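(* Let $0<T<\infty$ and let $u_1$ and $u_2$ be two real-valued solutions of the Short Wave equation on $[0,\infty)\times[0,T]$ such that, for $i=1,2$, (i) $u_i(\cdot,t)\in H^4(0,\infty)$ and $u_{i,xx}(\cdot,t)\in H^{2,1}(0,\infty)$ for all $t\in[0,T]$; (ii) $1-u_{i,xx}(x,0)>0$ for all $x\ge0$; (iii) $u_i(0,t)\le0$ for all $0\le t\le T$. If $u_1(x,0)=u_2(x,0)$ for all $x\ge0$, then $u_1(x,t)=u_2(x,t)$ for all $x\ge0$ and $0\le t<T$.
   Context: The Short Wave equation is $u_{txx}-2u_x+2u_xu_{xx}+uu_{xxx}=0$; with $m=-u_{xx}$ and $m+1>0$ it is equivalent to $(\sqrt{m+1})_t=-(u\sqrt{m+1})_x$. Weighted Sobolev space: $H^{k,j}(\Omega)=\{f\in L^1_{\mathrm{loc}}(\Omega): f^{(l)},\,x^{2j}f^{(l)}\in L^2(\Omega),\ 0\le l\le k\}$, and $H^k=H^{k,0}$. *)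

theory Defs
  imports "HOL-Analysis.Analysis"
begin

subsection \<open>Weighted Sobolev spaces on subsets of the line\<close>

definition test_functions :: "real set \<Rightarrow> (real \<Rightarrow> real) set" where
  "test_functions \<Omega> = {\<phi>.
     (\<forall>n x. (deriv ^^ n) \<phi> field_differentiable at x) \<and>
     compact (closure {x. \<phi> x \<noteq> 0}) \<and> closure {x. \<phi> x \<noteq> 0} \<subseteq> \<Omega>}"

definition L1_loc :: "real set \<Rightarrow> (real \<Rightarrow> real) set" where
  "L1_loc \<Omega> = {f. \<forall>K. compact K \<and> K \<subseteq> \<Omega> \<longrightarrow> integrable (lebesgue_on K) f}"

definition L2 :: "real set \<Rightarrow> (real \<Rightarrow> real) set" where
  "L2 \<Omega> = {f. f \<in> borel_measurable (lebesgue_on \<Omega>) \<and>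
               integrable (lebesgue_on \<Omega>) (\<lambda>x. (f x)\<^sup>2)}"

definition weak_derivative :: "real set \<Rightarrow> nat \<Rightarrow> (real \<Rightarrow> real) \<Rightarrow> (real \<Rightarrow> real) \<Rightarrow> bool" where
  "weak_derivative \<Omega> l f g \<longleftrightarrow> f \<in> L1_loc \<Omega> \<and> g \<in> L1_loc \<Omega> \<and>
     (\<forall>\<phi>\<in>test_functions \<Omega>.
        (\<integral>x. f x * (deriv ^^ l) \<phi> x \<partial>lebesgue_on \<Omega>)
          = (-1) ^ l * (\<integral>x. g x * \<phi> x \<partial>lebesgue_on \<Omega>))"

text \<open>
  The space $H^{k,j}(\Omega)$ for open \<open>\<Omega>\<close>; the derivatives \<open>f\<^sup>(\<^sup>l\<^sup>)\<close> are weak derivatives.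
  Elements are represented by functions on the whole line, of which only the restriction
  to \<open>\<Omega>\<close> (up to null sets) matters.  A weak derivative is unique up to null sets,
  so the choice of \<open>g\<close> is immaterial.
\<close>

definition weighted_sobolev :: "nat \<Rightarrow> nat \<Rightarrow> real set \<Rightarrow> (real \<Rightarrow> real) set" where
  "weighted_sobolev k j \<Omega> = {f. f \<in> L1_loc \<Omega> \<and>
     (\<forall>l\<le>k. \<exists>g. weak_derivative \<Omega> l f g \<and> g \<in> L2 \<Omega> \<and> (\<lambda>x. x ^ (2 * j) * g x) \<in> L2 \<Omega>)}"

abbreviation sobolev :: "nat \<Rightarrow> real set \<Rightarrow> (real \<Rightarrow> real) set" where
  "sobolev k \<equiv> weighted_sobolev k 0"


subsection \<open>Classical solutions of the Short Wave equation on a half-strip\<close>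

text \<open>
  Partial derivatives of a function \<open>u x t\<close> on $[0,\infty)\times[0,T]$.  They are taken within
  the domain, hence one-sided at \<open>x = 0\<close>, \<open>t = 0\<close> and \<open>t = T\<close>.
\<close>

definition partial_x :: "(real \<Rightarrow> real \<Rightarrow> real) \<Rightarrow> real \<Rightarrow> real \<Rightarrow> real" where
  "partial_x u x t = vector_derivative (\<lambda>y. u y t) (at x within {0..})"

definition partial_t :: "real \<Rightarrow> (real \<Rightarrow> real \<Rightarrow> real) \<Rightarrow> real \<Rightarrow> real \<Rightarrow> real" where
  "partial_t T u x t = vector_derivative (\<lambda>s. u x s) (at t within {0..T})"

definition cont_partial_x :: "real \<Rightarrow> (real \<Rightarrow> real \<Rightarrow> real) \<Rightarrow> bool" where
  "cont_partial_x T u \<longleftrightarrow>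
     (\<forall>x\<ge>0. \<forall>t\<in>{0..T}. (\<lambda>y. u y t) differentiable (at x within {0..})) \<and>
     continuous_on ({0..} \<times> {0..T}) (\<lambda>(x, t). partial_x u x t)"

definition cont_partial_t :: "real \<Rightarrow> (real \<Rightarrow> real \<Rightarrow> real) \<Rightarrow> bool" where
  "cont_partial_t T u \<longleftrightarrow>
     (\<forall>x\<ge>0. \<forall>t\<in>{0..T}. (\<lambda>s. u x s) differentiable (at t within {0..T})) \<and>
     continuous_on ({0..} \<times> {0..T}) (\<lambda>(x, t). partial_t T u x t)"

text \<open>
  A solution is understood classically: \<open>u\<close> and the derivatives $u_x, u_{xx}, u_{xxx},
  u_t, u_{tx}, u_{txx}$ exist and are jointly continuous up to the boundary, and
  $u_{txx}-2u_x+2u_xu_{xx}+uu_{xxx}=0$ holds pointwise.  No uniformity in \<open>t\<close> of the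
  behaviour as \<open>x\<close> tends to infinity is required.
\<close>

definition short_wave_solution :: "real \<Rightarrow> (real \<Rightarrow> real \<Rightarrow> real) \<Rightarrow> bool" where
  "short_wave_solution T u \<longleftrightarrow>
     continuous_on ({0..} \<times> {0..T}) (\<lambda>(x, t). u x t) \<and>
     cont_partial_x T u \<and>
     cont_partial_x T (partial_x u) \<and>
     cont_partial_x T (partial_x (partial_x u)) \<and>
     cont_partial_t T u \<and>
     cont_partial_x T (partial_t T u) \<and>
     cont_partial_x T (partial_x (partial_t T u)) \<and>
     (\<forall>x\<ge>0. \<forall>t\<in>{0..T}.
        partial_x (partial_x (partial_t T u)) x t
          - 2 * partial_x u x t
          + 2 * partial_x u x t * partial_x (partial_x u) x t
          + u x t * partial_x (partial_x (partial_x u)) x t = 0)"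

end

theory Submission
  imports Defs
begin

text \<open>
Write \<open>p = u\<^sub>x\<close>, \<open>q = u\<^sub>x\<^sub>x\<close> and \<open>w = 1 - q\<close>.  Since \<open>(sqrt w)\<^sub>t = - (u sqrt w)\<^sub>x\<close>, the label \<open>y\<close> with
\<open>y\<^sub>x = sqrt w\<close>, \<open>y\<^sub>t = - u sqrt w\<close> is constant along particle paths.  In the coordinates \<open>(y, t)\<close> the
stretching \<open>e\<^sup>h = x\<^sub>y = 1 / sqrt w\<close> and the velocity gradient \<open>P = u\<^sub>x\<close> satisfy
\<open>h\<^sub>t = P\<close>, \<open>P\<^sub>y = 2 sinh h\<close>, that is, \<open>h\<close> solves the sinh-Gordon equation \<open>h\<^sub>t\<^sub>y = 2 sinh h\<close>, and the
initial values of \<open>h\<close> are determined by those of \<open>u\<close>.  For two solutions the relative energy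
\<open>R = cosh h\<^sub>1 - cosh h\<^sub>2 - sinh h\<^sub>2 (h\<^sub>1 - h\<^sub>2)\<close> obeys a balance law with flux \<open>(P\<^sub>1 - P\<^sub>2)\<^sup>2 / 4\<close> and a
source bounded by \<open>\<bar>P\<^sub>2\<bar> R\<close>.  At \<open>y = a\<close> the flux has the good sign, and at infinity it is
negligible on average as soon as \<open>P\<^sub>1\<close> and \<open>P\<^sub>2\<close> are in \<open>L\<^sup>2\<close> uniformly in time, so \<open>h\<^sub>1 = h\<^sub>2\<close>
(\<open>sinh_gordon_unique\<close>).  Then particle positions agree up to a shift depending on time only, and the
shift is \<open>0\<close> because \<open>u \<rightarrow> 0\<close> at infinity (\<open>eulerian_unique\<close>).  The condition \<open>u(0, t) \<le> 0\<close> says that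
particles only leave the half-line, so every particle present at a time was present initially.

The hypotheses give decay at infinity at each time separately, and the necessary uniformity in
time has to be proved.  It comes from two conserved densities whose fluxes have a favourable sign
for propagation backwards in time: \<open>p\<^sup>2\<close> with flux \<open>2 u\<^sup>2 + 2 bc u - u p\<^sup>2\<close> (\<open>energy_bound\<close>), where \<open>bc\<close>
is a continuous function of time, and \<open>(sqrt w - 1)\<^sup>2\<close> with flux \<open>p\<^sup>2 / 2 - u (sqrt w - 1)\<^sup>2\<close>
(\<open>excess_bound\<close>).  Integrating over regions whose right edge moves faster than the particles bounds
both integrals at all times by their values at the final time.  The first bound limits \<open>\<bar>u\<bar>\<close> to the
order of \<open>1 + sqrt x\<close>, so no particle comes from infinity in finite time and \<open>w\<close> stays positive
(\<open>w_pos\<close>); both together bound \<open>p\<close> (\<open>p_bounded\<close>) and the \<open>L\<^sup>2\<close> norm of \<open>P\<close>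
(\<open>weighted_energy_bound\<close>).
\<close>

section \<open>Smooth test functions\<close>

text \<open>
The smooth functions \<open>P(x) ((x - a)(b - x))\<^bsup>-k\<^esup> exp (- c / ((x - a)(b - x)))\<close> on \<open>(a, b)\<close>, extended by
\<open>0\<close>.  For polynomial \<open>P\<close> this family is closed under differentiation, and for \<open>k = 0\<close> and
\<open>c \<rightarrow> 0\<close> it tends boundedly to \<open>P\<close> on \<open>(a, b)\<close>.
\<close>

definition bump :: "real \<Rightarrow> real \<Rightarrow> real \<Rightarrow> (real \<Rightarrow> real) \<Rightarrow> nat \<Rightarrow> real \<Rightarrow> real" where
  "bump a b c P k x =
     (if a < x \<and> x < b then P x / ((x - a) * (b - x)) ^ k * exp (- c / ((x - a) * (b - x))) else 0)"

lemma power_div_fact_le_exp: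
  fixes z :: real
  assumes "0 \<le> z"
  shows "z ^ m / fact m \<le> exp z"
proof -
  have s: "(\<lambda>n. z ^ n /\<^sub>R fact n) sums exp z"
    by (rule exp_converges)
  have "(\<Sum>n\<in>{m}. z ^ n /\<^sub>R fact n) \<le> suminf (\<lambda>n. z ^ n /\<^sub>R fact n)"
    using s assms by (intro sum_le_suminf) (auto simp: sums_iff)
  also have "\<dots> = exp z"
    using s by (simp add: sums_iff)
  finally show ?thesis
    by (simp add: divide_inverse mult.commute)
qed

lemma exp_neg_inverse_le:
  fixes c y :: real
  assumes "0 < c" "0 < y"
  shows "exp (- c / y) \<le> fact m / c ^ m * y ^ m"
proof -
  have "(c / y) ^ m / fact m \<le> exp (c / y)"
    using assms by (intro power_div_fact_le_exp) auto
  then have "inverse (exp (c / y)) \<le> inverse ((c / y) ^ m / fact m)"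
    using assms by (intro le_imp_inverse_le) auto
  then show ?thesis
    using assms by (simp add: exp_minus power_divide field_simps)
qed

text \<open>
The exponential beats every power of \<open>(x - a)(b - x)\<close>; the quadratic decay at the end points
gives the derivative \<open>0\<close> there.
\<close>

lemma bump_le_square:
  assumes ab: "a < b" and c: "0 < c" and P: "real_polynomial_function P"
  shows "\<exists>C. \<forall>x. \<bar>bump a b c P k x\<bar> \<le> C * (x - a)\<^sup>2 \<and> \<bar>bump a b c P k x\<bar> \<le> C * (b - x)\<^sup>2"
proof -
  have "continuous_on {a..b} P"
    using P by (simp add: continuous_on_polymonial_function real_polynomial_function_eq)
  then have "bounded (P ` {a..b})"
    by (intro compact_imp_bounded compact_continuous_image) auto
  then obtain B where B: "\<And>x. x \<in> {a..b} \<Longrightarrow> \<bar>P x\<bar> \<le> B"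
    unfolding bounded_iff by (metis imageI real_norm_def)
  define D where "D = fact (k+2) / c ^ (k+2)"
  have D: "0 \<le> D" using c by (simp add: D_def)
  have B0: "0 \<le> B" using B[of a] ab by auto
  have key: "\<bar>bump a b c P k x\<bar> \<le> B * D * ((x - a) * (b - x))\<^sup>2" for x
  proof (cases "a < x \<and> x < b")
    case True
    define y where "y = (x - a) * (b - x)"
    have y: "0 < y" using True by (simp add: y_def)
    have "\<bar>bump a b c P k x\<bar> = \<bar>P x\<bar> / y ^ k * exp (- c / y)"
      using True y by (simp add: bump_def y_def[symmetric] abs_mult)
    also have "\<dots> \<le> B / y ^ k * (D * y ^ (k+2))"
      unfolding D_def using True y c B0
      by (intro mult_mono divide_right_mono B exp_neg_inverse_le) auto
    also have "\<dots> = B * D * y\<^sup>2"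
      using y by (simp add: field_simps power_add power2_eq_square)
    finally show ?thesis by (simp add: y_def)
  next
    case False
    then show ?thesis using B0 D by (auto simp: bump_def)
  qed
  have "\<bar>bump a b c P k x\<bar> \<le> B * D * (b - a)\<^sup>2 * (x - a)\<^sup>2 \<and>
        \<bar>bump a b c P k x\<bar> \<le> B * D * (b - a)\<^sup>2 * (b - x)\<^sup>2" for x
  proof (cases "a < x \<and> x < b")
    case True
    have sq: "(x - a)\<^sup>2 \<le> (b - a)\<^sup>2" "(b - x)\<^sup>2 \<le> (b - a)\<^sup>2"
      using True by (auto intro!: power_mono)
    have BD: "0 \<le> B * D" using B0 D by simp
    have "((x - a) * (b - x))\<^sup>2 \<le> (b - a)\<^sup>2 * (x - a)\<^sup>2"
      using mult_right_mono[OF sq(2), of "(x - a)\<^sup>2"] by (simp add: power_mult_distrib mult.commute)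
    then have "\<bar>bump a b c P k x\<bar> \<le> B * D * ((b - a)\<^sup>2 * (x - a)\<^sup>2)"
      by (intro order_trans[OF key] mult_left_mono BD)
    moreover have "((x - a) * (b - x))\<^sup>2 \<le> (b - a)\<^sup>2 * (b - x)\<^sup>2"
      using mult_right_mono[OF sq(1), of "(b - x)\<^sup>2"] by (simp add: power_mult_distrib mult.commute)
    then have "\<bar>bump a b c P k x\<bar> \<le> B * D * ((b - a)\<^sup>2 * (b - x)\<^sup>2)"
      by (intro order_trans[OF key] mult_left_mono BD)
    ultimately show ?thesis by (simp add: mult.assoc)
  next
    case False
    then show ?thesis using B0 D by (auto simp: bump_def)
  qed
  then show ?thesis by blast
qed

lemma has_real_derivative_zero_of_quadratic_bound:
  fixes f :: "real \<Rightarrow> real"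
  assumes "\<And>y. \<bar>f y\<bar> \<le> C * (y - x)\<^sup>2"
  shows "(f has_real_derivative 0) (at x)"
proof -
  have f0: "f x = 0" using assms[of x] by simp
  have "((\<lambda>y. \<bar>C\<bar> * \<bar>y - x\<bar>) \<longlongrightarrow> \<bar>C\<bar> * \<bar>x - x\<bar>) (at x)"
    by (intro tendsto_intros)
  then have lim: "((\<lambda>y. \<bar>C\<bar> * \<bar>y - x\<bar>) \<longlongrightarrow> 0) (at x)"
    by simp
  have le: "norm ((f y - f x) / (y - x)) \<le> \<bar>C\<bar> * \<bar>y - x\<bar>" if "y \<noteq> x" for y
  proof -
    have "\<bar>f y\<bar> \<le> C * (y - x)\<^sup>2" by (rule assms)
    also have "\<dots> \<le> \<bar>C\<bar> * (y - x)\<^sup>2" by (intro mult_right_mono) auto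
    also have "\<dots> = \<bar>C\<bar> * \<bar>y - x\<bar> * \<bar>y - x\<bar>"
      by (simp add: power2_eq_square)
    finally show ?thesis
      using that f0 by (simp add: pos_divide_le_eq)
  qed
  have "((\<lambda>y. (f y - f x) / (y - x)) \<longlongrightarrow> 0) (at x)"
    by (rule Lim_null_comparison[OF _ lim]) (use le in \<open>auto simp: eventually_at_filter\<close>)
  then show ?thesis
    by (simp add: has_field_derivative_iff)
qed

lemma bump_deriv:
  assumes ab: "a < b" and c: "0 < c" and P: "real_polynomial_function P"
  shows "\<exists>Q. real_polynomial_function Q \<and>
     (\<forall>x. (bump a b c P k has_real_derivative bump a b c Q (k+2) x) (at x))"
proof -
  obtain P' where P': "real_polynomial_function P'" "\<And>x. (P has_real_derivative P' x) (at x)"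
    using has_real_derivative_polynomial_function[OF P] by blast
  define Q where "Q = (\<lambda>x. P' x * ((x - a) * (b - x))\<^sup>2 - real k * P x * (a + b - 2 * x) * ((x - a) * (b - x))
      + c * P x * (a + b - 2 * x))"
  have id: "real_polynomial_function (\<lambda>x. x :: real)"
    by (rule real_polynomial_function.intros(1)) (rule bounded_linear_ident)
  have Q: "real_polynomial_function Q"
    unfolding Q_def using P P'(1) id
    by (intro real_polynomial_function.intros(2-) real_polynomial_function_diff real_polynomial_function_power)
  obtain C where C: "\<And>x. \<bar>bump a b c P k x\<bar> \<le> C * (x - a)\<^sup>2" "\<And>x. \<bar>bump a b c P k x\<bar> \<le> C * (b - x)\<^sup>2"
    using bump_le_square[OF ab c P] by blast
  have alg: "(p' * y ^ k - p * (real k * y ^ (k - 1) * d)) / (y ^ k * y ^ k) * E + E * (c * d / y\<^sup>2) * (p / y ^ k)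
      = (p' * y\<^sup>2 - real k * p * d * y + c * p * d) / y ^ (k + 2) * E" if "y > 0" for y p' p d E :: real and k :: nat
  proof (cases k)
    case 0
    then show ?thesis using that by (simp add: field_simps power2_eq_square)
  next
    case (Suc j)
    define z K where "z = y ^ j" and "K = real k"
    have z: "z > 0" using that by (simp add: z_def)
    have "(p' * (y * z) - p * (K * z * d)) / (y * z * (y * z)) * E + E * (c * d / (y * y)) * (p / (y * z))
      = (p' * (y * y) - K * p * d * y + c * p * d) / (y * y * (y * z)) * E"
    proof -
      have "(p' * (y * z) - p * (K * z * d)) / (y * z * (y * z)) = (p' * (y * y) - K * p * d * y) / (y * y * (y * z))"
        using that z by (simp add: frac_eq_eq) (simp add: algebra_simps)
      moreover have "E * (c * d / (y * y)) * (p / (y * z)) = c * p * d / (y * y * (y * z)) * E"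
        by simp
      ultimately show ?thesis
        by (simp only: distrib_right[symmetric] add_divide_distrib[symmetric])
    qed
    moreover have "y ^ k = y * z" "real k = K" "y ^ (k - 1) = z" "y ^ (k + 2) = y * y * (y * z)" "y\<^sup>2 = y * y"
      using Suc by (simp_all add: z_def K_def power2_eq_square mult.assoc)
    ultimately show ?thesis by (simp only:)
  qed
  have "(bump a b c P k has_real_derivative bump a b c Q (k+2) x) (at x)" for x
  proof -
    consider "x < a" | "x = a" | "a < x \<and> x < b" | "x = b" | "b < x" by linarith
    then show ?thesis
    proof cases
      case 1
      have "((\<lambda>_. 0) has_real_derivative 0) (at x)" by simp
      then have "(bump a b c P k has_real_derivative 0) (at x)"
        by (rule has_field_derivative_transform_within_open[where S="{..<a}"])
           (use 1 in \<open>auto simp: bump_def\<close>)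
      then show ?thesis using 1 by (simp add: bump_def)
    next
      case 5
      have "((\<lambda>_. 0) has_real_derivative 0) (at x)" by simp
      then have "(bump a b c P k has_real_derivative 0) (at x)"
        by (rule has_field_derivative_transform_within_open[where S="{b<..}"])
           (use 5 in \<open>auto simp: bump_def\<close>)
      then show ?thesis using 5 by (simp add: bump_def)
    next
      case 2
      then have "(bump a b c P k has_real_derivative 0) (at x)"
        using C(1) by (intro has_real_derivative_zero_of_quadratic_bound) auto
      then show ?thesis using 2 by (simp add: bump_def)
    next
      case 4
      then have "(bump a b c P k has_real_derivative 0) (at x)"
        using C(2) by (intro has_real_derivative_zero_of_quadratic_bound) (auto simp: power2_commute[of _ b])
      then show ?thesis using 4 by (simp add: bump_def)
    next
      case 3
      define y where "y = (x - a) * (b - x)"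
      have y: "y > 0" using 3 by (simp add: y_def)
      have dy: "((\<lambda>x. (x - a) * (b - x)) has_real_derivative (a + b - 2 * x)) (at x)"
        by (auto intro!: derivative_eq_intros)
      have d1: "((\<lambda>x. ((x - a) * (b - x)) ^ k) has_real_derivative real k * y ^ (k - 1) * (a + b - 2 * x)) (at x)"
        using DERIV_power[OF dy, of k] by (simp add: y_def algebra_simps)
      have d2: "((\<lambda>x. exp (- c / ((x - a) * (b - x)))) has_real_derivative
            exp (- c / y) * (c * (a + b - 2 * x) / y\<^sup>2)) (at x)"
        using y unfolding y_def
        by (auto intro!: derivative_eq_intros dy simp: power2_eq_square)
      have d3: "((\<lambda>x. P x / ((x - a) * (b - x)) ^ k) has_real_derivative
          (P' x * y ^ k - P x * (real k * y ^ (k - 1) * (a + b - 2 * x))) / (y ^ k * y ^ k)) (at x)"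
      proof -
        have "((x - a) * (b - x)) ^ k \<noteq> 0" using y unfolding y_def by (metis less_irrefl power_not_zero)
        from DERIV_divide[OF P'(2)[of x] d1 this] show ?thesis by (simp only: y_def)
      qed
      have "((\<lambda>x. P x / ((x - a) * (b - x)) ^ k * exp (- c / ((x - a) * (b - x)))) has_real_derivative
          (P' x * y ^ k - P x * (real k * y ^ (k - 1) * (a + b - 2 * x))) / (y ^ k * y ^ k) * exp (- c / y)
          + exp (- c / y) * (c * (a + b - 2 * x) / y\<^sup>2) * (P x / y ^ k)) (at x)"
        using DERIV_mult[OF d3 d2] by (simp add: y_def)
      also have "(P' x * y ^ k - P x * (real k * y ^ (k - 1) * (a + b - 2 * x))) / (y ^ k * y ^ k) * exp (- c / y)
          + exp (- c / y) * (c * (a + b - 2 * x) / y\<^sup>2) * (P x / y ^ k) = bump a b c Q (k+2) x"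
        using 3 y alg[of y "P' x" k "P x" "a + b - 2 * x" "exp (- c / y)"]
        by (simp add: bump_def Q_def y_def[symmetric])
      finally show ?thesis
        by (rule has_field_derivative_transform_within_open[where S="{a<..<b}"])
           (use 3 in \<open>auto simp: bump_def\<close>)
    qed
  qed
  then show ?thesis using Q by blast
qed

lemma bump_test_function:
  assumes ab: "0 < a" "a < b" and c: "0 < c" and P: "real_polynomial_function P"
  shows "bump a b c P 0 \<in> test_functions {0<..}"
proof -
  have iter: "\<exists>Q k. real_polynomial_function Q \<and> (deriv ^^ n) (bump a b c P 0) = bump a b c Q k" for n
  proof (induction n)
    case 0
    then show ?case using P by auto
  next
    case (Suc n)
    then obtain Q k where Q: "real_polynomial_function Q" "(deriv ^^ n) (bump a b c P 0) = bump a b c Q k"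
      by blast
    obtain Q' where "real_polynomial_function Q'"
      "\<And>x. (bump a b c Q k has_real_derivative bump a b c Q' (k+2) x) (at x)"
      using bump_deriv[OF ab(2) c Q(1)] by blast
    then show ?case using Q(2) by (auto intro!: exI[of _ Q'] exI[of _ "k+2"] DERIV_imp_deriv)
  qed
  have 1: "(deriv ^^ n) (bump a b c P 0) field_differentiable at x" for n x
    using iter[of n] bump_deriv[OF ab(2) c] unfolding field_differentiable_def by metis
  have "{x. bump a b c P 0 x \<noteq> 0} \<subseteq> {a..b}"
    by (auto simp: bump_def split: if_splits)
  then have 2: "closure {x. bump a b c P 0 x \<noteq> 0} \<subseteq> {a..b}"
    by (intro closure_minimal) auto
  then have "compact (closure {x. bump a b c P 0 x \<noteq> 0})"
    by (metis closed_closure compact_Icc compact_Int_closed inf.absorb_iff2)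
  then show ?thesis
    unfolding test_functions_def using 1 2 ab by auto
qed

section \<open>Square integrability of continuous Sobolev functions\<close>

lemma continuous_on_bump:
  assumes "a < b" "0 < c" "real_polynomial_function P"
  shows "continuous_on UNIV (bump a b c P k)"
  using bump_deriv[OF assms, of k] by (metis DERIV_continuous_on has_field_derivative_at_within)

lemma integrable_lebesgue_on_subset:
  fixes f :: "real \<Rightarrow> real"
  assumes "integrable (lebesgue_on B) f" "A \<subseteq> B" "A \<in> sets lebesgue" "B \<in> sets lebesgue"
  shows "integrable (lebesgue_on A) f"
proof -
  have "set_integrable lebesgue B f"
    using assms by (simp add: set_integrable_def integrable_restrict_space)
  then have "set_integrable lebesgue A f"
    by (rule set_integrable_subset) (use assms in auto)
  then show ?thesis
    using assms by (simp add: set_integrable_def integrable_restrict_space)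
qed

lemma weak_derivative_0_test_polynomial:
  fixes f g P :: "real \<Rightarrow> real"
  assumes wd: "weak_derivative {0<..} 0 f g" and ab: "0 < a" "a < b" and P: "real_polynomial_function P"
  shows "(LINT x|lebesgue_on {a<..<b}. f x * P x) = (LINT x|lebesgue_on {a<..<b}. g x * P x)"
proof -
  let ?M = "lebesgue_on {a<..<b}"
  let ?\<phi> = "\<lambda>n::nat. bump a b (1 / real (Suc n)) P 0"
  have ss: "{a<..<b} \<subseteq> {0<..}" using ab by auto
  have cont: "continuous_on {a..b} P"
    using P by (simp add: continuous_on_polymonial_function real_polynomial_function_eq)
  then have "bounded (P ` {a..b})"
    by (intro compact_imp_bounded compact_continuous_image) auto
  then obtain B where B: "\<And>x. x \<in> {a..b} \<Longrightarrow> \<bar>P x\<bar> \<le> B"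
    unfolding bounded_iff by (metis imageI real_norm_def)
  have lim: "(\<lambda>n. LINT x|lebesgue_on {0<..}. h x * ?\<phi> n x) \<longlonglongrightarrow> (LINT x|?M. h x * P x)"
    if h: "h \<in> L1_loc {0<..}" for h
  proof -
    have "integrable (lebesgue_on {a..b}) h"
      using h ab unfolding L1_loc_def by (auto simp: subset_iff)
    then have hM: "integrable ?M h"
      by (rule integrable_lebesgue_on_subset) auto
    have *: "(LINT x|lebesgue_on {0<..}. h x * ?\<phi> n x) = (LINT x|?M. h x * ?\<phi> n x)" for n
    proof -
      have "(LINT x|lebesgue_on {0<..}. h x * ?\<phi> n x) =
            (LINT x|lebesgue_on {0<..}. (if x \<in> {a<..<b} then h x * ?\<phi> n x else 0))"
        by (intro Bochner_Integration.integral_cong) (auto simp: bump_def)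
      also have "\<dots> = (LINT x|lebesgue_on ({a<..<b} \<inter> {0<..}). h x * ?\<phi> n x)"
        by (rule Lebesgue_Measure.integral_restrict_Int) auto
      also have "{a<..<b} \<inter> {0<..} = {a<..<b}" using ss by auto
      finally show ?thesis .
    qed
    have "(\<lambda>n. LINT x|?M. h x * ?\<phi> n x) \<longlonglongrightarrow> (LINT x|?M. h x * P x)"
    proof (rule integral_dominated_convergence[where w = "\<lambda>x. \<bar>h x\<bar> * B"])
      have mP: "P \<in> borel_measurable ?M"
        by (rule continuous_imp_measurable_on_sets_lebesgue)
           (use cont in \<open>auto intro: continuous_on_subset\<close>)
      show "(\<lambda>x. h x * P x) \<in> borel_measurable ?M"
        using hM mP by (intro borel_measurable_times) auto
      show "(\<lambda>x. h x * ?\<phi> n x) \<in> borel_measurable ?M" for n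
      proof -
        have "?\<phi> n \<in> borel_measurable ?M"
          by (rule continuous_imp_measurable_on_sets_lebesgue)
             (use continuous_on_bump[OF ab(2) _ P, of "1 / real (Suc n)" 0] in \<open>auto intro: continuous_on_subset\<close>)
        then show ?thesis using hM by (intro borel_measurable_times) auto
      qed
      show "integrable ?M (\<lambda>x. \<bar>h x\<bar> * B)" using hM by auto
      show "AE x in ?M. (\<lambda>n. h x * ?\<phi> n x) \<longlonglongrightarrow> h x * P x"
      proof (intro AE_I2)
        fix x assume "x \<in> space ?M"
        then have x: "a < x" "x < b" by auto
        have "(\<lambda>n. h x * (P x * exp (- (1 / real (Suc n)) / ((x - a) * (b - x))))) \<longlonglongrightarrow>
              h x * (P x * exp (- 0 / ((x - a) * (b - x))))"
          using x by (intro tendsto_intros LIMSEQ_Suc[OF lim_1_over_n]) auto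
        then show "(\<lambda>n. h x * ?\<phi> n x) \<longlonglongrightarrow> h x * P x"
          using x by (simp add: bump_def)
      qed
      show "AE x in ?M. norm (h x * ?\<phi> n x) \<le> \<bar>h x\<bar> * B" for n
      proof (intro AE_I2)
        fix x assume "x \<in> space ?M"
        then have x: "a < x" "x < b" by auto
        then have y: "(x - a) * (b - x) > 0" by simp
        have "\<bar>P x\<bar> * exp (- (1 / real (Suc n)) / ((x - a) * (b - x))) \<le> B * 1"
          using x y B[of x] by (intro mult_mono) (auto simp: divide_nonneg_pos)
        then have "\<bar>?\<phi> n x\<bar> \<le> B"
          using x y by (simp add: bump_def abs_mult)
        then show "norm (h x * ?\<phi> n x) \<le> \<bar>h x\<bar> * B"
          by (simp add: abs_mult mult_left_mono)
      qed
    qed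
    then show ?thesis by (simp only: *)
  qed
  have eq: "(LINT x|lebesgue_on {0<..}. f x * ?\<phi> n x) = (LINT x|lebesgue_on {0<..}. g x * ?\<phi> n x)" for n
  proof -
    have "?\<phi> n \<in> test_functions {0<..}"
      by (intro bump_test_function ab P) auto
    then show ?thesis using wd by (simp add: weak_derivative_def)
  qed
  show ?thesis
    using LIMSEQ_unique[OF lim[of f] lim[of g, folded eq]] wd by (simp add: weak_derivative_def)
qed

text \<open>
The form of the fundamental lemma of the calculus of variations that is needed here: if a
continuous \<open>f\<close> and \<open>g \<in> L\<^sup>2\<close> define the same distribution, then \<open>f\<close> has no larger \<open>L\<^sup>2\<close> norm
than \<open>g\<close>.  Testing with polynomials that approximate \<open>f\<close> uniformly gives
\<open>\<integral> f\<^sup>2 \<le> \<integral> g f\<close> on every compact interval.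
\<close>

lemma weak_derivative_0_square_integral_le:
  fixes f g :: "real \<Rightarrow> real"
  assumes wd: "weak_derivative {0<..} 0 f g" and g: "g \<in> L2 {0<..}"
    and ab: "0 < a" "a < b" and f: "continuous_on {a..b} f"
  shows "integral {a..b} (\<lambda>x. (f x)\<^sup>2) \<le> (LINT x|lebesgue_on {0<..}. (g x)\<^sup>2)"
proof -
  let ?M = "lebesgue_on {a<..<b}"
  have sub: "integrable ?M h" if "integrable (lebesgue_on {a..b}) h" for h :: "real \<Rightarrow> real"
    using that by (rule integrable_lebesgue_on_subset) auto
  have subI: "integrable ?M h" if "continuous_on {a..b} h" for h :: "real \<Rightarrow> real"
    using that by (intro sub continuous_imp_integrable_real)
  have fI: "integrable ?M f" using f by (rule subI)
  have gI: "integrable ?M g"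
    using wd ab unfolding weak_derivative_def L1_loc_def by (intro sub) (auto simp: subset_iff)
  have f2I: "integrable ?M (\<lambda>x. (f x)\<^sup>2)"
    by (intro subI continuous_intros f)
  have g2: "integrable (lebesgue_on {0<..}) (\<lambda>x. (g x)\<^sup>2)"
    using g by (simp add: L2_def)
  have g2I: "integrable ?M (\<lambda>x. (g x)\<^sup>2)"
  proof (rule integrable_lebesgue_on_subset[OF g2])
    show "{a<..<b} \<subseteq> {0<..}" using ab by auto
  qed auto
  have gfI: "integrable ?M (\<lambda>x. g x * h x)" if h: "continuous_on {a..b} h" for h
  proof -
    have "bounded (h ` {a..b})"
      by (intro compact_imp_bounded compact_continuous_image h) auto
    then obtain B where B: "\<And>x. x \<in> {a..b} \<Longrightarrow> \<bar>h x\<bar> \<le> B"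
      unfolding bounded_iff by (metis imageI real_norm_def)
    have "integrable ?M (\<lambda>x. B * g x)" using gI by simp
    then show ?thesis
    proof (rule Bochner_Integration.integrable_bound)
      show "(\<lambda>x. g x * h x) \<in> borel_measurable ?M"
        using gI subI[OF h] by (intro borel_measurable_times) auto
      show "AE x in ?M. norm (g x * h x) \<le> norm (B * g x)"
      proof (intro AE_I2)
        fix x assume "x \<in> space ?M"
        then have "\<bar>h x\<bar> \<le> \<bar>B\<bar>" using B[of x] by auto
        then show "norm (g x * h x) \<le> norm (B * g x)"
          using mult_left_mono[of "\<bar>h x\<bar>" "\<bar>B\<bar>" "\<bar>g x\<bar>"] by (simp add: abs_mult mult.commute)
      qed
    qed
  qed
  let ?A = "LINT x|?M. \<bar>f x\<bar> + \<bar>g x\<bar>"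
  have A: "integrable ?M (\<lambda>x. \<bar>f x\<bar> + \<bar>g x\<bar>)" using fI gI by auto
  have A0: "0 \<le> ?A" by (intro Bochner_Integration.integral_nonneg) auto
  have eps: "(LINT x|?M. (f x)\<^sup>2) \<le> (LINT x|?M. g x * f x) + e * ?A" if e: "0 < e" for e
  proof -
    obtain P where P: "real_polynomial_function P" "\<And>x. x \<in> {a..b} \<Longrightarrow> \<bar>f x - P x\<bar> < e"
      using Stone_Weierstrass_real_polynomial_function[of "{a..b}" f e] f e by auto
    have cP: "continuous_on {a..b} P"
      using P by (simp add: continuous_on_polymonial_function real_polynomial_function_eq)
    have fPI: "integrable ?M (\<lambda>x. f x * P x)"
      by (intro subI continuous_intros f cP)
    have "(LINT x|?M. (f x)\<^sup>2) - (LINT x|?M. g x * f x) =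
          (LINT x|?M. (f x)\<^sup>2) - (LINT x|?M. g x * f x) - ((LINT x|?M. f x * P x) - (LINT x|?M. g x * P x))"
      using weak_derivative_0_test_polynomial[OF wd ab P(1)] by simp
    also have "\<dots> = (LINT x|?M. ((f x)\<^sup>2 - g x * f x) - (f x * P x - g x * P x))"
      using f2I gfI[OF f] gfI[OF cP] fPI by simp
    also have "\<dots> \<le> (LINT x|?M. e * (\<bar>f x\<bar> + \<bar>g x\<bar>))"
    proof (rule integral_mono)
      show "integrable ?M (\<lambda>x. ((f x)\<^sup>2 - g x * f x) - (f x * P x - g x * P x))"
        using f2I gfI[OF f] gfI[OF cP] fPI by auto
      show "integrable ?M (\<lambda>x. e * (\<bar>f x\<bar> + \<bar>g x\<bar>))" using A by auto
      fix x assume "x \<in> space ?M"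
      then have "\<bar>f x - P x\<bar> \<le> e" using P(2)[of x] by auto
      then have "\<bar>f x - g x\<bar> * \<bar>f x - P x\<bar> \<le> (\<bar>f x\<bar> + \<bar>g x\<bar>) * e"
        by (intro mult_mono) auto
      moreover have "((f x)\<^sup>2 - g x * f x) - (f x * P x - g x * P x) = (f x - g x) * (f x - P x)"
        by (simp add: algebra_simps power2_eq_square)
      ultimately show "((f x)\<^sup>2 - g x * f x) - (f x * P x - g x * P x) \<le> e * (\<bar>f x\<bar> + \<bar>g x\<bar>)"
        by (metis abs_le_D1 abs_mult mult.commute)
    qed
    also have "\<dots> = e * ?A" by simp
    finally show ?thesis by simp
  qed
  have fg: "(LINT x|?M. (f x)\<^sup>2) \<le> (LINT x|?M. g x * f x)"
  proof (rule field_le_epsilon)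
    fix e :: real assume "0 < e"
    have scale: "0 < e / (r + 1) \<and> e / (r + 1) * r \<le> e" if "0 \<le> r" for r :: real
      using that \<open>0 < e\<close> by (simp add: divide_simps mult_left_mono)
    have "(LINT x|?M. (f x)\<^sup>2) \<le> (LINT x|?M. g x * f x) + e / (?A + 1) * ?A"
      by (rule eps) (use scale[OF A0] in blast)
    also have "e / (?A + 1) * ?A \<le> e"
      using scale[OF A0] by blast
    finally show "(LINT x|?M. (f x)\<^sup>2) \<le> (LINT x|?M. g x * f x) + e" by simp
  qed
  also have "(LINT x|?M. g x * f x) \<le> (LINT x|?M. (g x)\<^sup>2 / 2 + (f x)\<^sup>2 / 2)"
  proof (rule integral_mono)
    fix x
    have "0 \<le> (g x - f x)\<^sup>2" by simp
    then show "g x * f x \<le> (g x)\<^sup>2 / 2 + (f x)\<^sup>2 / 2"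
      by (simp add: power2_diff field_simps)
  qed (use gfI[OF f] f2I g2I in auto)
  also have "\<dots> = (LINT x|?M. (g x)\<^sup>2) / 2 + (LINT x|?M. (f x)\<^sup>2) / 2"
    using f2I g2I by simp
  finally have "(LINT x|?M. (f x)\<^sup>2) \<le> (LINT x|?M. (g x)\<^sup>2)" by simp
  moreover have "(LINT x|?M. (f x)\<^sup>2) = integral {a..b} (\<lambda>x. (f x)\<^sup>2)"
    by (subst lebesgue_integral_eq_integral[OF f2I]) (auto simp: integral_open_interval_real)
  moreover have "(LINT x|?M. (g x)\<^sup>2) = integral {a<..<b} (\<lambda>x. (g x)\<^sup>2)"
    by (subst lebesgue_integral_eq_integral[OF g2I]) auto
  moreover have "integral {a<..<b} (\<lambda>x. (g x)\<^sup>2) \<le> integral {0<..} (\<lambda>x. (g x)\<^sup>2)"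
    using ab by (intro integral_subset_le integrable_on_lebesgue_on g2 g2I) auto
  moreover have "(LINT x|lebesgue_on {0<..}. (g x)\<^sup>2) = integral {0<..} (\<lambda>x. (g x)\<^sup>2)"
    by (rule lebesgue_integral_eq_integral[OF g2]) auto
  ultimately show ?thesis by simp
qed

text \<open>
A member of a weighted Sobolev space on \<open>(0, \<infinity>)\<close> that is continuous on \<open>[0, \<infinity>)\<close> is square
integrable.  Its weak derivative of order \<open>0\<close> controls the integral over \<open>[1, x]\<close>; over \<open>[0, 1]\<close>
continuity suffices.
\<close>

lemma weighted_sobolev_square_integral_bounded:
  assumes f: "f \<in> weighted_sobolev k j {0<..}" and c: "continuous_on {0..} f"
  shows "\<exists>C\<ge>0. \<forall>x\<ge>0. integral {0..x} (\<lambda>x. (f x)\<^sup>2) \<le> C"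
proof -
  obtain g where g: "weak_derivative {0<..} 0 f g" "g \<in> L2 {0<..}"
    using f unfolding weighted_sobolev_def by blast
  define C where "C = integral {0..1} (\<lambda>x. (f x)\<^sup>2) + (LINT x|lebesgue_on {0<..}. (g x)\<^sup>2)"
  have i: "(\<lambda>x. (f x)\<^sup>2) integrable_on {u..v}" if "0 \<le> u" for u v
    using that by (intro integrable_continuous_real continuous_intros continuous_on_subset[OF c]) auto
  have g0: "0 \<le> (LINT x|lebesgue_on {0<..}. (g x)\<^sup>2)"
    by (intro Bochner_Integration.integral_nonneg) auto
  have "integral {0..x} (\<lambda>x. (f x)\<^sup>2) \<le> C" if x: "0 \<le> x" for x
  proof (cases "x \<le> 1")
    case True
    have "integral {0..x} (\<lambda>x. (f x)\<^sup>2) \<le> integral {0..1} (\<lambda>x. (f x)\<^sup>2)"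
      using True x by (intro integral_subset_le i) auto
    then show ?thesis using g0 unfolding C_def by linarith
  next
    case False
    have "integral {0..x} (\<lambda>x. (f x)\<^sup>2) = integral {0..1} (\<lambda>x. (f x)\<^sup>2) + integral {1..x} (\<lambda>x. (f x)\<^sup>2)"
      using False by (intro Henstock_Kurzweil_Integration.integral_combine[symmetric] i) auto
    also have "integral {1..x} (\<lambda>x. (f x)\<^sup>2) \<le> (LINT x|lebesgue_on {0<..}. (g x)\<^sup>2)"
      using False by (intro weak_derivative_0_square_integral_le[OF g] continuous_on_subset[OF c]) auto
    finally show ?thesis by (simp add: C_def)
  qed
  moreover have "0 \<le> C"
    using g0 by (auto simp: C_def intro!: add_nonneg_nonneg Henstock_Kurzweil_Integration.integral_nonneg i)
  ultimately show ?thesis by blast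
qed

section \<open>Calculus on a half-strip\<close>

text \<open>
Continuously differentiable functions on \<open>[0, \<infinity>) \<times> [0, T]\<close> with partial derivatives \<open>fx\<close> and
\<open>ft\<close>, which are one-sided on the boundary.
\<close>

definition C1_strip :: "real \<Rightarrow> (real \<Rightarrow> real \<Rightarrow> real) \<Rightarrow> (real \<Rightarrow> real \<Rightarrow> real) \<Rightarrow> (real \<Rightarrow> real \<Rightarrow> real) \<Rightarrow> bool" where
  "C1_strip T f fx ft \<longleftrightarrow>
     (\<forall>x\<ge>0. \<forall>t\<in>{0..T}. ((\<lambda>x. f x t) has_real_derivative fx x t) (at x within {0..}) \<and>
                        ((\<lambda>t. f x t) has_real_derivative ft x t) (at t within {0..T})) \<and>
     continuous_on ({0..} \<times> {0..T}) (\<lambda>(x, t). fx x t) \<and>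
     continuous_on ({0..} \<times> {0..T}) (\<lambda>(x, t). ft x t)"

lemma C1_strip_has_derivative:
  assumes f: "C1_strip T f fx ft" and x: "0 \<le> x" "t \<in> {0..T}"
  shows "((\<lambda>(x, t). f x t) has_derivative (\<lambda>(h, k). fx x t * h + ft x t * k)) (at (x, t) within {0..} \<times> {0..T})"
proof -
  have ft: "continuous_on ({0..} \<times> {0..T}) (\<lambda>z. blinfun_mult_right ((\<lambda>(x, t). ft x t) z))"
    using f by (intro continuous_intros) (simp add: C1_strip_def)
  have "((\<lambda>(x, t). f x t) has_derivative (\<lambda>(h, k). fx x t * h + blinfun_apply (blinfun_mult_right (ft x t)) k))
      (at (x, t) within {0..} \<times> {0..T})"
  proof (rule has_derivative_partialsI[where fx = "\<lambda>h. fx x t * h" and fy = "\<lambda>x t. blinfun_mult_right (ft x t)"])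
    show "((\<lambda>x. f x t) has_derivative (\<lambda>h. fx x t * h)) (at x within {0..})"
      using f x by (auto simp: C1_strip_def has_field_derivative_def)
    show "((\<lambda>y. f x y) has_derivative blinfun_apply (blinfun_mult_right (ft x y))) (at y within {0..T})"
      if "x \<in> {0..}" "y \<in> {0..T}" for x y
      using f that by (auto simp: C1_strip_def has_field_derivative_def)
    show "continuous (at (x, t) within {0..} \<times> {0..T}) (\<lambda>(x, y). blinfun_mult_right (ft x y))"
      using ft x by (simp add: continuous_on_eq_continuous_within case_prod_beta')
  qed (use x in auto)
  then show ?thesis by simp
qed

lemma C1_strip_continuous_on:
  assumes f: "C1_strip T f fx ft"
  shows "continuous_on ({0..} \<times> {0..T}) (\<lambda>(x, t). f x t)"
  unfolding continuous_on_eq_continuous_within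
proof
  fix z :: "real \<times> real" assume "z \<in> {0..} \<times> {0..T}"
  then obtain x t where "z = (x, t)" "0 \<le> x" "t \<in> {0..T}" by auto
  then show "continuous (at z within {0..} \<times> {0..T}) (\<lambda>(x, t). f x t)"
    using has_derivative_continuous[OF C1_strip_has_derivative[OF f, of x t]] by simp
qed

lemma C1_strip_chain:
  assumes f: "C1_strip T f fx ft" and S: "S \<subseteq> {0..T}" "\<tau> \<in> S" and \<xi>0: "\<And>s. s \<in> S \<Longrightarrow> 0 \<le> \<xi> s"
    and \<xi>: "(\<xi> has_real_derivative d) (at \<tau> within S)"
  shows "((\<lambda>s. f (\<xi> s) s) has_real_derivative fx (\<xi> \<tau>) \<tau> * d + ft (\<xi> \<tau>) \<tau>) (at \<tau> within S)"
proof -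
  have "((\<lambda>(x, t). f x t) has_derivative (\<lambda>(h, k). fx (\<xi> \<tau>) \<tau> * h + ft (\<xi> \<tau>) \<tau> * k))
      (at (\<xi> \<tau>, \<tau>) within {0..} \<times> {0..T})"
    using S \<xi>0 by (intro C1_strip_has_derivative[OF f]) auto
  then have 1: "((\<lambda>(x, t). f x t) has_derivative (\<lambda>(h, k). fx (\<xi> \<tau>) \<tau> * h + ft (\<xi> \<tau>) \<tau> * k))
      (at (\<xi> \<tau>, \<tau>) within (\<lambda>s. (\<xi> s, s)) ` S)"
    by (rule has_derivative_subset) (use S \<xi>0 in auto)
  have 2: "((\<lambda>s. (\<xi> s, s)) has_derivative (\<lambda>h. (d * h, h))) (at \<tau> within S)"
    using \<xi> by (intro derivative_intros) (simp add: has_field_derivative_def)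
  have 3: "(\<lambda>h. fx (\<xi> \<tau>) \<tau> * (d * h) + ft (\<xi> \<tau>) \<tau> * h) = (*) (fx (\<xi> \<tau>) \<tau> * d + ft (\<xi> \<tau>) \<tau>)"
    by (auto simp: fun_eq_iff algebra_simps)
  show ?thesis
    using has_derivative_in_compose[OF 2 1] by (simp add: has_field_derivative_def 3)
qed

lemma integral_upper_limit_has_real_derivative:
  fixes g :: "real \<Rightarrow> real"
  assumes g: "continuous_on {a..} g" and x: "a \<le> x"
  shows "((\<lambda>x. integral {a..x} g) has_real_derivative g x) (at x within {a..})"
proof -
  have "((\<lambda>x. integral {a..x} g) has_real_derivative g x) (at x within {a..x+1})"
    by (rule integral_has_real_derivative) (use x in \<open>auto intro: continuous_on_subset[OF g]\<close>)
  moreover have "at x within {a..x+1} = at x within {a..}"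
    by (rule at_within_nhd[of _ "{..<x+1}"]) (use x in auto)
  ultimately show ?thesis by simp
qed

lemma continuous_on_slice_x:
  assumes "continuous_on (A \<times> B) (\<lambda>(x, t). f x t)" "t \<in> B"
  shows "continuous_on A (\<lambda>x. f x t)"
proof -
  have "continuous_on A (\<lambda>x. (\<lambda>(x, t). f x t) (x, t))"
    by (rule continuous_on_compose2[OF assms(1)]) (use assms(2) in \<open>auto intro!: continuous_intros\<close>)
  then show ?thesis by simp
qed

lemma continuous_on_slice_t:
  assumes "continuous_on (A \<times> B) (\<lambda>(x, t). f x t)" "x \<in> A"
  shows "continuous_on B (\<lambda>t. f x t)"
proof -
  have "continuous_on B (\<lambda>t. (\<lambda>(x, t). f x t) (x, t))"
    by (rule continuous_on_compose2[OF assms(1)]) (use assms(2) in \<open>auto intro!: continuous_intros\<close>)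
  then show ?thesis by simp
qed

lemma continuous_on_swap_args:
  assumes "continuous_on (A \<times> B) (\<lambda>(x, t). f x t)"
  shows "continuous_on (B \<times> A) (\<lambda>(t, x). f x t)"
proof -
  have "continuous_on (B \<times> A) (\<lambda>z. (\<lambda>(x, t). f x t) (snd z, fst z))"
    by (rule continuous_on_compose2[OF assms]) (auto intro!: continuous_intros)
  then show ?thesis by (simp add: split_beta)
qed

lemma integral_has_real_derivative_parameter:
  fixes f ft :: "real \<Rightarrow> real \<Rightarrow> real"
  assumes f: "\<And>x t. x \<in> {a..b} \<Longrightarrow> t \<in> {0..T} \<Longrightarrow> ((\<lambda>t. f x t) has_real_derivative ft x t) (at t within {0..T})"
    and int: "\<And>t. t \<in> {0..T} \<Longrightarrow> continuous_on {a..b} (\<lambda>x. f x t)"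
    and ft: "continuous_on ({a..b} \<times> {0..T}) (\<lambda>(x, t). ft x t)" and t: "t \<in> {0..T}"
  shows "((\<lambda>t. integral {a..b} (\<lambda>x. f x t)) has_real_derivative integral {a..b} (\<lambda>x. ft x t)) (at t within {0..T})"
proof -
  have "((\<lambda>t. integral (cbox a b) (\<lambda>x. f x t)) has_real_derivative integral (cbox a b) (\<lambda>x. ft x t)) (at t within {0..T})"
  proof (rule leibniz_rule_field_derivative[where f = "\<lambda>t x. f x t" and fx = "\<lambda>t x. ft x t"])
    show "(\<lambda>x. f x t) integrable_on cbox a b" if "t \<in> {0..T}" for t
      using int[OF that] by (auto intro: integrable_continuous_real)
    show "continuous_on ({0..T} \<times> cbox a b) (\<lambda>(t, x). ft x t)"
      using continuous_on_swap_args[OF ft] by simp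
  qed (use f t in auto)
  then show ?thesis by simp
qed

lemma integral_eq_diff_of_derivative:
  fixes H h :: "real \<Rightarrow> real"
  assumes "a \<le> b" "\<And>x. x \<in> {a..b} \<Longrightarrow> (H has_real_derivative h x) (at x within {a..b})"
  shows "integral {a..b} h = H b - H a"
  using fundamental_theorem_of_calculus[of a b H h] assms
  by (auto simp: has_real_derivative_iff_has_vector_derivative intro!: integral_unique)

text \<open>
A local conservation law \<open>f\<^sub>t = H\<^sub>x\<close> in integrated form.  Through \<open>C1_strip_chain\<close> it gives the
derivative of \<open>\<integral>\<^sub>0\<^bsup>\<xi>(t)\<^esup> f(z, t) dz\<close> for a moving end point \<open>\<xi>\<close>.
\<close>

lemma conservation_law_integral:
  fixes f ft H :: "real \<Rightarrow> real \<Rightarrow> real"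
  assumes f: "C1_strip T f fx ft"
    and H: "\<And>x t. 0 \<le> x \<Longrightarrow> t \<in> {0..T} \<Longrightarrow> ((\<lambda>x. H x t) has_real_derivative ft x t) (at x within {0..})"
    and Hc: "continuous_on ({0..} \<times> {0..T}) (\<lambda>(x, t). H x t)"
  shows "C1_strip T (\<lambda>x t. integral {0..x} (\<lambda>z. f z t)) f (\<lambda>x t. H x t - H 0 t)"
  unfolding C1_strip_def
proof (intro conjI allI impI ballI)
  note fc = C1_strip_continuous_on[OF f]
  fix x t :: real assume x: "0 \<le> x" and t: "t \<in> {0..T}"
  show "((\<lambda>x. integral {0..x} (\<lambda>z. f z t)) has_real_derivative f x t) (at x within {0..})"
    by (rule integral_upper_limit_has_real_derivative[OF continuous_on_slice_x[OF fc t] x])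
  have "((\<lambda>t. integral {0..x} (\<lambda>z. f z t)) has_real_derivative integral {0..x} (\<lambda>z. ft z t)) (at t within {0..T})"
  proof (rule integral_has_real_derivative_parameter[OF _ _ _ t])
    show "continuous_on {0..x} (\<lambda>x. f x t)" if "t \<in> {0..T}" for t
      by (rule continuous_on_subset[OF continuous_on_slice_x[OF fc that]]) auto
    show "continuous_on ({0..x} \<times> {0..T}) (\<lambda>(x, t). ft x t)"
      by (rule continuous_on_subset[of "{0..} \<times> {0..T}"]) (use f in \<open>auto simp: C1_strip_def\<close>)
  qed (use f in \<open>auto simp: C1_strip_def\<close>)
  also have "integral {0..x} (\<lambda>z. ft z t) = H x t - H 0 t"
    by (rule integral_eq_diff_of_derivative[OF x])
       (use t in \<open>auto intro: DERIV_subset[OF H]\<close>)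
  finally show "((\<lambda>t. integral {0..x} (\<lambda>z. f z t)) has_real_derivative H x t - H 0 t) (at t within {0..T})" .
next
  show "continuous_on ({0..} \<times> {0..T}) (\<lambda>(x, t). f x t)"
    by (rule C1_strip_continuous_on[OF f])
  have "continuous_on ({0..} \<times> {0..T}) (\<lambda>z. (\<lambda>(x, t). H x t) (0, snd z))"
    by (rule continuous_on_compose2[OF Hc]) (auto intro!: continuous_intros)
  then show "continuous_on ({0..} \<times> {0..T}) (\<lambda>(x, t). H x t - H 0 t)"
    using continuous_on_diff[OF Hc] by (simp add: case_prod_beta')
qed

lemma at_within_Ici_neq_bot:
  fixes x a :: real
  assumes "a \<le> x"
  shows "at x within {a..} \<noteq> bot"
proof -
  have "at_right x \<le> at x within {a..}"
    using assms by (intro at_le) auto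
  then show ?thesis
    using trivial_limit_at_right_real[of x] by (metis bot.extremum_uniqueI)
qed

text \<open>
Existence and value of \<open>f\<^sub>x\<^sub>t\<close> when only \<open>f\<^sub>t\<^sub>x\<close> is assumed to exist: differentiate
\<open>f(x, t) - f(x, 0) = \<integral>\<^sub>0\<^sup>t f\<^sub>t(x, s) ds\<close> in \<open>x\<close>.
\<close>

lemma mixed_partial_derivative:
  fixes f fx ft ftx :: "real \<Rightarrow> real \<Rightarrow> real"
  assumes f: "C1_strip T f fx ft"
    and ftx: "\<And>x t. 0 \<le> x \<Longrightarrow> t \<in> {0..T} \<Longrightarrow> ((\<lambda>x. ft x t) has_real_derivative ftx x t) (at x within {0..})"
    and c: "continuous_on ({0..} \<times> {0..T}) (\<lambda>(x, t). ftx x t)"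
    and x: "0 \<le> x" and t: "t \<in> {0..T}"
  shows "((\<lambda>t. fx x t) has_real_derivative ftx x t) (at t within {0..T})"
proof -
  have ftc: "continuous_on ({0..} \<times> {0..T}) (\<lambda>(x, t). ft x t)"
    using f by (simp add: C1_strip_def)
  have int_ft: "integral {0..s} (ft z) = f z s - f z 0" if "0 \<le> z" "s \<in> {0..T}" for z s
  proof (rule integral_eq_diff_of_derivative)
    fix r assume "r \<in> {0..s}"
    then have "((\<lambda>t. f z t) has_real_derivative ft z r) (at r within {0..T})"
      using f that by (auto simp: C1_strip_def)
    then show "((\<lambda>t. f z t) has_real_derivative ft z r) (at r within {0..s})"
      by (rule DERIV_subset) (use that in auto)
  qed (use that in auto)
  have fx_eq: "fx x s = fx x 0 + integral {0..s} (ftx x)" if s: "s \<in> {0..T}" for s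
  proof -
    have "((\<lambda>z. integral (cbox 0 s) (ft z)) has_real_derivative integral (cbox 0 s) (ftx x)) (at x within {0..})"
    proof (rule leibniz_rule_field_derivative)
      show "continuous_on ({0..} \<times> cbox 0 s) (\<lambda>(x, t). ftx x t)"
        by (rule continuous_on_subset[OF c]) (use s in auto)
      show "ft z integrable_on cbox 0 s" if "z \<in> {0..}" for z
        using continuous_on_subset[OF continuous_on_slice_t[OF ftc that], of "{0..s}"] s
        by (auto intro: integrable_continuous_real)
    qed (use s x ftx in auto)
    then have "((\<lambda>z. integral (cbox 0 s) (ft z)) has_real_derivative integral {0..s} (ftx x)) (at x within {0..})"
      by simp
    then have "((\<lambda>z. f z s - f z 0) has_real_derivative integral {0..s} (ftx x)) (at x within {0..})"
    proof (rule has_field_derivative_transform_within[where d=1])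
      show "integral (cbox 0 s) (ft z) = f z s - f z 0" if "z \<in> {0..}" for z
        using int_ft[of z s] that s by simp
    qed (use x in auto)
    moreover have "((\<lambda>z. f z s - f z 0) has_real_derivative fx x s - fx x 0) (at x within {0..})"
      using f x s by (intro derivative_intros) (auto simp: C1_strip_def)
    ultimately have "fx x s - fx x 0 = integral {0..s} (ftx x)"
      using x by (intro has_field_derivative_unique) (auto simp: at_within_Ici_neq_bot)
    then show ?thesis by simp
  qed
  have "((\<lambda>s. fx x 0 + integral {0..s} (ftx x)) has_real_derivative 0 + ftx x t) (at t within {0..T})"
    using continuous_on_slice_t[OF c, of x] x t
    by (intro derivative_intros integral_has_real_derivative) auto
  then have "((\<lambda>s. fx x s) has_real_derivative 0 + ftx x t) (at t within {0..T})"
    by (rule has_field_derivative_transform_within[where d=1]) (use t in \<open>auto intro: fx_eq[symmetric]\<close>)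
  then show ?thesis by simp
qed

section \<open>Square integrals on the half-line\<close>

lemma continuous_on_Ici_integrable:
  fixes f :: "real \<Rightarrow> real"
  assumes "continuous_on {0..} f" "0 \<le> a"
  shows "f integrable_on {a..b}"
  by (rule integrable_continuous_real) (use assms in \<open>auto intro: continuous_on_subset\<close>)

lemma has_real_derivative_Ici_imp_continuous_on:
  fixes f :: "real \<Rightarrow> real"
  assumes "\<And>x. 0 \<le> x \<Longrightarrow> (f has_real_derivative f' x) (at x within {0..})"
  shows "continuous_on {0..} f"
  using assms by (intro DERIV_continuous_on) auto

lemma integral_derivative_Ici:
  fixes f f' :: "real \<Rightarrow> real"
  assumes d: "\<And>x. 0 \<le> x \<Longrightarrow> (f has_real_derivative f' x) (at x within {0..})" and ab: "0 \<le> a" "a \<le> b"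
  shows "integral {a..b} f' = f b - f a"
proof (rule integral_eq_diff_of_derivative)
  fix x assume "x \<in> {a..b}"
  then show "(f has_real_derivative f' x) (at x within {a..b})"
    using ab by (intro DERIV_subset[OF d]) auto
qed (use ab in auto)

lemma const_le_integral:
  fixes f :: "real \<Rightarrow> real"
  assumes "f integrable_on {a..b}" "a \<le> b" "\<And>x. x \<in> {a..b} \<Longrightarrow> c \<le> f x"
  shows "c * (b - a) \<le> integral {a..b} f"
proof -
  have "integral {a..b} (\<lambda>_. c) \<le> integral {a..b} f"
    using assms by (intro integral_le) auto
  then show ?thesis using assms by (simp add: mult.commute)
qed

lemma exists_small_square:
  fixes f :: "real \<Rightarrow> real"
  assumes f: "continuous_on {0..} f" and C: "\<And>x. 0 \<le> x \<Longrightarrow> integral {0..x} (\<lambda>z. (f z)\<^sup>2) \<le> C"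
    and e: "0 < e" and x: "0 \<le> x"
  shows "\<exists>z\<ge>x. (f z)\<^sup>2 < e"
proof (rule ccontr)
  assume "\<not> ?thesis"
  then have ge: "\<And>z. z \<ge> x \<Longrightarrow> e \<le> (f z)\<^sup>2" by (meson not_less)
  have int: "(\<lambda>z. (f z)\<^sup>2) integrable_on {a..b}" if "0 \<le> a" for a b
    using that by (intro continuous_on_Ici_integrable continuous_intros f) auto
  define L where "L = (\<bar>C\<bar> + 1) / e"
  have L: "0 < L" "e * L = \<bar>C\<bar> + 1" using e by (auto simp: L_def)
  have "e * (x + L - x) \<le> integral {x..x+L} (\<lambda>z. (f z)\<^sup>2)"
    using L ge x by (intro const_le_integral int) auto
  also have "\<dots> \<le> integral {0..x+L} (\<lambda>z. (f z)\<^sup>2)"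
    using x by (intro integral_subset_le int) auto
  also have "\<dots> \<le> C" using C[of "x+L"] L x by simp
  finally show False using L by simp
qed

text \<open>
Integration by parts gives \<open>\<integral> f'\<^sup>2 = [f f'] - \<integral> f f''\<close>.  The boundary term is at most \<open>1\<close> at
arbitrarily large points, since otherwise \<open>(f\<^sup>2)' = 2 f f'\<close> would make \<open>f\<^sup>2\<close> grow linearly.
\<close>

lemma square_integral_first_derivative_bounded:
  fixes f f' f'' :: "real \<Rightarrow> real"
  assumes f: "\<And>x. 0 \<le> x \<Longrightarrow> (f has_real_derivative f' x) (at x within {0..})"
    and f': "\<And>x. 0 \<le> x \<Longrightarrow> (f' has_real_derivative f'' x) (at x within {0..})"
    and f'': "continuous_on {0..} f''"
    and C0: "\<And>x. 0 \<le> x \<Longrightarrow> integral {0..x} (\<lambda>z. (f z)\<^sup>2) \<le> C0"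
    and C2: "\<And>x. 0 \<le> x \<Longrightarrow> integral {0..x} (\<lambda>z. (f'' z)\<^sup>2) \<le> C2"
  shows "\<exists>C\<ge>0. \<forall>x\<ge>0. integral {0..x} (\<lambda>z. (f' z)\<^sup>2) \<le> C"
proof -
  note cf = has_real_derivative_Ici_imp_continuous_on[OF f]
  note cf' = has_real_derivative_Ici_imp_continuous_on[OF f']
  have sq: "((\<lambda>x. (f x)\<^sup>2) has_real_derivative 2 * f x * f' x) (at x within {0..})" if "0 \<le> x" for x
    using that by (auto intro!: derivative_eq_intros f)
  have prod: "((\<lambda>x. f x * f' x) has_real_derivative (f' x)\<^sup>2 + f x * f'' x) (at x within {0..})" if "0 \<le> x" for x
    using that by (auto intro!: derivative_eq_intros f f' simp: power2_eq_square)
  have far: "\<exists>X\<ge>x. f X * f' X \<le> 1" if x: "0 \<le> x" for x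
  proof (rule ccontr)
    assume "\<not> ?thesis"
    then have gt: "\<And>X. X \<ge> x \<Longrightarrow> 1 < f X * f' X" by (meson not_less)
    have "1 \<le> (f z)\<^sup>2" if z: "z \<ge> x + 1" for z
    proof -
      have "2 * (z - x) \<le> integral {x..z} (\<lambda>x. 2 * f x * f' x)"
      proof (rule const_le_integral)
        fix y assume "y \<in> {x..z}"
        then show "2 \<le> 2 * f y * f' y" using gt[of y] by simp
      qed (use x z in \<open>auto intro!: continuous_on_Ici_integrable continuous_intros cf cf'\<close>)
      also have "\<dots> = (f z)\<^sup>2 - (f x)\<^sup>2"
        by (rule integral_derivative_Ici[OF sq]) (use x z in auto)
      finally have "2 * (z - x) + (f x)\<^sup>2 \<le> (f z)\<^sup>2" by simp
      moreover have "2 \<le> 2 * (z - x)" using z by simp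
      moreover have "0 \<le> (f x)\<^sup>2" by simp
      ultimately show ?thesis by linarith
    qed
    moreover obtain z where "z \<ge> x + 1" "(f z)\<^sup>2 < 1"
      using exists_small_square[OF cf C0, of 1 "x+1"] x by auto
    ultimately show False by force
  qed
  define C where "C = 1 + \<bar>f 0 * f' 0\<bar> + (\<bar>C0\<bar> + \<bar>C2\<bar>) / 2"
  have "integral {0..x} (\<lambda>z. (f' z)\<^sup>2) \<le> C" if x: "0 \<le> x" for x
  proof -
    obtain X where X: "X \<ge> x" "f X * f' X \<le> 1" using far[OF x] by blast
    have X0: "0 \<le> X" using X x by simp
    have int: "g integrable_on {0..X}" if "continuous_on {0..} g" for g :: "real \<Rightarrow> real"
      using that by (intro continuous_on_Ici_integrable) auto
    have "integral {0..x} (\<lambda>z. (f' z)\<^sup>2) \<le> integral {0..X} (\<lambda>z. (f' z)\<^sup>2)"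
      using X x by (intro integral_subset_le continuous_on_Ici_integrable continuous_intros cf') auto
    also have "\<dots> \<le> integral {0..X} (\<lambda>z. ((f' z)\<^sup>2 + f z * f'' z) + ((f z)\<^sup>2 / 2 + (f'' z)\<^sup>2 / 2))"
    proof (rule integral_le)
      fix z
      have "0 \<le> (f z + f'' z)\<^sup>2" by simp
      then show "(f' z)\<^sup>2 \<le> ((f' z)\<^sup>2 + f z * f'' z) + ((f z)\<^sup>2 / 2 + (f'' z)\<^sup>2 / 2)"
        by (simp add: power2_sum field_simps)
    qed (auto intro!: int continuous_intros cf cf' f'')
    also have "\<dots> = integral {0..X} (\<lambda>z. (f' z)\<^sup>2 + f z * f'' z)
        + (integral {0..X} (\<lambda>z. (f z)\<^sup>2) / 2 + integral {0..X} (\<lambda>z. (f'' z)\<^sup>2) / 2)"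
      by (subst Henstock_Kurzweil_Integration.integral_add
           | (rule int; intro continuous_intros cf cf' f'')
           | simp)+
    also have "integral {0..X} (\<lambda>z. (f' z)\<^sup>2 + f z * f'' z) = f X * f' X - f 0 * f' 0"
      by (rule integral_derivative_Ici[OF prod]) (use X0 in auto)
    finally show ?thesis
      using X(2) C0[OF X0] C2[OF X0] abs_ge_self[of C0] abs_ge_self[of C2] abs_ge_minus_self[of "f 0 * f' 0"]
      unfolding C_def by argo
  qed
  then show ?thesis by (intro exI[of _ C]) (auto simp: C_def)
qed

lemma tendsto_zero_of_square_integrals:
  fixes f f' :: "real \<Rightarrow> real"
  assumes f: "\<And>x. 0 \<le> x \<Longrightarrow> (f has_real_derivative f' x) (at x within {0..})"
    and f': "continuous_on {0..} f'"
    and C0: "\<And>x. 0 \<le> x \<Longrightarrow> integral {0..x} (\<lambda>z. (f z)\<^sup>2) \<le> C0"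
    and C1: "\<And>x. 0 \<le> x \<Longrightarrow> integral {0..x} (\<lambda>z. (f' z)\<^sup>2) \<le> C1"
  shows "(f \<longlongrightarrow> 0) at_top"
proof -
  note cf = has_real_derivative_Ici_imp_continuous_on[OF f]
  define G where "G = (\<lambda>x. integral {0..x} (\<lambda>z. (f z)\<^sup>2 + (f' z)\<^sup>2))"
  have int: "g integrable_on {a..b}" if "continuous_on {0..} g" "0 \<le> a" for g :: "real \<Rightarrow> real" and a b
    using that by (intro continuous_on_Ici_integrable) auto
  have G_diff: "G y - G x = integral {x..y} (\<lambda>z. (f z)\<^sup>2 + (f' z)\<^sup>2)" if "0 \<le> x" "x \<le> y" for x y
  proof -
    have "integral {0..x} (\<lambda>z. (f z)\<^sup>2 + (f' z)\<^sup>2) + integral {x..y} (\<lambda>z. (f z)\<^sup>2 + (f' z)\<^sup>2)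
        = integral {0..y} (\<lambda>z. (f z)\<^sup>2 + (f' z)\<^sup>2)"
      using that by (intro Henstock_Kurzweil_Integration.integral_combine int continuous_intros cf f') auto
    then show ?thesis by (simp add: G_def)
  qed
  have G_mono: "G x \<le> G y" if "0 \<le> x" "x \<le> y" for x y
  proof -
    have "0 \<le> integral {x..y} (\<lambda>z. (f z)\<^sup>2 + (f' z)\<^sup>2)"
      using that by (intro Henstock_Kurzweil_Integration.integral_nonneg int continuous_intros cf f') auto
    then show ?thesis using G_diff[OF that] by simp
  qed
  have G_le: "G x \<le> C0 + C1" if "0 \<le> x" for x
  proof -
    have "G x = integral {0..x} (\<lambda>z. (f z)\<^sup>2) + integral {0..x} (\<lambda>z. (f' z)\<^sup>2)"
      unfolding G_def by (intro Henstock_Kurzweil_Integration.integral_add int continuous_intros cf f') auto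
    then show ?thesis using C0[OF that] C1[OF that] by simp
  qed
  have sq: "((\<lambda>x. (f x)\<^sup>2) has_real_derivative 2 * f x * f' x) (at x within {0..})" if "0 \<le> x" for x
    using that by (auto intro!: derivative_eq_intros f)
  have osc: "\<bar>(f y)\<^sup>2 - (f x)\<^sup>2\<bar> \<le> G y - G x" if xy: "0 \<le> x" "x \<le> y" for x y
  proof -
    have "(f y)\<^sup>2 - (f x)\<^sup>2 = integral {x..y} (\<lambda>x. 2 * f x * f' x)"
      using integral_derivative_Ici[OF sq xy] by simp
    also have "norm \<dots> \<le> integral {x..y} (\<lambda>z. (f z)\<^sup>2 + (f' z)\<^sup>2)"
    proof (rule integral_norm_bound_integral)
      fix z
      have "0 \<le> (\<bar>f z\<bar> - \<bar>f' z\<bar>)\<^sup>2" by simp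
      then show "norm (2 * f z * f' z) \<le> (f z)\<^sup>2 + (f' z)\<^sup>2"
        by (simp add: power2_diff abs_mult)
    qed (use xy in \<open>auto intro!: int continuous_intros cf f'\<close>)
    finally show ?thesis using G_diff[OF xy] by simp
  qed
  have sq0: "((\<lambda>x. (f x)\<^sup>2) \<longlongrightarrow> 0) at_top"
  proof (rule tendstoI)
    fix e :: real assume e: "0 < e"
    define S where "S = (SUP x\<in>{0..}. G x)"
    have bdd: "bdd_above (G ` {0..})" using G_le by (auto intro!: bdd_aboveI2)
    have "S - e / 2 < (SUP x\<in>{0..}. G x)" using e by (simp add: S_def)
    then obtain x0 where x0: "0 \<le> x0" "S - e / 2 < G x0"
      by (subst (asm) less_cSUP_iff[OF _ bdd]) auto
    have GS: "G x \<le> S" if "0 \<le> x" for x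
      unfolding S_def using that bdd by (intro cSUP_upper) auto
    obtain z where z: "z \<ge> x0" "(f z)\<^sup>2 < e / 2"
      using exists_small_square[OF cf C0, of "e/2" x0] e x0 by auto
    have "(f x)\<^sup>2 < e" if x: "x \<ge> x0" for x
    proof -
      have "\<bar>(f x)\<^sup>2 - (f z)\<^sup>2\<bar> < e / 2"
      proof (cases "z \<le> x")
        case True
        then show ?thesis
          using osc[of z x] z x x0 GS[of x] G_mono[of x0 z] by auto
      next
        case False
        then show ?thesis
          using osc[of x z] z x x0 GS[of z] G_mono[of x0 x] by (auto simp: abs_minus_commute)
      qed
      then show ?thesis using z by linarith
    qed
    then show "\<forall>\<^sub>F x in at_top. dist ((f x)\<^sup>2) 0 < e"
      unfolding eventually_at_top_linorder by (auto simp: dist_real_def intro!: exI[of _ x0])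
  qed
  then have "((\<lambda>x. sqrt ((f x)\<^sup>2)) \<longlongrightarrow> sqrt 0) at_top"
    by (rule tendsto_real_sqrt)
  then show ?thesis by (simp add: tendsto_rabs_zero_iff)
qed

text \<open>
A bound on \<open>\<integral> f'\<^sup>2\<close> forces \<open>f\<close> to grow at most like the square root of \<open>x\<close>.
\<close>

lemma sqrt_growth_of_square_integral:
  fixes f f' :: "real \<Rightarrow> real"
  assumes f: "\<And>x. 0 \<le> x \<Longrightarrow> (f has_real_derivative f' x) (at x within {0..})"
    and f': "continuous_on {0..} f'" and x: "0 \<le> x"
    and N: "integral {0..x} (\<lambda>z. (f' z)\<^sup>2) \<le> N"
  shows "\<bar>f x\<bar> \<le> \<bar>f 0\<bar> + (1 + N) / 2 * sqrt x"
proof (cases "x = 0")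
  case False
  with x have x: "0 < x" by simp
  define l where "l = sqrt x"
  have l: "0 < l" "l * l = x" using x by (auto simp: l_def)
  have "f x - f 0 = integral {0..x} f'"
    using integral_derivative_Ici[OF f, of 0 x] x by simp
  also have "norm \<dots> \<le> integral {0..x} (\<lambda>z. (1 / l + l * (f' z)\<^sup>2) / 2)"
  proof (rule integral_norm_bound_integral)
    fix z
    have "0 \<le> (1 - l * \<bar>f' z\<bar>)\<^sup>2 / l" using l by simp
    then show "norm (f' z) \<le> (1 / l + l * (f' z)\<^sup>2) / 2"
      using l by (simp add: power2_diff field_simps power2_eq_square)
  qed (auto intro!: continuous_on_Ici_integrable continuous_intros f')
  also have "\<dots> = integral {0..x} (\<lambda>z. 1 / (2 * l)) + integral {0..x} (\<lambda>z. l / 2 * (f' z)\<^sup>2)"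
    by (subst Henstock_Kurzweil_Integration.integral_add[symmetric])
       (auto intro!: continuous_on_Ici_integrable continuous_intros f' simp: field_simps)
  also have "\<dots> = l / 2 + l / 2 * integral {0..x} (\<lambda>z. (f' z)\<^sup>2)"
    using l x by (simp add: field_simps)
  also have "\<dots> \<le> l / 2 + l / 2 * N"
    using N l by (intro add_left_mono mult_left_mono) auto
  also have "\<dots> = (1 + N) / 2 * sqrt x" by (simp add: l_def field_simps)
  finally have "\<bar>f x - f 0\<bar> \<le> (1 + N) / 2 * sqrt x" by simp
  moreover have "\<bar>f x\<bar> \<le> \<bar>f 0\<bar> + \<bar>f x - f 0\<bar>" by simp
  ultimately show ?thesis by linarith
qed simp

section \<open>The energy of a solution\<close>

lemma continuous_on_args:
  assumes c: "continuous_on (A \<times> B) (\<lambda>(x, t). f x t)" and g: "continuous_on S g" and h: "continuous_on S h"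
    and "\<And>s. s \<in> S \<Longrightarrow> g s \<in> A" "\<And>s. s \<in> S \<Longrightarrow> h s \<in> B"
  shows "continuous_on S (\<lambda>s. f (g s) (h s))"
proof -
  have "continuous_on S (\<lambda>s. (\<lambda>(x, t). f x t) (g s, h s))"
    by (rule continuous_on_compose2[OF c]) (use assms in \<open>auto intro!: continuous_intros\<close>)
  then show ?thesis by simp
qed

lemma continuous_on_Icc_bounded:
  fixes f :: "real \<Rightarrow> real"
  assumes "continuous_on {a..b} f"
  shows "\<exists>K\<ge>0. \<forall>x\<in>{a..b}. \<bar>f x\<bar> \<le> K"
proof -
  have "bounded (f ` {a..b})"
    by (intro compact_imp_bounded compact_continuous_image assms) auto
  then obtain K where "\<forall>x\<in>{a..b}. \<bar>f x\<bar> \<le> K" by (auto simp: bounded_iff)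
  then have "\<forall>x\<in>{a..b}. \<bar>f x\<bar> \<le> max K 0" by fastforce
  then show ?thesis by (intro exI[of _ "max K 0"]) auto
qed

text \<open>
A solution on \<open>[0, \<infinity>) \<times> [0, T]\<close> together with its derivatives \<open>p = u\<^sub>x\<close>, \<open>q = u\<^sub>x\<^sub>x\<close>,
\<open>r = u\<^sub>x\<^sub>x\<^sub>x\<close>, \<open>ut = u\<^sub>t\<close>, \<open>pt = u\<^sub>x\<^sub>t\<close> and \<open>qt = u\<^sub>x\<^sub>x\<^sub>t\<close>.  The \<open>L\<^sup>2\<close> bounds hold at each time
separately, with no uniformity in \<open>t\<close>.
\<close>

locale short_wave =
  fixes T :: real and u p q r ut pt qt :: "real \<Rightarrow> real \<Rightarrow> real"
  assumes T_pos: "0 < T"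
    and u_C1: "C1_strip T u p ut" and p_C1: "C1_strip T p q pt" and q_C1: "C1_strip T q r qt"
    and pt_x: "\<And>x t. \<lbrakk>0 \<le> x; t \<in> {0..T}\<rbrakk> \<Longrightarrow> ((\<lambda>x. pt x t) has_real_derivative qt x t) (at x within {0..})"
    and short_wave_eq: "\<And>x t. \<lbrakk>0 \<le> x; t \<in> {0..T}\<rbrakk> \<Longrightarrow>
          qt x t - 2 * p x t + 2 * p x t * q x t + u x t * r x t = 0"
    and outflow: "\<And>t. t \<in> {0..T} \<Longrightarrow> u 0 t \<le> 0"
    and initial_pos: "\<And>x. 0 \<le> x \<Longrightarrow> 0 < 1 - q x 0"
    and u_L2: "\<And>t. t \<in> {0..T} \<Longrightarrow> \<exists>C\<ge>0. \<forall>x\<ge>0. integral {0..x} (\<lambda>z. (u z t)\<^sup>2) \<le> C"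
    and q_L2: "\<And>t. t \<in> {0..T} \<Longrightarrow> \<exists>C\<ge>0. \<forall>x\<ge>0. integral {0..x} (\<lambda>z. (q z t)\<^sup>2) \<le> C"
begin

lemma u_x: "\<lbrakk>0 \<le> x; t \<in> {0..T}\<rbrakk> \<Longrightarrow> ((\<lambda>x. u x t) has_real_derivative p x t) (at x within {0..})"
  and p_x: "\<lbrakk>0 \<le> x; t \<in> {0..T}\<rbrakk> \<Longrightarrow> ((\<lambda>x. p x t) has_real_derivative q x t) (at x within {0..})"
  and q_x: "\<lbrakk>0 \<le> x; t \<in> {0..T}\<rbrakk> \<Longrightarrow> ((\<lambda>x. q x t) has_real_derivative r x t) (at x within {0..})"
  and p_t: "\<lbrakk>0 \<le> x; t \<in> {0..T}\<rbrakk> \<Longrightarrow> ((\<lambda>t. p x t) has_real_derivative pt x t) (at t within {0..T})"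
  and q_t: "\<lbrakk>0 \<le> x; t \<in> {0..T}\<rbrakk> \<Longrightarrow> ((\<lambda>t. q x t) has_real_derivative qt x t) (at t within {0..T})"
  using u_C1[unfolded C1_strip_def] p_C1[unfolded C1_strip_def] q_C1[unfolded C1_strip_def] by blast+

lemma u_cont: "continuous_on ({0..} \<times> {0..T}) (\<lambda>(x, t). u x t)"
  and p_cont: "continuous_on ({0..} \<times> {0..T}) (\<lambda>(x, t). p x t)"
  and q_cont: "continuous_on ({0..} \<times> {0..T}) (\<lambda>(x, t). q x t)"
  and r_cont: "continuous_on ({0..} \<times> {0..T}) (\<lambda>(x, t). r x t)"
  and pt_cont: "continuous_on ({0..} \<times> {0..T}) (\<lambda>(x, t). pt x t)"
  using C1_strip_continuous_on[OF u_C1] C1_strip_continuous_on[OF p_C1] C1_strip_continuous_on[OF q_C1]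
    p_C1[unfolded C1_strip_def] q_C1[unfolded C1_strip_def]
  by blast+

lemma qt_eq: "\<lbrakk>0 \<le> x; t \<in> {0..T}\<rbrakk> \<Longrightarrow> qt x t = 2 * p x t * (1 - q x t) - u x t * r x t"
  using short_wave_eq[of x t] by (simp add: algebra_simps)

lemma p_L2:
  assumes t: "t \<in> {0..T}"
  shows "\<exists>C\<ge>0. \<forall>x\<ge>0. integral {0..x} (\<lambda>z. (p z t)\<^sup>2) \<le> C"
proof -
  obtain C0 C2 where "\<forall>x\<ge>0. integral {0..x} (\<lambda>z. (u z t)\<^sup>2) \<le> C0" "\<forall>x\<ge>0. integral {0..x} (\<lambda>z. (q z t)\<^sup>2) \<le> C2"
    using u_L2[OF t] q_L2[OF t] by blast
  then show ?thesis
    by (intro square_integral_first_derivative_bounded[OF u_x[OF _ t] p_x[OF _ t] continuous_on_slice_x[OF q_cont t]]) auto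
qed

text \<open>
Integrating the equation once in \<open>x\<close> leaves a function of \<open>t\<close> alone.  It is expressed through
boundary values at \<open>x = 0\<close>, so it is continuous; that it vanishes is not needed.
\<close>

definition bc :: "real \<Rightarrow> real" where
  "bc t = pt 0 t - 2 * u 0 t + u 0 t * q 0 t + (p 0 t)\<^sup>2 / 2"

lemma pt_eq:
  assumes x: "0 \<le> x" and t: "t \<in> {0..T}"
  shows "pt x t = 2 * u x t - u x t * q x t - (p x t)\<^sup>2 / 2 + bc t"
proof -
  let ?f = "\<lambda>x. pt x t - 2 * u x t + u x t * q x t + (p x t)\<^sup>2 / 2"
  have "(?f has_real_derivative 0) (at x within {0..})" if "x \<in> {0..}" for x
  proof -
    have "(?f has_real_derivative qt x t - 2 * p x t + (p x t * q x t + r x t * u x t) + p x t * q x t) (at x within {0..})"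
      using that t by (auto intro!: derivative_eq_intros pt_x u_x p_x q_x simp: power2_eq_square)
    then show ?thesis
      using short_wave_eq[of x t] that t by (simp add: algebra_simps)
  qed
  then obtain k where "\<forall>x\<in>{0..}. ?f x = k"
    using has_field_derivative_zero_constant[of "{0..}" ?f] by auto
  then have "?f x = ?f 0" using x by simp
  then show ?thesis by (simp add: bc_def)
qed

lemma bc_cont: "continuous_on {0..T} bc"
  unfolding bc_def[abs_def]
  by (intro continuous_intros continuous_on_slice_t[OF pt_cont] continuous_on_slice_t[OF u_cont]
      continuous_on_slice_t[OF p_cont] continuous_on_slice_t[OF q_cont]) auto

text \<open>
The flux in the conservation law \<open>(p\<^sup>2)\<^sub>t = (2 u\<^sup>2 + 2 bc u - u p\<^sup>2)\<^sub>x\<close>.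
\<close>

definition energy_flux :: "real \<Rightarrow> real \<Rightarrow> real" where
  "energy_flux x t = 2 * (u x t)\<^sup>2 + 2 * bc t * u x t - u x t * (p x t)\<^sup>2"

lemma energy_flux_x:
  assumes x: "0 \<le> x" and t: "t \<in> {0..T}"
  shows "((\<lambda>x. energy_flux x t) has_real_derivative 2 * p x t * pt x t) (at x within {0..})"
proof -
  have "((\<lambda>x. energy_flux x t) has_real_derivative
      4 * u x t * p x t + 2 * bc t * p x t - (p x t * (p x t)\<^sup>2 + 2 * p x t * q x t * u x t)) (at x within {0..})"
    unfolding energy_flux_def using x t
    by (auto intro!: derivative_eq_intros u_x p_x simp: power2_eq_square algebra_simps)
  then show ?thesis
    unfolding pt_eq[OF x t] by (simp add: power2_eq_square algebra_simps)
qed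

lemma energy_flux_cont: "continuous_on ({0..} \<times> {0..T}) (\<lambda>(x, t). energy_flux x t)"
proof -
  have "continuous_on ({0..} \<times> {0..T}) (\<lambda>z. bc (snd z))"
    by (rule continuous_on_compose2[OF bc_cont]) (auto intro!: continuous_intros)
  then show ?thesis
    unfolding energy_flux_def case_prod_beta'
    using u_cont p_cont by (intro continuous_intros) (simp_all add: case_prod_beta')
qed

lemma p_sq_C1: "C1_strip T (\<lambda>x t. (p x t)\<^sup>2) (\<lambda>x t. 2 * p x t * q x t) (\<lambda>x t. 2 * p x t * pt x t)"
  unfolding C1_strip_def case_prod_beta'
  using p_cont q_cont pt_cont
  by (auto intro!: derivative_eq_intros p_x p_t continuous_intros simp: case_prod_beta')

text \<open>
The energy \<open>\<integral> p\<^sup>2\<close> is bounded uniformly in time by propagating the bound at time \<open>T\<close>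
\<^emph>\<open>backwards\<close>.  On \<open>0 \<le> x \<le> \<xi>(t)\<close> the energy changes at the rate
\<open>(\<xi>' - u) p\<^sup>2 + 2 u\<^sup>2 + 2 bc u\<close> at \<open>x = \<xi>(t)\<close>, minus the flux at \<open>x = 0\<close>.  This is bounded below
once \<open>\<xi>' \<ge> u\<close>, because \<open>2 u\<^sup>2 + 2 bc u \<ge> - bc\<^sup>2 / 2\<close>.  The energy bound itself makes \<open>u\<close> grow at
most like the square root of \<open>x\<close>, so quadratic curves \<open>\<xi>(t) = (a + b t)\<^sup>2\<close> are fast enough; a
continuity argument removes the circularity.
\<close>

lemma energy_bound: "\<exists>N\<ge>0. \<forall>t\<in>{0..T}. \<forall>x\<ge>0. integral {0..x} (\<lambda>z. (p z t)\<^sup>2) \<le> N"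
proof -
  obtain E where E: "0 \<le> E" "\<And>x. 0 \<le> x \<Longrightarrow> integral {0..x} (\<lambda>z. (p z T)\<^sup>2) \<le> E"
    using p_L2[of T] T_pos by auto
  obtain K0 where K0: "0 \<le> K0" "\<And>t. t \<in> {0..T} \<Longrightarrow> \<bar>u 0 t\<bar> \<le> K0"
    using continuous_on_Icc_bounded[OF continuous_on_slice_t[OF u_cont, of 0]] by auto
  obtain K where K: "0 \<le> K" "\<And>t. t \<in> {0..T} \<Longrightarrow> \<bar>(bc t)\<^sup>2 / 2 + \<bar>energy_flux 0 t\<bar>\<bar> \<le> K"
  proof -
    have "continuous_on {0..T} (\<lambda>t. (bc t)\<^sup>2 / 2 + \<bar>energy_flux 0 t\<bar>)"
      by (intro continuous_intros bc_cont continuous_on_slice_t[OF energy_flux_cont]) auto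
    from continuous_on_Icc_bounded[OF this] show ?thesis using that by blast
  qed
  define N where "N = E + K * T + 1"
  have N: "0 < N" "E + K * T < N" using E K T_pos by (auto simp: N_def intro!: add_nonneg_pos)
  define b where "b = (1 + (1 + N) / 2) / 2"
  have b: "0 < b" using N(1) by (simp add: b_def add_pos_pos)
  have main: "integral {0..x} (\<lambda>z. (p z t)\<^sup>2) \<le> N" if x: "0 \<le> x" and t: "t \<in> {0..T}" for x t
  proof -
    define a where "a = K0 + sqrt x"
    have a: "0 \<le> a" "K0 \<le> a" "sqrt x \<le> a" using K0 x by (auto simp: a_def)
    define \<xi> where "\<xi> = (\<lambda>s. (a + b * s)\<^sup>2)"
    have \<xi>0: "0 \<le> \<xi> s" for s by (simp add: \<xi>_def)
    have \<xi>': "(\<xi> has_real_derivative 2 * b * (a + b * s)) (at s within S)" for s S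
      unfolding \<xi>_def by (auto intro!: derivative_eq_intros)
    define g where "g = (\<lambda>s. integral {0..\<xi> s} (\<lambda>z. (p z s)\<^sup>2))"
    have g': "(g has_real_derivative (p (\<xi> s) s)\<^sup>2 * (2 * b * (a + b * s)) + (energy_flux (\<xi> s) s - energy_flux 0 s))
          (at s within {0..T})" if "s \<in> {0..T}" for s
      unfolding g_def
      by (rule C1_strip_chain[OF conservation_law_integral[OF p_sq_C1 energy_flux_x energy_flux_cont] order_refl that \<xi>0 \<xi>'])
    \<comment> \<open>As long as \<open>g s \<le> N\<close>, the curve outruns the fluid and the flux has a lower bound.\<close>
    have g'_ge: "- K \<le> (p (\<xi> s) s)\<^sup>2 * (2 * b * (a + b * s)) + (energy_flux (\<xi> s) s - energy_flux 0 s)"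
      if s: "s \<in> {0..T}" and gs: "g s \<le> N" for s
    proof -
      have abs: "0 \<le> a + b * s" using a b s by simp
      have "\<bar>u (\<xi> s) s\<bar> \<le> \<bar>u 0 s\<bar> + (1 + N) / 2 * sqrt (\<xi> s)"
        using gs unfolding g_def
        by (intro sqrt_growth_of_square_integral[where f' = "\<lambda>x. p x s"] u_x s \<xi>0
             continuous_on_slice_x[OF p_cont s]) auto
      also have "sqrt (\<xi> s) = a + b * s" using abs by (simp add: \<xi>_def)
      also have "\<bar>u 0 s\<bar> \<le> a + b * s" using K0(2)[OF s] a b s by (simp add: add_increasing2)
      finally have "u (\<xi> s) s \<le> 2 * b * (a + b * s)"
        by (simp add: b_def algebra_simps add_divide_distrib)
      then have "0 \<le> (p (\<xi> s) s)\<^sup>2 * (2 * b * (a + b * s) - u (\<xi> s) s)" by simp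
      moreover have "0 \<le> (2 * u (\<xi> s) s + bc s)\<^sup>2" by simp
      then have "- ((bc s)\<^sup>2 / 2) \<le> 2 * (u (\<xi> s) s)\<^sup>2 + 2 * bc s * u (\<xi> s) s"
        by (simp add: power2_sum power_mult_distrib algebra_simps)
      moreover have "(bc s)\<^sup>2 / 2 + \<bar>energy_flux 0 s\<bar> \<le> K" using K(2)[OF s] by simp
      ultimately show ?thesis
        unfolding energy_flux_def[of "\<xi> s"] by (simp add: algebra_simps)
    qed
    have g_cont: "continuous_on {0..T} g"
      by (rule DERIV_continuous_on[OF g'])
    have "g s < N" if s: "s \<in> {0..T}" for s
    proof (rule ccontr)
      assume "\<not> g s < N"
      \<comment> \<open>After the last time at which the bound fails, \<open>g\<close> decreases by at most \<open>K T\<close>.\<close>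
      define B where "B = {s \<in> {0..T}. N \<le> g s}"
      have "closed B"
        unfolding B_def using continuous_closed_preimage[OF g_cont, of "{N..}"] by (simp add: vimage_def Int_def)
      moreover have "bounded B" unfolding B_def by (rule bounded_subset[of "{0..T}"]) auto
      ultimately have cB: "compact B" by (simp add: compact_eq_bounded_closed)
      have nB: "B \<noteq> {}" using s \<open>\<not> g s < N\<close> by (auto simp: B_def)
      obtain s1 where s1: "s1 \<in> B" "\<And>s. s \<in> B \<Longrightarrow> s \<le> s1"
        using compact_attains_sup[OF cB nB] by blast
      have s1T: "s1 \<in> {0..T}" "N \<le> g s1" using s1(1) by (auto simp: B_def)
      have gT: "g T \<le> E" unfolding g_def by (intro E \<xi>0)
      have "0 \<le> K * T" using K T_pos by simp
      then have "s1 < T" using s1T gT N by (cases "s1 = T") auto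
      have g'_mvt: "(g has_derivative (\<lambda>h. ((p (\<xi> s) s)\<^sup>2 * (2 * b * (a + b * s)) + (energy_flux (\<xi> s) s - energy_flux 0 s)) * h))
          (at s within {s1..T})" if "s1 \<le> s" "s \<le> T" for s
        using DERIV_subset[OF g', of s "{s1..T}"] that s1T by (simp add: has_field_derivative_def)
      obtain z where z: "s1 < z" "z < T"
        "g T - g s1 = ((p (\<xi> z) z)\<^sup>2 * (2 * b * (a + b * z)) + (energy_flux (\<xi> z) z - energy_flux 0 z)) * (T - s1)"
        using mvt_simple[OF \<open>s1 < T\<close> g'_mvt] by auto
      have z0: "z \<in> {0..T}" using z s1(1) by (auto simp: B_def)
      have "g z \<le> N" using s1(2)[of z] z z0 by (force simp: B_def)
      from g'_ge[OF z0 this] have "- K * (T - s1) \<le> g T - g s1"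
        unfolding z(3) using \<open>s1 < T\<close> by (intro mult_right_mono) auto
      moreover have "K * (T - s1) \<le> K * T" using s1(1) K by (intro mult_left_mono) (auto simp: B_def)
      ultimately have "g s1 \<le> E + K * T" using gT by simp
      then show False using s1(1) N by (simp add: B_def)
    qed
    then have "g t < N" using t by simp
    have "x \<le> \<xi> t"
    proof -
      have "(sqrt x)\<^sup>2 \<le> (a + b * t)\<^sup>2"
        using a b t x by (intro power_mono) (auto intro: add_increasing2)
      then show ?thesis using x by (simp add: \<xi>_def)
    qed
    then have "integral {0..x} (\<lambda>z. (p z t)\<^sup>2) \<le> g t"
      unfolding g_def using x t
      by (intro integral_subset_le continuous_on_Ici_integrable continuous_intros continuous_on_slice_x[OF p_cont]) auto
    then show ?thesis using \<open>g t < N\<close> by simp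
  qed
  then show ?thesis using N by (intro exI[of _ N]) auto
qed

lemma u_growth: "\<exists>K>0. \<forall>t\<in>{0..T}. \<forall>x\<ge>0. \<bar>u x t\<bar> \<le> K * (1 + sqrt x)"
proof -
  obtain N where N: "0 \<le> N" "\<And>t x. t \<in> {0..T} \<Longrightarrow> 0 \<le> x \<Longrightarrow> integral {0..x} (\<lambda>z. (p z t)\<^sup>2) \<le> N"
    using energy_bound by blast
  obtain K0 where K0: "0 \<le> K0" "\<And>t. t \<in> {0..T} \<Longrightarrow> \<bar>u 0 t\<bar> \<le> K0"
    using continuous_on_Icc_bounded[OF continuous_on_slice_t[OF u_cont, of 0]] by auto
  have "\<bar>u x t\<bar> \<le> (K0 + (1 + N) / 2) * (1 + sqrt x)" if "0 \<le> x" and t: "t \<in> {0..T}" for x t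
  proof -
    have "\<bar>u x t\<bar> \<le> \<bar>u 0 t\<bar> + (1 + N) / 2 * sqrt x"
      using that N
      by (intro sqrt_growth_of_square_integral[where f' = "\<lambda>x. p x t"] u_x continuous_on_slice_x[OF p_cont t]) auto
    also have "\<dots> \<le> K0 * (1 + sqrt x) + (1 + N) / 2 * (1 + sqrt x)"
      using K0 N that by (intro add_mono mult_left_mono) (auto intro: order_trans[OF K0(2)[OF t]] mult_nonneg_nonneg simp: distrib_left)
    finally show ?thesis by (simp add: algebra_simps)
  qed
  moreover have "0 < K0 + (1 + N) / 2" using K0 N by (intro add_nonneg_pos) auto
  ultimately show ?thesis by blast
qed

lemma u_tendsto_0:
  assumes t: "t \<in> {0..T}"
  shows "((\<lambda>x. u x t) \<longlongrightarrow> 0) at_top"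
proof -
  obtain C0 C1 where "\<forall>x\<ge>0. integral {0..x} (\<lambda>z. (u z t)\<^sup>2) \<le> C0" "\<forall>x\<ge>0. integral {0..x} (\<lambda>z. (p z t)\<^sup>2) \<le> C1"
    using u_L2[OF t] p_L2[OF t] by blast
  then show ?thesis
    by (intro tendsto_zero_of_square_integrals[OF u_x[OF _ t] continuous_on_slice_x[OF p_cont t]]) auto
qed

end

section \<open>Positivity and the second conserved density\<close>

lemma has_real_derivative_minus_one_square:
  fixes f :: "real \<Rightarrow> real"
  assumes "(f has_real_derivative d) (at x within S)"
  shows "((\<lambda>x. (f x - 1)\<^sup>2) has_real_derivative 2 * (f x - 1) * d) (at x within S)"
  using assms by (auto intro!: derivative_eq_intros)

context short_wave begin

text \<open>
The function \<open>w = 1 - q\<close> satisfies \<open>w\<^sub>t + u w\<^sub>x = - 2 p w\<close> and stays positive, by a minimum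
principle on the compact cone \<open>0 \<le> x \<le> (a - K t)\<^sup>2\<close>.  By \<open>u_growth\<close>, no characteristic enters this
cone through its right edge, and by \<open>u \<le> 0\<close> none enters at \<open>x = 0\<close>.  Hence from every point of the
cone with \<open>t > 0\<close> a short segment in the backward characteristic direction \<open>(- u, - 1)\<close> stays inside.
\<close>

lemma w_pos:
  assumes x1: "0 \<le> x1" and t1: "t1 \<in> {0..T}"
  shows "0 < 1 - q x1 t1"
proof -
  obtain K where K: "0 < K" "\<And>t x. t \<in> {0..T} \<Longrightarrow> 0 \<le> x \<Longrightarrow> \<bar>u x t\<bar> \<le> K * (1 + sqrt x)"
    using u_growth by blast
  define a where "a = K * T + 1 + sqrt x1"
  have a0: "0 \<le> a" using K T_pos x1 by (simp add: a_def)
  have aK: "1 + sqrt x1 \<le> a - K * t" if "t \<in> {0..T}" for t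
  proof -
    have "K * t \<le> K * T" using that K by (intro mult_left_mono) auto
    then show ?thesis by (simp add: a_def)
  qed
  define D where "D = ({0..a\<^sup>2} \<times> {0..T}) \<inter> {z. fst z \<le> (a - K * snd z)\<^sup>2}"
  have D_compact: "compact D"
    unfolding D_def
    by (intro compact_Int_closed compact_Times compact_Icc closed_Collect_le continuous_intros)
  have D_strip: "D \<subseteq> {0..} \<times> {0..T}" by (auto simp: D_def)
  have in_D: "(x, t) \<in> D" if "0 \<le> x" "t \<in> {0..T}" "x \<le> (a - K * t)\<^sup>2" for x t
  proof -
    have "(a - K * t)\<^sup>2 \<le> a\<^sup>2"
    proof (rule power_mono)
      show "0 \<le> a - K * t" using aK[OF that(2)] real_sqrt_ge_zero[OF x1] by linarith
      show "a - K * t \<le> a" using that K by simp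
    qed
    then show ?thesis using that by (auto simp: D_def)
  qed
  have x1D: "(x1, t1) \<in> D"
  proof (rule in_D[OF x1 t1])
    have "(sqrt x1)\<^sup>2 \<le> (a - K * t1)\<^sup>2"
      using aK[OF t1] x1 by (intro power_mono) auto
    then show "x1 \<le> (a - K * t1)\<^sup>2" using x1 by simp
  qed
  obtain B where B: "\<And>x t. (x, t) \<in> D \<Longrightarrow> \<bar>p x t\<bar> \<le> B"
  proof -
    have "bounded ((\<lambda>(x, t). p x t) ` D)"
      by (intro compact_imp_bounded compact_continuous_image continuous_on_subset[OF p_cont] D_strip D_compact)
    then obtain B where "\<forall>y\<in>(\<lambda>(x, t). p x t) ` D. \<bar>y\<bar> \<le> B" unfolding bounded_iff real_norm_def by blast
    then show ?thesis using that by fastforce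
  qed
  have B0: "0 \<le> B" using B[OF x1D] by simp
  obtain \<delta> where \<delta>: "0 < \<delta>" "\<And>x. x \<in> {0..a\<^sup>2} \<Longrightarrow> \<delta> \<le> 1 - q x 0"
  proof -
    have "continuous_on {0..a\<^sup>2} (\<lambda>x. 1 - q x 0)"
      using T_pos by (intro continuous_intros continuous_on_subset[OF continuous_on_slice_x[OF q_cont]]) auto
    then obtain m where "m \<in> {0..a\<^sup>2}" "\<And>x. x \<in> {0..a\<^sup>2} \<Longrightarrow> 1 - q m 0 \<le> 1 - q x 0"
      using continuous_attains_inf[of "{0..a\<^sup>2}" "\<lambda>x. 1 - q x 0"] by auto
    then show ?thesis using initial_pos[of m] that[of "1 - q m 0"] by auto
  qed
  define L where "L = 2 * B + 1"
  \<comment> \<open>A negative minimum of \<open>F\<close> is impossible at positive times: \<open>F\<close> increases along the flow there.\<close>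
  define F where "F = (\<lambda>x t. (1 - q x t - \<delta> * exp (- L * t)) * exp (- L * t))"
  have F_cont: "continuous_on D (\<lambda>(x, t). F x t)"
    unfolding F_def case_prod_beta'
    using continuous_on_subset[OF q_cont D_strip] by (intro continuous_intros) (simp_all add: case_prod_beta')
  obtain x0 t0 where min: "(x0, t0) \<in> D" "\<And>x t. (x, t) \<in> D \<Longrightarrow> F x0 t0 \<le> F x t"
    using continuous_attains_inf[OF D_compact _ F_cont] x1D by fast
  have x0: "0 \<le> x0" and t0: "t0 \<in> {0..T}" and x0_le: "x0 \<le> (a - K * t0)\<^sup>2" and x0a: "x0 \<in> {0..a\<^sup>2}"
    using min(1) by (auto simp: D_def)
  have "0 \<le> F x0 t0"
  proof (rule ccontr)
    assume neg: "\<not> 0 \<le> F x0 t0"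
    have "t0 \<noteq> 0"
      using neg \<delta>(2)[OF x0a] by (auto simp: F_def)
    then have t0_pos: "0 < t0" using t0 by simp
    define u0 where "u0 = u x0 t0"
    define e where "e = (if x0 = 0 then t0 else min t0 (x0 / (\<bar>u0\<bar> + 1)))"
    have e: "0 < e" "e \<le> t0" using t0_pos x0 by (auto simp: e_def)
    define \<xi> where "\<xi> = (\<lambda>t. x0 - u0 * (t0 - t))"
    have \<xi>0: "0 \<le> \<xi> t" if "t \<in> {t0 - e..t0}" for t
    proof (cases "x0 = 0")
      case True
      then have "u0 \<le> 0" using outflow[OF t0] by (simp add: u0_def)
      then show ?thesis using that True by (simp add: \<xi>_def mult_nonpos_nonneg)
    next
      case False
      then have "e * (\<bar>u0\<bar> + 1) \<le> x0"
        using x0 by (simp add: e_def min_le_iff_disj pos_le_divide_eq[symmetric])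
      moreover have "u0 * (t0 - t) \<le> (\<bar>u0\<bar> + 1) * e"
        using that by (intro mult_mono) auto
      ultimately show ?thesis by (simp add: \<xi>_def mult.commute)
    qed
    have \<xi>D: "(\<xi> t, t) \<in> D" if t: "t \<in> {t0 - e..t0}" for t
    proof (rule in_D[OF \<xi>0[OF t]])
      show "t \<in> {0..T}" using t t0 e by auto
      define A where "A = a - K * t0"
      have A: "1 \<le> A" using aK[OF t0] x1 real_sqrt_ge_zero[OF x1] unfolding A_def by linarith
      have "x0 \<le> A\<^sup>2" using x0_le by (simp add: A_def)
      then have "sqrt x0 \<le> sqrt (A\<^sup>2)" by (rule real_sqrt_le_mono)
      also have "\<dots> = A" using A by simp
      finally have "sqrt x0 \<le> A" .
      then have "\<bar>u0\<bar> \<le> K * (2 * A)"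
        using K(2)[OF t0 x0] K(1) A unfolding u0_def by (intro order_trans[OF K(2)[OF t0 x0]] mult_left_mono) auto
      then have "- u0 * (t0 - t) \<le> K * (2 * A) * (t0 - t)"
        using t by (intro mult_right_mono) auto
      then have "\<xi> t \<le> A\<^sup>2 + 2 * A * (K * (t0 - t))"
        using x0_le by (simp add: \<xi>_def A_def algebra_simps)
      also have "\<dots> \<le> (A + K * (t0 - t))\<^sup>2"
        by (simp add: power2_sum)
      finally show "\<xi> t \<le> (a - K * t)\<^sup>2" by (simp add: A_def algebra_simps)
    qed
    let ?S = "{t0 - e..t0}"
    have S: "?S \<subseteq> {0..T}" "t0 \<in> ?S" using e t0 by auto
    have \<xi>': "(\<xi> has_real_derivative u0) (at t0 within ?S)"
      unfolding \<xi>_def by (auto intro!: derivative_eq_intros)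
    have \<xi>t0: "\<xi> t0 = x0" by (simp add: \<xi>_def)
    have dq: "((\<lambda>t. q (\<xi> t) t) has_real_derivative r x0 t0 * u0 + qt x0 t0) (at t0 within ?S)"
      using C1_strip_chain[OF q_C1 S \<xi>0 \<xi>'] by (simp add: \<xi>t0)
    define \<phi> where "\<phi> = 1 - q x0 t0 - \<delta> * exp (- L * t0)"
    have "((\<lambda>t. F (\<xi> t) t) has_real_derivative
        (- (r x0 t0 * u0 + qt x0 t0) + \<delta> * (L * exp (- L * t0))) * exp (- L * t0)
        - \<phi> * (L * exp (- L * t0))) (at t0 within ?S)"
      unfolding F_def
      by (rule derivative_eq_intros dq refl)+ (simp add: \<xi>t0 \<phi>_def algebra_simps)
    also have "(- (r x0 t0 * u0 + qt x0 t0) + \<delta> * (L * exp (- L * t0))) * exp (- L * t0)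
        - \<phi> * (L * exp (- L * t0))
        = exp (- L * t0) * ((L + 2 * p x0 t0) * (- \<phi>) + (L - 2 * p x0 t0) * \<delta> * exp (- L * t0))"
      unfolding qt_eq[OF x0 t0] by (simp add: u0_def \<phi>_def algebra_simps)
    finally have dF: "((\<lambda>t. F (\<xi> t) t) has_real_derivative
       exp (- L * t0) * ((L + 2 * p x0 t0) * (- \<phi>) + (L - 2 * p x0 t0) * \<delta> * exp (- L * t0))) (at t0 within ?S)" .
    have "\<phi> < 0" using neg by (simp add: F_def \<phi>_def not_le mult_less_0_iff)
    have L: "0 < L + 2 * p x0 t0" "0 < L - 2 * p x0 t0" using B[OF min(1)] by (auto simp: L_def)
    have "0 < (L + 2 * p x0 t0) * (- \<phi>)" using L(1) \<open>\<phi> < 0\<close> by (simp add: mult_pos_neg)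
    moreover have "0 < (L - 2 * p x0 t0) * \<delta> * exp (- L * t0)" using L(2) \<delta>(1) by simp
    ultimately have "0 < exp (- L * t0) * ((L + 2 * p x0 t0) * (- \<phi>) + (L - 2 * p x0 t0) * \<delta> * exp (- L * t0))"
      by (intro mult_pos_pos[OF exp_gt_zero] add_pos_pos)
    from has_real_derivative_pos_inc_left[OF dF this] obtain d where d: "0 < d"
      "\<And>h. 0 < h \<Longrightarrow> t0 - h \<in> ?S \<Longrightarrow> h < d \<Longrightarrow> F (\<xi> (t0 - h)) (t0 - h) < F (\<xi> t0) t0"
      by blast
    define h where "h = min e (d / 2)"
    have h: "0 < h" "t0 - h \<in> ?S" "h < d" using d e by (auto simp: h_def min_def)
    show False
      using d(2)[OF h] min(2)[OF \<xi>D[OF h(2)]] by (simp add: \<xi>t0)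
  qed
  then have "0 \<le> F x1 t1" using min(2)[OF x1D] by simp
  then have "\<delta> * exp (- L * t1) \<le> 1 - q x1 t1"
    by (simp add: F_def zero_le_mult_iff)
  moreover have "0 < \<delta> * exp (- L * t1)" using \<delta> by simp
  ultimately show ?thesis by linarith
qed

text \<open>
The conserved density \<open>sqrt w\<close>, with \<open>(sqrt w)\<^sub>t = - (u sqrt w)\<^sub>x\<close>.
\<close>

definition sw :: "real \<Rightarrow> real \<Rightarrow> real" where
  "sw x t = sqrt (1 - q x t)"

lemma sw_pos: "\<lbrakk>0 \<le> x; t \<in> {0..T}\<rbrakk> \<Longrightarrow> 0 < sw x t"
  using w_pos by (simp add: sw_def)

lemma q_eq_sw: "\<lbrakk>0 \<le> x; t \<in> {0..T}\<rbrakk> \<Longrightarrow> q x t = 1 - (sw x t)\<^sup>2"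
  using w_pos[of x t] by (simp add: sw_def)

lemma sw_C1: "C1_strip T sw (\<lambda>x t. - r x t / (2 * sw x t)) (\<lambda>x t. - p x t * sw x t + u x t * r x t / (2 * sw x t))"
proof -
  have c: "continuous_on ({0..} \<times> {0..T}) (\<lambda>z. sw (fst z) (snd z))"
    unfolding sw_def using q_cont by (intro continuous_intros) (simp add: case_prod_beta')
  have nz: "sw x t \<noteq> 0" if "0 \<le> x" "0 \<le> t" "t \<le> T" for x t using sw_pos[of x t] that by simp
  have dx: "((\<lambda>x. sw x t) has_real_derivative - r x t / (2 * sw x t)) (at x within {0..})"
    if "0 \<le> x" "t \<in> {0..T}" for x t
    unfolding sw_def using w_pos[OF that]
    by (auto intro!: derivative_eq_intros q_x that simp: field_simps)
  have dt: "((\<lambda>t. sw x t) has_real_derivative - p x t * sw x t + u x t * r x t / (2 * sw x t)) (at t within {0..T})"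
    if "0 \<le> x" "t \<in> {0..T}" for x t
  proof -
    have "((\<lambda>t. sw x t) has_real_derivative - qt x t / (2 * sw x t)) (at t within {0..T})"
      unfolding sw_def using w_pos[OF that]
      by (auto intro!: derivative_eq_intros q_t that simp: field_simps)
    also have "- qt x t / (2 * sw x t) = - p x t * sw x t + u x t * r x t / (2 * sw x t)"
      using sw_pos[OF that] unfolding qt_eq[OF that] q_eq_sw[OF that] by (simp add: field_simps power2_eq_square)
    finally show ?thesis .
  qed
  show ?thesis
    unfolding C1_strip_def case_prod_beta'
    using dx dt c nz r_cont u_cont p_cont
    by (auto intro!: continuous_intros simp: case_prod_beta')
qed

lemma sw_cont: "continuous_on ({0..} \<times> {0..T}) (\<lambda>(x, t). sw x t)"
  by (rule C1_strip_continuous_on[OF sw_C1])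

lemma sw_x: "\<lbrakk>0 \<le> x; t \<in> {0..T}\<rbrakk> \<Longrightarrow> ((\<lambda>x. sw x t) has_real_derivative - r x t / (2 * sw x t)) (at x within {0..})"
  and sw_t: "\<lbrakk>0 \<le> x; t \<in> {0..T}\<rbrakk> \<Longrightarrow>
    ((\<lambda>t. sw x t) has_real_derivative - p x t * sw x t + u x t * r x t / (2 * sw x t)) (at t within {0..T})"
  using sw_C1[unfolded C1_strip_def] by blast+

lemma excess_C1: "C1_strip T (\<lambda>x t. (sw x t - 1)\<^sup>2) (\<lambda>x t. 2 * (sw x t - 1) * (- r x t / (2 * sw x t)))
    (\<lambda>x t. 2 * (sw x t - 1) * (- p x t * sw x t + u x t * r x t / (2 * sw x t)))"
proof -
  have nz: "sw x t \<noteq> 0" if "0 \<le> x" "0 \<le> t" "t \<le> T" for x t using sw_pos[of x t] that by simp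
  show ?thesis
    unfolding C1_strip_def
  proof (intro conjI allI impI ballI)
    show "continuous_on ({0..} \<times> {0..T}) (\<lambda>(x, t). 2 * (sw x t - 1) * (- r x t / (2 * sw x t)))"
         "continuous_on ({0..} \<times> {0..T})
            (\<lambda>(x, t). 2 * (sw x t - 1) * (- p x t * sw x t + u x t * r x t / (2 * sw x t)))"
      unfolding case_prod_beta'
      using sw_cont r_cont u_cont p_cont nz
      by (auto intro!: continuous_intros simp: case_prod_beta')
  qed (intro has_real_derivative_minus_one_square sw_x sw_t; assumption)+
qed

text \<open>
Combining the conservation laws of \<open>w\<close> and \<open>sqrt w\<close> yields
\<open>((sqrt w - 1)\<^sup>2)\<^sub>t = (p\<^sup>2 / 2 - u (sqrt w - 1)\<^sup>2)\<^sub>x\<close>.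
\<close>

lemma excess_flux_x:
  assumes x: "0 \<le> x" and t: "t \<in> {0..T}"
  shows "((\<lambda>x. (p x t)\<^sup>2 / 2 - u x t * (sw x t - 1)\<^sup>2) has_real_derivative
     2 * (sw x t - 1) * (- p x t * sw x t + u x t * r x t / (2 * sw x t))) (at x within {0..})"
proof -
  have "((\<lambda>x. (p x t)\<^sup>2 / 2 - u x t * (sw x t - 1)\<^sup>2) has_real_derivative
     p x t * q x t - (p x t * (sw x t - 1)\<^sup>2 + 2 * (sw x t - 1) * (- r x t / (2 * sw x t)) * u x t)) (at x within {0..})"
    using DERIV_diff[OF DERIV_cdivide[OF DERIV_power[OF p_x[OF x t], of 2], of 2]
        DERIV_mult[OF u_x[OF x t] has_real_derivative_minus_one_square[OF sw_x[OF x t]]]]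
    by (simp add: mult.commute)
  then show ?thesis
    unfolding q_eq_sw[OF x t] by (simp add: algebra_simps power2_eq_square)
qed

text \<open>
The same backward propagation as in \<open>energy_bound\<close>.  The term \<open>p\<^sup>2 / 2\<close> in the flux has the
favourable sign, and at time \<open>T\<close> the integrand is at most \<open>q\<^sup>2\<close>.
\<close>

lemma excess_bound: "\<exists>M\<ge>0. \<forall>t\<in>{0..T}. \<forall>x\<ge>0. integral {0..x} (\<lambda>z. (sw z t - 1)\<^sup>2) \<le> M"
proof -
  define H where "H = (\<lambda>x t. (p x t)\<^sup>2 / 2 - u x t * (sw x t - 1)\<^sup>2)"
  have H_cont: "continuous_on ({0..} \<times> {0..T}) (\<lambda>(x, t). H x t)"
    unfolding H_def case_prod_beta'
    using u_cont p_cont sw_cont by (intro continuous_intros) (simp_all add: case_prod_beta')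
  have H_x: "((\<lambda>x. H x t) has_real_derivative
     2 * (sw x t - 1) * (- p x t * sw x t + u x t * r x t / (2 * sw x t))) (at x within {0..})"
    if "0 \<le> x" "t \<in> {0..T}" for x t
    unfolding H_def by (rule excess_flux_x[OF that])
  obtain E where E: "0 \<le> E" "\<And>x. 0 \<le> x \<Longrightarrow> integral {0..x} (\<lambda>z. (q z T)\<^sup>2) \<le> E"
    using q_L2[of T] T_pos by auto
  obtain K where K: "0 < K" "\<And>t x. t \<in> {0..T} \<Longrightarrow> 0 \<le> x \<Longrightarrow> \<bar>u x t\<bar> \<le> K * (1 + sqrt x)"
    using u_growth by blast
  obtain H0 where H0: "0 \<le> H0" "\<And>t. t \<in> {0..T} \<Longrightarrow> \<bar>H 0 t\<bar> \<le> H0"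
    using continuous_on_Icc_bounded[OF continuous_on_slice_t[OF H_cont, of 0]] by auto
  have TT: "T \<in> {0..T}" using T_pos by simp
  have "integral {0..x} (\<lambda>z. (sw z t - 1)\<^sup>2) \<le> E + H0 * T" if x: "0 \<le> x" and t: "t \<in> {0..T}" for x t
  proof -
    define a where "a = 1 + sqrt x"
    have a: "1 \<le> a" "sqrt x \<le> a" using x by (auto simp: a_def)
    define \<xi> where "\<xi> = (\<lambda>s. (a + K * s)\<^sup>2)"
    have \<xi>0: "0 \<le> \<xi> s" for s by (simp add: \<xi>_def)
    have \<xi>': "(\<xi> has_real_derivative 2 * K * (a + K * s)) (at s within S)" for s S
      unfolding \<xi>_def by (auto intro!: derivative_eq_intros)
    define g where "g = (\<lambda>s. integral {0..\<xi> s} (\<lambda>z. (sw z s - 1)\<^sup>2))"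
    define g' where "g' = (\<lambda>s. (sw (\<xi> s) s - 1)\<^sup>2 * (2 * K * (a + K * s)) + (H (\<xi> s) s - H 0 s))"
    have dg: "(g has_real_derivative g' s) (at s within {0..T})" if "s \<in> {0..T}" for s
      unfolding g_def g'_def
      by (rule C1_strip_chain[OF conservation_law_integral[OF excess_C1 H_x H_cont] order_refl that \<xi>0 \<xi>'])
    have g'_ge: "- H0 \<le> g' s" if s: "s \<in> {0..T}" for s
    proof -
      have abs: "1 \<le> a + K * s" using a K s by (simp add: add_increasing2)
      then have "sqrt (\<xi> s) = a + K * s" by (simp add: \<xi>_def)
      then have "\<bar>u (\<xi> s) s\<bar> \<le> K * (2 * (a + K * s))"
        using K(2)[OF s \<xi>0[of s]] abs K(1) by (intro order_trans[OF K(2)[OF s \<xi>0]] mult_left_mono) auto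
      then have "u (\<xi> s) s \<le> K * (2 * (a + K * s))" by (rule order_trans[OF abs_ge_self])
      then have "u (\<xi> s) s \<le> 2 * K * (a + K * s)" by (simp add: algebra_simps)
      then have "0 \<le> (sw (\<xi> s) s - 1)\<^sup>2 * (2 * K * (a + K * s) - u (\<xi> s) s)"
        by (intro mult_nonneg_nonneg) auto
      then have "0 \<le> (sw (\<xi> s) s - 1)\<^sup>2 * (2 * K * (a + K * s)) - u (\<xi> s) s * (sw (\<xi> s) s - 1)\<^sup>2"
        by (simp only: right_diff_distrib mult.commute[of "u (\<xi> s) s"])
      moreover have "H (\<xi> s) s = (p (\<xi> s) s)\<^sup>2 / 2 - u (\<xi> s) s * (sw (\<xi> s) s - 1)\<^sup>2"
        by (simp add: H_def)
      moreover have "0 \<le> (p (\<xi> s) s)\<^sup>2 / 2" by simp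
      moreover have "H 0 s \<le> H0" using H0(2)[OF s] by simp
      ultimately show ?thesis unfolding g'_def by linarith
    qed
    have "g t \<le> g T + H0 * T"
    proof (cases "t = T")
      case False
      then have tT: "t < T" using t by simp
      obtain z where z: "z \<in> {t<..<T}" "g T - g t = g' z * (T - t)"
      proof -
        have "(g has_derivative (\<lambda>h. g' s * h)) (at s within {t..T})" if "t \<le> s" "s \<le> T" for s
          using DERIV_subset[OF dg, of s "{t..T}"] that t by (simp add: has_field_derivative_def)
        from mvt_simple[OF tT this] show ?thesis using that by blast
      qed
      have "- H0 * (T - t) \<le> g' z * (T - t)"
        using g'_ge[of z] z(1) t tT by (intro mult_right_mono) auto
      then have "- H0 * (T - t) \<le> g T - g t" by (simp only: z(2))
      moreover have "H0 * (T - t) \<le> H0 * T" using H0 t by (intro mult_left_mono) auto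
      ultimately show ?thesis by simp
    qed (use H0 T_pos in auto)
    also have "g T \<le> E"
    proof -
      have "g T \<le> integral {0..\<xi> T} (\<lambda>z. (q z T)\<^sup>2)"
        unfolding g_def
      proof (rule integral_le)
        fix z assume z: "z \<in> {0..\<xi> T}"
        then have s: "0 < sw z T" using sw_pos[OF _ TT] by auto
        have "\<bar>sw z T - 1\<bar> * 1 \<le> \<bar>sw z T - 1\<bar> * (sw z T + 1)"
          using s by (intro mult_left_mono) auto
        also have "\<dots> = \<bar>q z T\<bar>"
        proof -
          have "q z T = - ((sw z T - 1) * (sw z T + 1))"
            using z q_eq_sw[OF _ TT, of z] by (simp add: power2_eq_square algebra_simps)
          then show ?thesis using s by (simp add: abs_mult)
        qed
        finally show "(sw z T - 1)\<^sup>2 \<le> (q z T)\<^sup>2"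
          by (simp add: abs_le_square_iff)
      qed (auto intro!: continuous_on_Ici_integrable continuous_intros continuous_on_slice_x[OF q_cont TT]
             continuous_on_slice_x[OF sw_cont TT])
      then show ?thesis using E(2)[OF \<xi>0[of T]] by simp
    qed
    finally have "g t \<le> E + H0 * T" by simp
    moreover have "x \<le> \<xi> t"
    proof -
      have "(sqrt x)\<^sup>2 \<le> (a + K * t)\<^sup>2"
        using a K t x by (intro power_mono) (auto intro: add_increasing2)
      then show ?thesis using x by (simp add: \<xi>_def)
    qed
    then have "integral {0..x} (\<lambda>z. (sw z t - 1)\<^sup>2) \<le> g t"
      unfolding g_def using x t
      by (intro integral_subset_le continuous_on_Ici_integrable continuous_intros continuous_on_slice_x[OF sw_cont]) auto
    ultimately show ?thesis by simp
  qed
  then show ?thesis using E H0 T_pos by (intro exI[of _ "E + H0 * T"]) auto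
qed

text \<open>
Since \<open>\<bar>q\<bar> \<le> 2 (sqrt w - 1)\<^sup>2 + 1\<close>, the oscillation of \<open>p\<close> on unit intervals is bounded; its
square average there is bounded by the energy.
\<close>

lemma p_bounded: "\<exists>B\<ge>0. \<forall>t\<in>{0..T}. \<forall>x\<ge>0. \<bar>p x t\<bar> \<le> B"
proof -
  obtain N where N: "0 \<le> N" "\<And>t x. t \<in> {0..T} \<Longrightarrow> 0 \<le> x \<Longrightarrow> integral {0..x} (\<lambda>z. (p z t)\<^sup>2) \<le> N"
    using energy_bound by blast
  obtain M where M: "0 \<le> M" "\<And>t x. t \<in> {0..T} \<Longrightarrow> 0 \<le> x \<Longrightarrow> integral {0..x} (\<lambda>z. (sw z t - 1)\<^sup>2) \<le> M"
    using excess_bound by blast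
  define R where "R = 2 * N + 2 * (2 * M + 1)\<^sup>2"
  have "\<bar>p x t\<bar> \<le> sqrt R" if x: "0 \<le> x" and t: "t \<in> {0..T}" for x t
  proof -
    note cp = continuous_on_slice_x[OF p_cont t] and cq = continuous_on_slice_x[OF q_cont t]
      and cs = continuous_on_slice_x[OF sw_cont t]
    have int: "g integrable_on {a..b}" if "continuous_on {0..} g" "0 \<le> a" for g :: "real \<Rightarrow> real" and a b
      using that by (intro continuous_on_Ici_integrable) auto
    have diff: "\<bar>p z t - p x t\<bar> \<le> 2 * M + 1" if z: "z \<in> {x..x+1}" for z
    proof -
      have "p z t - p x t = integral {x..z} (\<lambda>x. q x t)"
        using integral_derivative_Ici[OF p_x[OF _ t], of x z] x z by simp
      also have "norm \<dots> \<le> integral {x..z} (\<lambda>y. 2 * (sw y t - 1)\<^sup>2 + 1)"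
      proof (rule integral_norm_bound_integral)
        fix y assume "y \<in> {x..z}"
        then have y: "0 \<le> y" using x by simp
        define s where "s = sw y t"
        have s: "0 < s" using sw_pos[OF y t] by (simp add: s_def)
        have "2 * \<bar>s - 1\<bar> \<le> 1 + \<bar>s - 1\<bar>\<^sup>2"
          using zero_le_power2[of "\<bar>s - 1\<bar> - 1"] by (simp add: power2_diff)
        moreover have "\<bar>1 - s\<^sup>2\<bar> = \<bar>s - 1\<bar> * \<bar>s - 1 + 2\<bar>"
          by (simp add: abs_mult[symmetric] power2_eq_square algebra_simps abs_minus_commute)
        moreover have "\<bar>s - 1\<bar> * \<bar>s - 1 + 2\<bar> \<le> \<bar>s - 1\<bar> * (\<bar>s - 1\<bar> + 2)"
          by (intro mult_left_mono) auto
        ultimately show "norm (q y t) \<le> 2 * (sw y t - 1)\<^sup>2 + 1"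
          unfolding q_eq_sw[OF y t] s_def[symmetric] by (simp add: power2_eq_square algebra_simps)
      qed (use x z in \<open>auto intro!: int continuous_intros cq cs\<close>)
      also have "\<dots> \<le> integral {0..x+1} (\<lambda>y. 2 * (sw y t - 1)\<^sup>2) + integral {x..x+1} (\<lambda>y. 1)"
      proof -
        have "integral {x..z} (\<lambda>y. 2 * (sw y t - 1)\<^sup>2 + 1) =
            integral {x..z} (\<lambda>y. 2 * (sw y t - 1)\<^sup>2) + integral {x..z} (\<lambda>y. 1)"
          using x by (intro Henstock_Kurzweil_Integration.integral_add int continuous_intros cs) auto
        also have "\<dots> \<le> integral {0..x+1} (\<lambda>y. 2 * (sw y t - 1)\<^sup>2) + integral {x..x+1} (\<lambda>y. 1)"
          using x z by (intro add_mono integral_subset_le int continuous_intros cs) auto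
        finally show ?thesis .
      qed
      also have "\<dots> \<le> 2 * M + 1"
        using M(2)[OF t, of "x+1"] x by simp
      finally show ?thesis by simp
    qed
    have "(p x t)\<^sup>2 * (x + 1 - x) \<le> integral {x..x+1} (\<lambda>z. 2 * (p z t)\<^sup>2 + 2 * (2 * M + 1)\<^sup>2)"
    proof (rule const_le_integral)
      fix z assume z: "z \<in> {x..x+1}"
      have "(p z t - p x t)\<^sup>2 \<le> (2 * M + 1)\<^sup>2"
        using diff[OF z] M(1) by (simp add: abs_le_square_iff[symmetric])
      moreover have "(p x t)\<^sup>2 \<le> 2 * (p z t)\<^sup>2 + 2 * (p z t - p x t)\<^sup>2"
        using zero_le_power2[of "2 * p z t - p x t"] by (simp add: power2_diff power_mult_distrib algebra_simps)
      ultimately show "(p x t)\<^sup>2 \<le> 2 * (p z t)\<^sup>2 + 2 * (2 * M + 1)\<^sup>2" by linarith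
    qed (use x in \<open>auto intro!: int continuous_intros cp\<close>)
    also have "\<dots> = integral {x..x+1} (\<lambda>z. 2 * (p z t)\<^sup>2) + integral {x..x+1} (\<lambda>z. 2 * (2 * M + 1)\<^sup>2)"
      using x by (intro Henstock_Kurzweil_Integration.integral_add int continuous_intros cp) auto
    also have "integral {x..x+1} (\<lambda>z. 2 * (p z t)\<^sup>2) \<le> integral {0..x+1} (\<lambda>z. 2 * (p z t)\<^sup>2)"
      using x by (intro integral_subset_le int continuous_intros cp) auto
    also have "\<dots> \<le> 2 * N" using N(2)[OF t, of "x+1"] x by simp
    finally have "(p x t)\<^sup>2 \<le> R" by (simp add: R_def)
    then show ?thesis using real_le_rsqrt[of "\<bar>p x t\<bar>" R] by simp
  qed
  then show ?thesis using N by (intro exI[of _ "sqrt R"]) (auto simp: R_def)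
qed

lemma weighted_energy_bound: "\<exists>N\<ge>0. \<forall>t\<in>{0..T}. \<forall>x\<ge>0. integral {0..x} (\<lambda>z. (p z t)\<^sup>2 * sw z t) \<le> N"
proof -
  obtain N where N: "0 \<le> N" "\<And>t x. t \<in> {0..T} \<Longrightarrow> 0 \<le> x \<Longrightarrow> integral {0..x} (\<lambda>z. (p z t)\<^sup>2) \<le> N"
    using energy_bound by blast
  obtain M where M: "0 \<le> M" "\<And>t x. t \<in> {0..T} \<Longrightarrow> 0 \<le> x \<Longrightarrow> integral {0..x} (\<lambda>z. (sw z t - 1)\<^sup>2) \<le> M"
    using excess_bound by blast
  obtain B where B: "0 \<le> B" "\<And>t x. t \<in> {0..T} \<Longrightarrow> 0 \<le> x \<Longrightarrow> \<bar>p x t\<bar> \<le> B"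
    using p_bounded by blast
  have "integral {0..x} (\<lambda>z. (p z t)\<^sup>2 * sw z t) \<le> 2 * N + B\<^sup>2 * M" if x: "0 \<le> x" and t: "t \<in> {0..T}" for x t
  proof -
    note cp = continuous_on_slice_x[OF p_cont t] and cs = continuous_on_slice_x[OF sw_cont t]
    have int: "g integrable_on {0..x}" if "continuous_on {0..} g" for g :: "real \<Rightarrow> real"
      using that by (intro continuous_on_Ici_integrable) auto
    have "integral {0..x} (\<lambda>z. (p z t)\<^sup>2 * sw z t) \<le> integral {0..x} (\<lambda>z. 2 * (p z t)\<^sup>2 + B\<^sup>2 * (sw z t - 1)\<^sup>2)"
    proof (rule integral_le)
      fix z assume "z \<in> {0..x}"
      then have z: "0 \<le> z" by simp
      have "sw z t \<le> 2 + (sw z t - 1)\<^sup>2"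
        using zero_le_power2[of "2 * sw z t - 3"] by (simp add: power2_diff power_mult_distrib algebra_simps)
      then have "(p z t)\<^sup>2 * sw z t \<le> (p z t)\<^sup>2 * (2 + (sw z t - 1)\<^sup>2)"
        by (intro mult_left_mono) auto
      also have "\<dots> = 2 * (p z t)\<^sup>2 + (p z t)\<^sup>2 * (sw z t - 1)\<^sup>2" by (simp add: algebra_simps)
      also have "(p z t)\<^sup>2 * (sw z t - 1)\<^sup>2 \<le> B\<^sup>2 * (sw z t - 1)\<^sup>2"
        using B(2)[OF t z] B(1) by (intro mult_right_mono) (auto simp: abs_le_square_iff[symmetric])
      finally show "(p z t)\<^sup>2 * sw z t \<le> 2 * (p z t)\<^sup>2 + B\<^sup>2 * (sw z t - 1)\<^sup>2" by simp
    qed (auto intro!: int continuous_intros cp cs)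
    also have "\<dots> = integral {0..x} (\<lambda>z. 2 * (p z t)\<^sup>2) + integral {0..x} (\<lambda>z. B\<^sup>2 * (sw z t - 1)\<^sup>2)"
      by (intro Henstock_Kurzweil_Integration.integral_add int continuous_intros cp cs)
    also have "\<dots> = 2 * integral {0..x} (\<lambda>z. (p z t)\<^sup>2) + B\<^sup>2 * integral {0..x} (\<lambda>z. (sw z t - 1)\<^sup>2)"
      by simp
    also have "\<dots> \<le> 2 * N + B\<^sup>2 * M"
      using N(2)[OF t x] M(2)[OF t x] by (intro add_mono mult_left_mono) auto
    finally show ?thesis .
  qed
  then show ?thesis using N M by (intro exI[of _ "2 * N + B\<^sup>2 * M"]) auto
qed

end

section \<open>Lagrangian coordinates\<close>

lemma mvt_Ici:
  fixes f f' :: "real \<Rightarrow> real"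
  assumes f: "\<And>x. 0 \<le> x \<Longrightarrow> (f has_real_derivative f' x) (at x within {0..})" and xy: "0 \<le> x" "0 \<le> y"
  shows "\<exists>z\<ge>0. \<bar>z - x\<bar> \<le> \<bar>y - x\<bar> \<and> f y - f x = f' z * (y - x)"
proof -
  have *: "\<exists>z\<in>{a<..<b}. f b - f a = f' z * (b - a)" if "0 \<le> a" "a < b" for a b
  proof (rule mvt_simple[OF that(2)])
    fix s assume "a \<le> s" "s \<le> b"
    then show "(f has_derivative (*) (f' s)) (at s within {a..b})"
      using DERIV_subset[OF f, of s "{a..b}"] that by (simp add: has_field_derivative_def)
  qed
  consider "x < y" | "x = y" | "y < x" by linarith
  then show ?thesis
  proof cases
    case 1
    then obtain z where "z \<in> {x<..<y}" "f y - f x = f' z * (y - x)" using *[OF xy(1)] by blast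
    then show ?thesis using xy by (intro exI[of _ z]) auto
  next
    case 2
    then show ?thesis using xy by auto
  next
    case 3
    then obtain z where "z \<in> {y<..<x}" "f x - f y = f' z * (x - y)" using *[OF xy(2)] by blast
    then show ?thesis using xy by (intro exI[of _ z]) (auto simp: algebra_simps)
  qed
qed

context short_wave begin

text \<open>
The Lagrangian label \<open>lag x t\<close> is the mass coordinate: \<open>lag\<^sub>x = sqrt w\<close> and \<open>lag\<^sub>t = - u sqrt w\<close>, so
that it is constant along the flow of \<open>u\<close>.  Its value \<open>lag0 t\<close> at \<open>x = 0\<close> accounts for the mass
that has left through the boundary; by outflow it is nondecreasing in \<open>t\<close>.
\<close>

definition lag0 :: "real \<Rightarrow> real" where
  "lag0 t = integral {0..t} (\<lambda>s. - u 0 s * sw 0 s)"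

definition lag :: "real \<Rightarrow> real \<Rightarrow> real" where
  "lag x t = integral {0..x} (\<lambda>z. sw z t) + lag0 t"

lemma lag0_0 [simp]: "lag0 0 = 0"
  by (simp add: lag0_def)

lemma lag_0 [simp]: "lag 0 t = lag0 t"
  by (simp add: lag_def)

lemma lag0_mono:
  assumes "0 \<le> s" "s \<le> t" "t \<in> {0..T}"
  shows "lag0 s \<le> lag0 t"
  unfolding lag0_def
proof (rule integral_subset_le)
  have c: "continuous_on {0..T} (\<lambda>s. - u 0 s * sw 0 s)"
    by (intro continuous_intros continuous_on_slice_t[OF u_cont] continuous_on_slice_t[OF sw_cont]) auto
  show "(\<lambda>s. - u 0 s * sw 0 s) integrable_on {0..s}" "(\<lambda>s. - u 0 s * sw 0 s) integrable_on {0..t}"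
    using assms by (intro integrable_continuous_real continuous_on_subset[OF c]; auto)+
  show "\<forall>\<tau>\<in>{0..t}. 0 \<le> - u 0 \<tau> * sw 0 \<tau>"
  proof
    fix \<tau> assume "\<tau> \<in> {0..t}"
    then have \<tau>: "\<tau> \<in> {0..T}" using assms by auto
    show "0 \<le> - u 0 \<tau> * sw 0 \<tau>"
      using outflow[OF \<tau>] sw_pos[OF order_refl \<tau>] by (intro mult_nonneg_nonneg) auto
  qed
qed (use assms in auto)

lemma lag_C1: "C1_strip T lag sw (\<lambda>x t. - u x t * sw x t)"
proof -
  let ?H = "\<lambda>x t. - u x t * sw x t"
  have H_x: "((\<lambda>x. ?H x t) has_real_derivative - p x t * sw x t + u x t * r x t / (2 * sw x t)) (at x within {0..})"
    if "0 \<le> x" "t \<in> {0..T}" for x t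
    using DERIV_mult[OF DERIV_minus[OF u_x[OF that]] sw_x[OF that]] by (simp add: mult.commute)
  have H_cont: "continuous_on ({0..} \<times> {0..T}) (\<lambda>(x, t). ?H x t)"
    unfolding case_prod_beta' using u_cont sw_cont by (intro continuous_intros) (simp_all add: case_prod_beta')
  have C1: "C1_strip T (\<lambda>x t. integral {0..x} (\<lambda>z. sw z t)) sw (\<lambda>x t. ?H x t - ?H 0 t)"
    by (rule conservation_law_integral[OF sw_C1 H_x H_cont])
  have d0: "(lag0 has_real_derivative ?H 0 t) (at t within {0..T})" if "t \<in> {0..T}" for t
    unfolding lag0_def[abs_def]
    using that by (intro integral_has_real_derivative continuous_on_slice_t[OF H_cont]) auto
  show ?thesis
    unfolding C1_strip_def
  proof (intro conjI allI impI ballI)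
    fix x t :: real assume xt: "0 \<le> x" "t \<in> {0..T}"
    have 1: "((\<lambda>x. integral {0..x} (\<lambda>z. sw z t)) has_real_derivative sw x t) (at x within {0..})"
      and 2: "((\<lambda>t. integral {0..x} (\<lambda>z. sw z t)) has_real_derivative ?H x t - ?H 0 t) (at t within {0..T})"
      using C1 xt unfolding C1_strip_def by blast+
    show "((\<lambda>x. lag x t) has_real_derivative sw x t) (at x within {0..})"
      unfolding lag_def using DERIV_add[OF 1 DERIV_const[of "lag0 t"]] by simp
    show "((\<lambda>t. lag x t) has_real_derivative ?H x t) (at t within {0..T})"
      unfolding lag_def using DERIV_add[OF 2 d0[OF xt(2)]] by simp
  qed (rule sw_cont H_cont)+
qed

lemma lag_x: "\<lbrakk>0 \<le> x; t \<in> {0..T}\<rbrakk> \<Longrightarrow> ((\<lambda>x. lag x t) has_real_derivative sw x t) (at x within {0..})"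
  and lag_t: "\<lbrakk>0 \<le> x; t \<in> {0..T}\<rbrakk> \<Longrightarrow> ((\<lambda>t. lag x t) has_real_derivative - u x t * sw x t) (at t within {0..T})"
  using lag_C1[unfolded C1_strip_def] by blast+

lemma lag_less_iff:
  assumes t: "t \<in> {0..T}" and x: "0 \<le> x" "0 \<le> y"
  shows "lag x t < lag y t \<longleftrightarrow> x < y"
proof -
  obtain z where "0 \<le> z" "lag y t - lag x t = sw z t * (y - x)"
    using mvt_Ici[OF lag_x[OF _ t] x] by blast
  moreover from this have "0 < sw z t * (y - x) \<longleftrightarrow> 0 < y - x"
    using sw_pos[OF _ t, of z] by (simp add: zero_less_mult_iff)
  ultimately show ?thesis by linarith
qed

lemma lag_surj:
  assumes t: "t \<in> {0..T}" and y: "lag0 t \<le> y"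
  shows "\<exists>x\<ge>0. lag x t = y"
proof -
  obtain M where M: "0 \<le> M" "\<And>t x. t \<in> {0..T} \<Longrightarrow> 0 \<le> x \<Longrightarrow> integral {0..x} (\<lambda>z. (sw z t - 1)\<^sup>2) \<le> M"
    using excess_bound by blast
  note cs = continuous_on_slice_x[OF sw_cont t]
  define x where "x = 2 * (M + (y - lag0 t))"
  have x: "0 \<le> x" using M y by (simp add: x_def)
  have int: "g integrable_on {0..x}" if "continuous_on {0..} g" for g :: "real \<Rightarrow> real"
    using that by (intro continuous_on_Ici_integrable) auto
  have "1 / 2 * (x - 0) \<le> integral {0..x} (\<lambda>z. sw z t + (sw z t - 1)\<^sup>2)"
  proof (rule const_le_integral)
    fix z
    show "1 / 2 \<le> sw z t + (sw z t - 1)\<^sup>2"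
      using zero_le_power2[of "2 * sw z t - 1"] by (simp add: power2_diff power_mult_distrib algebra_simps)
  qed (use x in \<open>auto intro!: int continuous_intros cs\<close>)
  also have "\<dots> = integral {0..x} (\<lambda>z. sw z t) + integral {0..x} (\<lambda>z. (sw z t - 1)\<^sup>2)"
    by (intro Henstock_Kurzweil_Integration.integral_add int continuous_intros cs)
  finally have "y \<le> lag x t"
    using M(2)[OF t x] unfolding lag_def x_def by simp
  then show ?thesis
    using IVT'[of "\<lambda>x. lag x t" 0 y x] y x
      continuous_on_subset[OF has_real_derivative_Ici_imp_continuous_on[OF lag_x[OF _ t]], of "{0..x}"]
    by auto
qed

text \<open>
The position at time \<open>t\<close> of the particle with label \<open>y\<close>, the inverse of \<open>\<lambda>x. lag x t\<close>.  It is
meaningful for \<open>y \<ge> lag0 t\<close>.  Inverting the label replaces the solution of the characteristic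
differential equation.
\<close>

definition pos :: "real \<Rightarrow> real \<Rightarrow> real" where
  "pos y t = (SOME x. 0 \<le> x \<and> lag x t = y)"

lemma pos_nonneg: "\<lbrakk>t \<in> {0..T}; lag0 t \<le> y\<rbrakk> \<Longrightarrow> 0 \<le> pos y t"
  and lag_pos: "\<lbrakk>t \<in> {0..T}; lag0 t \<le> y\<rbrakk> \<Longrightarrow> lag (pos y t) t = y"
  using someI_ex[OF lag_surj, of t y] unfolding pos_def by blast+

lemma pos_less_iff:
  assumes "t \<in> {0..T}" "lag0 t \<le> y" "0 \<le> x"
  shows "pos y t < x \<longleftrightarrow> y < lag x t" "x < pos y t \<longleftrightarrow> lag x t < y"
  using lag_less_iff[OF assms(1) pos_nonneg[OF assms(1,2)] assms(3)]
    lag_less_iff[OF assms(1) assms(3) pos_nonneg[OF assms(1,2)]] lag_pos[OF assms(1,2)] by auto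

lemma lag0_le_lag:
  assumes "t \<in> {0..T}" "0 \<le> x"
  shows "lag0 t \<le> lag x t"
  using lag_less_iff[OF assms(1) assms(2), of 0] assms by (simp flip: not_less)

lemma pos_lag:
  assumes "t \<in> {0..T}" "0 \<le> x"
  shows "pos (lag x t) t = x"
  using pos_less_iff[OF assms(1) lag0_le_lag[OF assms] assms(2)] by auto

text \<open>
The labels of the particles that are still in the half-line at time \<open>T\<close>, hence at every earlier
time.
\<close>

abbreviation "lagdom \<equiv> {lag0 T..}"

lemma lagdom_ge: "\<lbrakk>y \<in> lagdom; t \<in> {0..T}\<rbrakk> \<Longrightarrow> lag0 t \<le> y"
  using lag0_mono[of t T] by force

lemma lag_cont: "continuous_on ({0..} \<times> {0..T}) (\<lambda>(x, t). lag x t)"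
  by (rule C1_strip_continuous_on[OF lag_C1])

lemma pos_cont: "continuous_on (lagdom \<times> {0..T}) (\<lambda>(y, t). pos y t)"
  unfolding continuous_on_def
proof
  fix z0 :: "real \<times> real" assume "z0 \<in> lagdom \<times> {0..T}"
  then obtain y t where z0: "z0 = (y, t)" and y: "y \<in> lagdom" and t: "t \<in> {0..T}" by blast
  note yt = lagdom_ge[OF y t]
  let ?F = "at (y, t) within lagdom \<times> {0..T}"
  have mem: "\<forall>\<^sub>F z in ?F. z \<in> lagdom \<times> {0..T}"
    by (simp add: eventually_at_filter)
  have lim: "((\<lambda>z. lag a (snd z) - fst z) \<longlongrightarrow> lag a t - y) ?F" if "0 \<le> a" for a
  proof -
    have "continuous_on (lagdom \<times> {0..T}) (\<lambda>z. lag a (snd z) - fst z)"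
      by (intro continuous_intros continuous_on_compose2[OF continuous_on_slice_t[OF lag_cont, of a]])
         (use that in auto)
    then show ?thesis using y t by (auto simp: continuous_on_def)
  qed
  show "((\<lambda>(y, t). pos y t) \<longlongrightarrow> (\<lambda>(y, t). pos y t) z0) (at z0 within lagdom \<times> {0..T})"
    unfolding z0 prod.case
  proof (rule order_tendstoI)
    fix a assume a: "pos y t < a"
    have a0: "0 \<le> a" using a pos_nonneg[OF t yt] by simp
    have "0 < lag a t - y" using a pos_less_iff(1)[OF t yt a0] by simp
    from order_tendstoD(1)[OF lim[OF a0] this] mem
    show "\<forall>\<^sub>F z in ?F. (\<lambda>(y, t). pos y t) z < a"
    proof eventually_elim
      case (elim z)
      then show ?case
        using pos_less_iff(1)[OF _ lagdom_ge a0, of "snd z" "fst z"] by (auto simp: case_prod_beta')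
    qed
  next
    fix a assume a: "a < pos y t"
    show "\<forall>\<^sub>F z in ?F. a < (\<lambda>(y, t). pos y t) z"
    proof (cases "0 \<le> a")
      case True
      have "lag a t - y < 0" using a pos_less_iff(2)[OF t yt True] by simp
      from order_tendstoD(2)[OF lim[OF True] this] mem
      show ?thesis
      proof eventually_elim
        case (elim z)
        then show ?case
          using pos_less_iff(2)[OF _ lagdom_ge True, of "snd z" "fst z"] by (auto simp: case_prod_beta')
      qed
    next
      case False
      show ?thesis
        using mem
      proof eventually_elim
        case (elim z)
        then show ?case
          using pos_nonneg[OF _ lagdom_ge, of "snd z" "fst z"] False by (auto simp: case_prod_beta')
      qed
    qed
  qed
qed

lemma pos_y:
  assumes y: "y \<in> lagdom" and t: "t \<in> {0..T}"
  shows "((\<lambda>y. pos y t) has_real_derivative 1 / sw (pos y t) t) (at y within lagdom)"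
proof -
  define x where "x = pos y t"
  have x: "0 \<le> x" unfolding x_def by (rule pos_nonneg[OF t lagdom_ge[OF y t]])
  have "\<forall>y'\<in>lagdom. \<exists>z\<ge>0. \<bar>z - x\<bar> \<le> \<bar>pos y' t - x\<bar> \<and> y' - y = sw z t * (pos y' t - x)"
  proof
    fix y' assume y': "y' \<in> lagdom"
    show "\<exists>z\<ge>0. \<bar>z - x\<bar> \<le> \<bar>pos y' t - x\<bar> \<and> y' - y = sw z t * (pos y' t - x)"
      using mvt_Ici[OF lag_x[OF _ t] x pos_nonneg[OF t lagdom_ge[OF y' t]]]
        lag_pos[OF t lagdom_ge[OF y' t]] lag_pos[OF t lagdom_ge[OF y t]] by (simp add: x_def)
  qed
  then obtain \<zeta> where \<zeta>: "\<And>y'. y' \<in> lagdom \<Longrightarrow> 0 \<le> \<zeta> y'" "\<And>y'. y' \<in> lagdom \<Longrightarrow> \<bar>\<zeta> y' - x\<bar> \<le> \<bar>pos y' t - x\<bar>"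
    "\<And>y'. y' \<in> lagdom \<Longrightarrow> y' - y = sw (\<zeta> y') t * (pos y' t - x)"
    by metis
  let ?F = "at y within lagdom"
  have mem: "\<forall>\<^sub>F y' in ?F. y' \<in> lagdom \<and> y' \<noteq> y"
    by (simp add: eventually_at_filter)
  have "((\<lambda>y'. pos y' t) \<longlongrightarrow> x) ?F"
    using continuous_on_slice_x[OF pos_cont t] y by (auto simp: continuous_on_def x_def)
  then have "((\<lambda>y'. \<bar>pos y' t - x\<bar>) \<longlongrightarrow> \<bar>x - x\<bar>) ?F" by (intro tendsto_intros)
  then have lim0: "((\<lambda>y'. \<bar>pos y' t - x\<bar>) \<longlongrightarrow> 0) ?F" by simp
  have "((\<lambda>y'. \<zeta> y' - x) \<longlongrightarrow> 0) ?F"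
    by (rule Lim_null_comparison[OF _ lim0]) (use mem \<zeta>(2) in \<open>auto elim!: eventually_mono\<close>)
  then have \<zeta>_lim: "(\<zeta> \<longlongrightarrow> x) ?F" by (simp add: LIM_zero_iff)
  have "((\<lambda>y'. sw (\<zeta> y') t) \<longlongrightarrow> sw x t) ?F"
    by (rule continuous_on_tendsto_compose[OF continuous_on_slice_x[OF sw_cont t] \<zeta>_lim])
       (use x mem \<zeta>(1) in \<open>auto elim!: eventually_mono\<close>)
  then have "((\<lambda>y'. 1 / sw (\<zeta> y') t) \<longlongrightarrow> 1 / sw x t) ?F"
    using sw_pos[OF x t] by (intro tendsto_intros) auto
  moreover have "\<forall>\<^sub>F y' in ?F. (pos y' t - pos y t) / (y' - y) = 1 / sw (\<zeta> y') t"
    using mem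
  proof eventually_elim
    case (elim y')
    then have "0 < sw (\<zeta> y') t" using sw_pos[OF \<zeta>(1) t] by blast
    moreover have "pos y' t - x \<noteq> 0" using \<zeta>(3)[of y'] elim by auto
    ultimately show ?case
      using \<zeta>(3)[of y'] elim by (simp add: x_def[symmetric])
  qed
  ultimately show ?thesis
    unfolding has_field_derivative_iff x_def[symmetric]
    by (subst tendsto_cong) (auto simp: x_def)
qed

lemma pos_t:
  assumes y: "y \<in> lagdom" and t: "t \<in> {0..T}"
  shows "((\<lambda>t. pos y t) has_real_derivative u (pos y t) t) (at t within {0..T})"
proof -
  define x where "x = pos y t"
  have x: "0 \<le> x" unfolding x_def by (rule pos_nonneg[OF t lagdom_ge[OF y t]])
  have "\<forall>t'\<in>{0..T}. \<exists>z\<ge>0. \<bar>z - x\<bar> \<le> \<bar>pos y t' - x\<bar> \<and> - (lag x t' - lag x t) = sw z t' * (pos y t' - x)"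
  proof
    fix t' assume t': "t' \<in> {0..T}"
    show "\<exists>z\<ge>0. \<bar>z - x\<bar> \<le> \<bar>pos y t' - x\<bar> \<and> - (lag x t' - lag x t) = sw z t' * (pos y t' - x)"
      using mvt_Ici[OF lag_x[OF _ t'] x pos_nonneg[OF t' lagdom_ge[OF y t']]]
        lag_pos[OF t' lagdom_ge[OF y t']] lag_pos[OF t lagdom_ge[OF y t]] by (simp add: x_def)
  qed
  then obtain \<zeta> where \<zeta>: "\<And>t'. t' \<in> {0..T} \<Longrightarrow> 0 \<le> \<zeta> t'" "\<And>t'. t' \<in> {0..T} \<Longrightarrow> \<bar>\<zeta> t' - x\<bar> \<le> \<bar>pos y t' - x\<bar>"
    "\<And>t'. t' \<in> {0..T} \<Longrightarrow> - (lag x t' - lag x t) = sw (\<zeta> t') t' * (pos y t' - x)"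
    by metis
  let ?F = "at t within {0..T}"
  have mem: "\<forall>\<^sub>F t' in ?F. t' \<in> {0..T} \<and> t' \<noteq> t"
    by (simp add: eventually_at_filter)
  have "((\<lambda>t'. pos y t') \<longlongrightarrow> x) ?F"
    using continuous_on_slice_t[OF pos_cont y] t by (auto simp: continuous_on_def x_def)
  then have "((\<lambda>t'. \<bar>pos y t' - x\<bar>) \<longlongrightarrow> \<bar>x - x\<bar>) ?F" by (intro tendsto_intros)
  then have lim0: "((\<lambda>t'. \<bar>pos y t' - x\<bar>) \<longlongrightarrow> 0) ?F" by simp
  have "((\<lambda>t'. \<zeta> t' - x) \<longlongrightarrow> 0) ?F"
    by (rule Lim_null_comparison[OF _ lim0]) (use mem \<zeta>(2) in \<open>auto elim!: eventually_mono\<close>)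
  then have \<zeta>_lim: "(\<zeta> \<longlongrightarrow> x) ?F" by (simp add: LIM_zero_iff)
  have "((\<lambda>t'. (\<zeta> t', t')) \<longlongrightarrow> (x, t)) ?F"
    by (intro tendsto_intros \<zeta>_lim)
  then have "((\<lambda>t'. (\<lambda>(x, t). sw x t) (\<zeta> t', t')) \<longlongrightarrow> (\<lambda>(x, t). sw x t) (x, t)) ?F"
    by (rule continuous_on_tendsto_compose[OF sw_cont])
       (use x t mem \<zeta>(1) in \<open>auto elim!: eventually_mono\<close>)
  then have sw_lim: "((\<lambda>t'. sw (\<zeta> t') t') \<longlongrightarrow> sw x t) ?F" by simp
  have "((\<lambda>t'. (lag x t' - lag x t) / (t' - t)) \<longlongrightarrow> - u x t * sw x t) ?F"
    using lag_t[OF x t] by (simp add: has_field_derivative_iff)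
  then have "((\<lambda>t'. - ((lag x t' - lag x t) / (t' - t)) / sw (\<zeta> t') t') \<longlongrightarrow> - (- u x t * sw x t) / sw x t) ?F"
    using sw_pos[OF x t] by (intro tendsto_intros sw_lim) auto
  then have "((\<lambda>t'. - ((lag x t' - lag x t) / (t' - t)) / sw (\<zeta> t') t') \<longlongrightarrow> u x t) ?F"
    using sw_pos[OF x t] by simp
  moreover have "\<forall>\<^sub>F t' in ?F. (pos y t' - pos y t) / (t' - t) = - ((lag x t' - lag x t) / (t' - t)) / sw (\<zeta> t') t'"
    using mem
  proof eventually_elim
    case (elim t')
    then have "0 < sw (\<zeta> t') t'" using sw_pos[OF \<zeta>(1)] by blast
    then have "- (lag x t' - lag x t) / sw (\<zeta> t') t' = pos y t' - x"
      using \<zeta>(3)[of t'] elim by simp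
    then have "(pos y t' - x) / (t' - t) = (- (lag x t' - lag x t) / sw (\<zeta> t') t') / (t' - t)" by (simp only:)
    also have "\<dots> = - ((lag x t' - lag x t) / (t' - t)) / sw (\<zeta> t') t'"
      by (simp only: divide_divide_eq_left minus_divide_left mult.commute)
    finally show ?case by (simp only: x_def)
  qed
  ultimately show ?thesis
    unfolding has_field_derivative_iff x_def[symmetric]
    by (subst tendsto_cong) (auto simp: x_def)
qed

text \<open>
The two Lagrangian unknowns: \<open>hl\<close> is the logarithm of the stretching \<open>pos\<^sub>y = 1 / sqrt w\<close>, and
\<open>pl\<close> is \<open>u\<^sub>x\<close> along particle paths.  They satisfy \<open>hl\<^sub>t = pl\<close> and \<open>pl\<^sub>y = 2 sinh hl\<close>.
\<close>

definition hl :: "real \<Rightarrow> real \<Rightarrow> real" where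
  "hl y t = - ln (sw (pos y t) t)"

definition pl :: "real \<Rightarrow> real \<Rightarrow> real" where
  "pl y t = p (pos y t) t"

lemma pos_dom: "\<lbrakk>y \<in> lagdom; t \<in> {0..T}\<rbrakk> \<Longrightarrow> 0 \<le> pos y t"
  by (intro pos_nonneg lagdom_ge)

lemma sw_pos_lag: "\<lbrakk>y \<in> lagdom; t \<in> {0..T}\<rbrakk> \<Longrightarrow> 0 < sw (pos y t) t"
  by (intro sw_pos pos_dom)

lemma continuous_on_lagrange:
  assumes "continuous_on ({0..} \<times> {0..T}) (\<lambda>(x, t). f x t)"
  shows "continuous_on (lagdom \<times> {0..T}) (\<lambda>(y, t). f (pos y t) t)"
proof -
  have "continuous_on (lagdom \<times> {0..T}) (\<lambda>z. f ((\<lambda>(y, t). pos y t) z) (snd z))"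
    by (rule continuous_on_args[OF assms pos_cont]) (auto intro!: continuous_intros pos_dom)
  then show ?thesis by (simp add: case_prod_beta')
qed

lemma hl_cont: "continuous_on (lagdom \<times> {0..T}) (\<lambda>(y, t). hl y t)"
  unfolding hl_def case_prod_beta'
  using continuous_on_lagrange[OF sw_cont] sw_pos_lag
  by (intro continuous_intros) (force simp: case_prod_beta')+

lemma pl_cont: "continuous_on (lagdom \<times> {0..T}) (\<lambda>(y, t). pl y t)"
  unfolding pl_def by (rule continuous_on_lagrange[OF p_cont])

lemma hl_t:
  assumes y: "y \<in> lagdom" and t: "t \<in> {0..T}"
  shows "((\<lambda>t. hl y t) has_real_derivative pl y t) (at t within {0..T})"
proof -
  have s: "0 < sw (pos y t) t" by (rule sw_pos_lag[OF y t])
  have "((\<lambda>t. sw (pos y t) t) has_real_derivative - r (pos y t) t / (2 * sw (pos y t) t) * u (pos y t) t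
      + (- p (pos y t) t * sw (pos y t) t + u (pos y t) t * r (pos y t) t / (2 * sw (pos y t) t))) (at t within {0..T})"
    by (rule C1_strip_chain[OF sw_C1 order_refl t pos_dom[OF y] pos_t[OF y t]])
  then have "((\<lambda>t. sw (pos y t) t) has_real_derivative - pl y t * sw (pos y t) t) (at t within {0..T})"
    by (simp add: pl_def mult.commute)
  from DERIV_minus[OF DERIV_chain2[OF DERIV_ln_divide[OF s] this]] show ?thesis
    unfolding hl_def using s by simp
qed

lemma DERIV_compose_pos:
  assumes f: "\<And>x. 0 \<le> x \<Longrightarrow> (f has_real_derivative f' x) (at x within {0..})"
    and y: "y \<in> lagdom" and t: "t \<in> {0..T}"
  shows "((\<lambda>y. f (pos y t)) has_real_derivative f' (pos y t) / sw (pos y t) t) (at y within lagdom)"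
proof -
  have "(f has_real_derivative f' (pos y t)) (at (pos y t) within (\<lambda>y. pos y t) ` lagdom)"
    by (rule DERIV_subset[OF f[OF pos_dom[OF y t]]]) (use t in \<open>auto intro: pos_dom\<close>)
  from DERIV_image_chain[OF this pos_y[OF y t]] show ?thesis by (simp add: o_def)
qed

lemma pl_y:
  assumes y: "y \<in> lagdom" and t: "t \<in> {0..T}"
  shows "((\<lambda>y. pl y t) has_real_derivative 2 * sinh (hl y t)) (at y within lagdom)"
proof -
  have s: "0 < sw (pos y t) t" by (rule sw_pos_lag[OF y t])
  have "2 * sinh (hl y t) = inverse (sw (pos y t) t) - sw (pos y t) t"
    using s by (simp add: sinh_field_def hl_def exp_minus)
  also have "\<dots> = q (pos y t) t / sw (pos y t) t"
    using s q_eq_sw[OF pos_dom[OF y t] t] by (simp add: field_simps power2_eq_square)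
  finally show ?thesis
    using DERIV_compose_pos[OF p_x[OF _ t] y t] by (simp add: pl_def)
qed

lemma pl_bounded: "\<exists>B\<ge>0. \<forall>y\<in>lagdom. \<forall>t\<in>{0..T}. \<bar>pl y t\<bar> \<le> B"
  using p_bounded pos_dom unfolding pl_def by blast

lemma pl_L2: "\<exists>N\<ge>0. \<forall>t\<in>{0..T}. \<forall>a\<in>lagdom. \<forall>b\<ge>a. integral {a..b} (\<lambda>y. (pl y t)\<^sup>2) \<le> N"
proof -
  obtain N where N: "0 \<le> N" "\<And>t x. t \<in> {0..T} \<Longrightarrow> 0 \<le> x \<Longrightarrow> integral {0..x} (\<lambda>z. (p z t)\<^sup>2 * sw z t) \<le> N"
    using weighted_energy_bound by blast
  have "integral {a..b} (\<lambda>y. (pl y t)\<^sup>2) \<le> N" if t: "t \<in> {0..T}" and a: "a \<in> lagdom" and ab: "a \<le> b" for t a b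
  proof -
    let ?G = "\<lambda>x. integral {0..x} (\<lambda>z. (p z t)\<^sup>2 * sw z t)"
    have c: "continuous_on {0..} (\<lambda>z. (p z t)\<^sup>2 * sw z t)"
      by (intro continuous_intros continuous_on_slice_x[OF p_cont t] continuous_on_slice_x[OF sw_cont t])
    have G: "(?G has_real_derivative (p x t)\<^sup>2 * sw x t) (at x within {0..})" if "0 \<le> x" for x
      by (rule integral_upper_limit_has_real_derivative[OF c that])
    have "((\<lambda>y. ?G (pos y t)) has_real_derivative (pl y t)\<^sup>2) (at y within {a..b})" if "y \<in> {a..b}" for y
    proof -
      have y: "y \<in> lagdom" using that a by auto
      have "((\<lambda>y. ?G (pos y t)) has_real_derivative (pl y t)\<^sup>2) (at y within lagdom)"
        using DERIV_compose_pos[OF G y t] sw_pos_lag[OF y t] by (simp add: pl_def)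
      then show ?thesis by (rule DERIV_subset) (use a in auto)
    qed
    then have "integral {a..b} (\<lambda>y. (pl y t)\<^sup>2) = ?G (pos b t) - ?G (pos a t)"
      by (rule integral_eq_diff_of_derivative[OF ab])
    moreover have "b \<in> lagdom" using a ab by auto
    then have "?G (pos b t) \<le> N" by (intro N(2) t pos_dom)
    moreover have "0 \<le> ?G (pos a t)"
    proof (intro Henstock_Kurzweil_Integration.integral_nonneg continuous_on_Ici_integrable c order_refl)
      fix z assume "z \<in> {0..pos a t}"
      then show "0 \<le> (p z t)\<^sup>2 * sw z t" using sw_pos[OF _ t, of z] by simp
    qed
    ultimately show ?thesis by simp
  qed
  then show ?thesis using N(1) by blast
qed

lemma u_pos_tendsto_0:
  assumes t: "t \<in> {0..T}"
  shows "((\<lambda>y. u (pos y t) t) \<longlongrightarrow> 0) at_top"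
proof -
  have "filterlim (\<lambda>y. pos y t) at_top at_top"
    unfolding filterlim_at_top_ge[where c = 0]
  proof (intro allI impI)
    fix x :: real assume x: "0 \<le> x"
    have "x \<le> pos y t" if "y \<ge> lag x t" for y
      using pos_less_iff(1)[OF t order_trans[OF lag0_le_lag[OF t x] that] x] that by linarith
    then show "\<forall>\<^sub>F y in at_top. x \<le> pos y t"
      unfolding eventually_at_top_linorder by blast
  qed
  from filterlim_compose[OF u_tendsto_0[OF t] this] show ?thesis .
qed

end

section \<open>Uniqueness for the sinh-Gordon system\<close>

text \<open>
\<open>R\<close> is the convexity remainder of \<open>cosh\<close> at \<open>b\<close>, and \<open>S\<close> is that of \<open>sinh\<close>.  Both \<open>R + S\<close> and
\<open>R - S\<close> are convexity remainders of exponentials, hence nonnegative.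
\<close>

lemma exp_convexity_remainders:
  fixes a b :: real
  defines "R \<equiv> cosh a - cosh b - sinh b * (a - b)" and "S \<equiv> sinh a - sinh b - cosh b * (a - b)"
  shows "\<bar>S\<bar> \<le> R" and "R = 0 \<Longrightarrow> a = b"
proof -
  have ex: "exp a = exp b * exp (a - b)" "exp (- a) = exp (- b) * exp (- (a - b))"
    by (simp_all flip: exp_add)
  have plus: "R + S = exp b * (exp (a - b) - (1 + (a - b)))"
    unfolding R_def S_def cosh_field_def sinh_field_def ex by (simp add: field_simps)
  have minus: "R - S = exp (- b) * (exp (- (a - b)) - (1 - (a - b)))"
    unfolding R_def S_def cosh_field_def sinh_field_def ex by (simp add: field_simps)
  have "0 \<le> exp (a - b) - (1 + (a - b))" "0 \<le> exp (- (a - b)) - (1 - (a - b))"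
    using exp_ge_add_one_self[of "a - b"] exp_ge_add_one_self[of "- (a - b)"] by linarith+
  then have "0 \<le> R + S" "0 \<le> R - S"
    unfolding plus minus by (simp_all only: mult_nonneg_nonneg exp_ge_zero)
  then show "\<bar>S\<bar> \<le> R" by linarith
  assume "R = 0"
  with \<open>0 \<le> R + S\<close> \<open>0 \<le> R - S\<close> have "R + S = 0" by linarith
  then have "a - b = exp (a - b) - 1" unfolding plus by simp
  then have "ln (exp (a - b)) = exp (a - b) - 1" by (simp only: ln_exp)
  then have "exp (a - b) = 1" by (intro ln_eq_minus_one) auto
  then show "a = b" by simp
qed

lemma cosh_remainder_deriv:
  fixes h1 h2 :: "real \<Rightarrow> real"
  assumes "(h1 has_real_derivative k1) (at t within A)" "(h2 has_real_derivative k2) (at t within A)"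
  shows "((\<lambda>t. cosh (h1 t) - cosh (h2 t) - sinh (h2 t) * (h1 t - h2 t)) has_real_derivative
     (sinh (h1 t) - sinh (h2 t)) * (k1 - k2) + k2 * (sinh (h1 t) - sinh (h2 t) - cosh (h2 t) * (h1 t - h2 t)))
     (at t within A)"
proof -
  have "((\<lambda>t. cosh (h1 t) - cosh (h2 t) - sinh (h2 t) * (h1 t - h2 t)) has_real_derivative
     sinh (h1 t) * k1 - sinh (h2 t) * k2 - (cosh (h2 t) * k2 * (h1 t - h2 t) + (k1 - k2) * sinh (h2 t)))
     (at t within A)"
    by (rule derivative_eq_intros assms refl)+
  then show ?thesis by (simp add: algebra_simps)
qed

lemma DERIV_nonpos_imp_le:
  fixes f f' :: "real \<Rightarrow> real"
  assumes f: "\<And>s. s \<in> {a..b} \<Longrightarrow> (f has_real_derivative f' s) (at s within {a..b})"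
    and le: "\<And>s. s \<in> {a..b} \<Longrightarrow> f' s \<le> 0" and t: "t \<in> {a..b}"
  shows "f t \<le> f a"
proof (cases "t = a")
  case False
  then have "a < t" using t by simp
  have "(f has_derivative (*) (f' s)) (at s within {a..t})" if "a \<le> s" "s \<le> t" for s
    using DERIV_subset[OF f, of s "{a..t}"] that t by (simp add: has_field_derivative_def)
  from mvt_simple[OF \<open>a < t\<close> this] obtain z where z: "z \<in> {a<..<t}" "f t - f a = f' z * (t - a)"
    by blast
  moreover have "f' z * (t - a) \<le> 0"
    using le[of z] z t by (intro mult_nonpos_nonneg) auto
  ultimately show ?thesis by linarith
qed simp

lemma integral_nonneg_eq_0_imp_0:
  fixes f :: "real \<Rightarrow> real"
  assumes f: "continuous_on {a..b} f" "\<And>x. x \<in> {a..b} \<Longrightarrow> 0 \<le> f x" and i: "integral {a..b} f = 0"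
    and ab: "a < b" and x: "x \<in> {a..b}"
  shows "f x = 0"
proof (rule has_integral_0_cbox_imp_0[of a b f])
  have "(f has_integral integral {a..b} f) {a..b}"
    by (intro integrable_integral integrable_continuous_real f)
  then show "(f has_integral 0) (cbox a b)" using i by simp
qed (use f ab x in auto)

text \<open>
Uniqueness for \<open>h\<^sub>t = P\<close>, \<open>P\<^sub>y = 2 sinh h\<close> on \<open>[a, \<infinity>) \<times> [0, T]\<close> with given \<open>h(\<cdot>, 0)\<close>.  With
\<open>\<kappa> = P1 - P2\<close> and the relative energy density \<open>R = cosh h1 - cosh h2 - sinh h2 (h1 - h2)\<close>,
\<open>R\<^sub>t = (\<kappa>\<^sup>2 / 4)\<^sub>y + P2 S\<close> and \<open>\<bar>S\<bar> \<le> R\<close>.  By Gronwall, \<open>\<integral>\<^sub>a\<^sup>Z R\<close> is at most a constant times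
\<open>\<integral>\<^sub>0\<^sup>T \<kappa>(Z, t)\<^sup>2 dt\<close>.  The left side is nondecreasing in \<open>Z\<close>, while the right side is integrable in
\<open>Z\<close> by the \<open>L\<^sup>2\<close> bounds on \<open>P1\<close> and \<open>P2\<close>; hence the left side vanishes.
\<close>

lemma sinh_gordon_unique:
  fixes h1 h2 P1 P2 :: "real \<Rightarrow> real \<Rightarrow> real"
  assumes T: "0 < T"
    and h1: "\<And>y t. \<lbrakk>a \<le> y; t \<in> {0..T}\<rbrakk> \<Longrightarrow> ((\<lambda>t. h1 y t) has_real_derivative P1 y t) (at t within {0..T})"
    and h2: "\<And>y t. \<lbrakk>a \<le> y; t \<in> {0..T}\<rbrakk> \<Longrightarrow> ((\<lambda>t. h2 y t) has_real_derivative P2 y t) (at t within {0..T})"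
    and P1: "\<And>y t. \<lbrakk>a \<le> y; t \<in> {0..T}\<rbrakk> \<Longrightarrow> ((\<lambda>y. P1 y t) has_real_derivative 2 * sinh (h1 y t)) (at y within {a..})"
    and P2: "\<And>y t. \<lbrakk>a \<le> y; t \<in> {0..T}\<rbrakk> \<Longrightarrow> ((\<lambda>y. P2 y t) has_real_derivative 2 * sinh (h2 y t)) (at y within {a..})"
    and ch: "continuous_on ({a..} \<times> {0..T}) (\<lambda>(y, t). h1 y t)" "continuous_on ({a..} \<times> {0..T}) (\<lambda>(y, t). h2 y t)"
    and cP: "continuous_on ({a..} \<times> {0..T}) (\<lambda>(y, t). P1 y t)" "continuous_on ({a..} \<times> {0..T}) (\<lambda>(y, t). P2 y t)"
    and B: "\<And>y t. \<lbrakk>a \<le> y; t \<in> {0..T}\<rbrakk> \<Longrightarrow> \<bar>P2 y t\<bar> \<le> B"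
    and N1: "\<And>b c t. \<lbrakk>a \<le> b; b \<le> c; t \<in> {0..T}\<rbrakk> \<Longrightarrow> integral {b..c} (\<lambda>y. (P1 y t)\<^sup>2) \<le> N"
    and N2: "\<And>b c t. \<lbrakk>a \<le> b; b \<le> c; t \<in> {0..T}\<rbrakk> \<Longrightarrow> integral {b..c} (\<lambda>y. (P2 y t)\<^sup>2) \<le> N"
    and init: "\<And>y. a \<le> y \<Longrightarrow> h1 y 0 = h2 y 0"
    and y0: "a \<le> y0" and t0: "t0 \<in> {0..T}"
  shows "h1 y0 t0 = h2 y0 t0"
proof -
  let ?D = "{a..} \<times> {0..T}"
  define R where "R = (\<lambda>y t. cosh (h1 y t) - cosh (h2 y t) - sinh (h2 y t) * (h1 y t - h2 y t))"
  define S where "S = (\<lambda>y t. sinh (h1 y t) - sinh (h2 y t) - cosh (h2 y t) * (h1 y t - h2 y t))"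
  define \<kappa> where "\<kappa> = (\<lambda>y t. P1 y t - P2 y t)"
  define d where "d = (\<lambda>y t. sinh (h1 y t) - sinh (h2 y t))"
  have S_le: "\<bar>S y t\<bar> \<le> R y t" for y t
    unfolding R_def S_def by (rule exp_convexity_remainders(1))
  have R0: "0 \<le> R y t" for y t using S_le[of y t] abs_ge_zero[of "S y t"] by linarith
  note cc = ch[unfolded case_prod_beta'] cP[unfolded case_prod_beta']
  have c\<kappa>: "continuous_on ?D (\<lambda>(y, t). \<kappa> y t)"
    unfolding \<kappa>_def case_prod_beta' by (intro continuous_intros cc)
  have cR: "continuous_on ?D (\<lambda>(y, t). R y t)"
    unfolding R_def case_prod_beta' by (intro continuous_intros cc)
  have cS: "continuous_on ?D (\<lambda>(y, t). S y t)"
    unfolding S_def case_prod_beta' by (intro continuous_intros cc)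
  have cd: "continuous_on ?D (\<lambda>(y, t). d y t)"
    unfolding d_def case_prod_beta' by (intro continuous_intros cc)
  have cRt: "continuous_on ?D (\<lambda>(y, t). d y t * \<kappa> y t + P2 y t * S y t)"
    using cd c\<kappa> cP(2) cS unfolding case_prod_beta' by (intro continuous_intros)
  have R_t: "((\<lambda>t. R y t) has_real_derivative d y t * \<kappa> y t + P2 y t * S y t) (at t within {0..T})"
    if "a \<le> y" "t \<in> {0..T}" for y t
    unfolding R_def d_def \<kappa>_def S_def by (rule cosh_remainder_deriv[OF h1[OF that] h2[OF that]])
  have \<kappa>_y: "((\<lambda>y. (\<kappa> y t)\<^sup>2 / 4) has_real_derivative d y t * \<kappa> y t) (at y within {a..})"
    if "a \<le> y" "t \<in> {0..T}" for y t
  proof -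
    have "((\<lambda>y. \<kappa> y t) has_real_derivative 2 * d y t) (at y within {a..})"
      unfolding \<kappa>_def d_def using DERIV_diff[OF P1[OF that] P2[OF that]] by (simp add: right_diff_distrib)
    then show ?thesis by (auto intro!: derivative_eq_intros)
  qed
  have slice: "continuous_on {b..c} (\<lambda>y. f y t)"
    if "continuous_on ?D (\<lambda>(y, t). f y t)" "t \<in> {0..T}" "a \<le> b" for f :: "real \<Rightarrow> real \<Rightarrow> real" and b c t
    by (rule continuous_on_subset[OF continuous_on_slice_x[OF that(1,2)]]) (use that(3) in auto)
  have B0: "0 \<le> B" using B[OF y0 t0] by simp
  define I where "I = (\<lambda>Z t. integral {a..Z} (\<lambda>y. R y t))"
  define J where "J = (\<lambda>Z. integral {0..T} (\<lambda>t. (\<kappa> Z t)\<^sup>2))"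
  have I_le: "I Z t \<le> exp (B * T) * (J Z / 4)" if Z: "a \<le> Z" and t: "t \<in> {0..T}" for Z t
  proof -
    have c\<kappa>Z: "continuous_on {0..T} (\<lambda>t. (\<kappa> Z t)\<^sup>2 / 4)"
      using continuous_on_slice_t[OF c\<kappa>, of Z] Z by (intro continuous_intros) auto
    have I_t: "((\<lambda>t. I Z t) has_real_derivative
        ((\<kappa> Z t)\<^sup>2 / 4 - (\<kappa> a t)\<^sup>2 / 4) + integral {a..Z} (\<lambda>y. P2 y t * S y t)) (at t within {0..T})"
      if t: "t \<in> {0..T}" for t
    proof -
      have "((\<lambda>t. I Z t) has_real_derivative integral {a..Z} (\<lambda>y. d y t * \<kappa> y t + P2 y t * S y t)) (at t within {0..T})"
        unfolding I_def
        by (rule integral_has_real_derivative_parameter[OF R_t _ _ t])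
           (auto intro: slice[OF cR] continuous_on_subset[OF cRt])
      also have "integral {a..Z} (\<lambda>y. d y t * \<kappa> y t + P2 y t * S y t)
          = integral {a..Z} (\<lambda>y. d y t * \<kappa> y t) + integral {a..Z} (\<lambda>y. P2 y t * S y t)"
        by (intro Henstock_Kurzweil_Integration.integral_add integrable_continuous_real continuous_intros
            slice[OF cd t] slice[OF c\<kappa> t] slice[OF cP(2) t] slice[OF cS t] order_refl)
      also have "integral {a..Z} (\<lambda>y. d y t * \<kappa> y t) = (\<kappa> Z t)\<^sup>2 / 4 - (\<kappa> a t)\<^sup>2 / 4"
        by (rule integral_eq_diff_of_derivative[OF Z]) (auto intro!: DERIV_subset[OF \<kappa>_y] t)
      finally show ?thesis .
    qed
    have src: "integral {a..Z} (\<lambda>y. P2 y t * S y t) \<le> B * I Z t" if t: "t \<in> {0..T}" for t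
    proof -
      have "integral {a..Z} (\<lambda>y. P2 y t * S y t) \<le> integral {a..Z} (\<lambda>y. B * R y t)"
      proof (rule integral_le)
        fix y assume "y \<in> {a..Z}"
        then have "\<bar>P2 y t\<bar> * \<bar>S y t\<bar> \<le> B * R y t"
          using B[of y t] t S_le[of y t] B0 by (intro mult_mono) auto
        then show "P2 y t * S y t \<le> B * R y t"
          by (metis abs_le_D1 abs_mult)
      qed (auto intro!: integrable_continuous_real continuous_intros slice[OF cP(2) t] slice[OF cS t] slice[OF cR t])
      then show ?thesis by (simp add: I_def)
    qed
    \<comment> \<open>Gronwall: \<open>V\<close> is nonincreasing and starts at \<open>0\<close>.\<close>
    define V where "V = (\<lambda>t. exp (- B * t) * I Z t - integral {0..t} (\<lambda>s. (\<kappa> Z s)\<^sup>2 / 4))"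
    define V' where "V' = (\<lambda>t. - B * exp (- B * t) * I Z t + exp (- B * t) *
        (((\<kappa> Z t)\<^sup>2 / 4 - (\<kappa> a t)\<^sup>2 / 4) + integral {a..Z} (\<lambda>y. P2 y t * S y t)) - (\<kappa> Z t)\<^sup>2 / 4)"
    have V_t: "(V has_real_derivative V' t) (at t within {0..T})" if t: "t \<in> {0..T}" for t
      unfolding V_def V'_def
      by (rule derivative_eq_intros I_t[OF t] integral_has_real_derivative[OF c\<kappa>Z t] refl)+ (simp add: algebra_simps)
    have V'_le: "V' t \<le> 0" if t: "t \<in> {0..T}" for t
    proof -
      have e: "0 < exp (- B * t)" "exp (- B * t) \<le> 1" using B0 t by auto
      have "V' t = exp (- B * t) * (integral {a..Z} (\<lambda>y. P2 y t * S y t) - B * I Z t)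
          + (exp (- B * t) - 1) * ((\<kappa> Z t)\<^sup>2 / 4) - exp (- B * t) * ((\<kappa> a t)\<^sup>2 / 4)"
        unfolding V'_def by (simp add: field_simps)
      moreover have "exp (- B * t) * (integral {a..Z} (\<lambda>y. P2 y t * S y t) - B * I Z t) \<le> 0"
        using e src[OF t] by (intro mult_nonneg_nonpos) auto
      moreover have "(exp (- B * t) - 1) * ((\<kappa> Z t)\<^sup>2 / 4) \<le> 0"
        using e by (intro mult_nonpos_nonneg) auto
      moreover have "0 \<le> exp (- B * t) * ((\<kappa> a t)\<^sup>2 / 4)" by simp
      ultimately show ?thesis by linarith
    qed
    have "I Z 0 = integral {a..Z} (\<lambda>y. 0)"
      unfolding I_def by (intro Henstock_Kurzweil_Integration.integral_cong) (simp add: R_def init)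
    then have "V 0 = 0" by (simp add: V_def)
    then have "V t \<le> 0" using DERIV_nonpos_imp_le[OF V_t V'_le t] by simp
    then have "exp (- B * t) * I Z t \<le> integral {0..t} (\<lambda>s. (\<kappa> Z s)\<^sup>2 / 4)" by (simp add: V_def)
    also have "\<dots> \<le> integral {0..T} (\<lambda>s. (\<kappa> Z s)\<^sup>2 / 4)"
      using t by (intro integral_subset_le integrable_continuous_real continuous_on_subset[OF c\<kappa>Z]) auto
    also have "\<dots> = J Z / 4" by (simp add: J_def)
    finally have "exp (B * t) * (exp (- B * t) * I Z t) \<le> exp (B * t) * (J Z / 4)"
      by (intro mult_left_mono) auto
    also have "\<dots> \<le> exp (B * T) * (J Z / 4)"
    proof (rule mult_right_mono)
      show "exp (B * t) \<le> exp (B * T)" using B0 t by (simp add: mult_left_mono)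
      have "0 \<le> J Z"
        unfolding J_def using continuous_on_slice_t[OF c\<kappa>, of Z] Z
        by (intro Henstock_Kurzweil_Integration.integral_nonneg integrable_continuous_real continuous_intros) auto
      then show "0 \<le> J Z / 4" by simp
    qed
    also have "exp (B * t) * (exp (- B * t) * I Z t) = I Z t"
      by (simp flip: exp_add mult.assoc)
    finally show ?thesis .
  qed
  define A where "A = y0 + 1"
  have A: "a < A" "y0 < A" using y0 by (auto simp: A_def)
  \<comment> \<open>Average the bound over \<open>Z\<close> in an interval of length \<open>n\<close> and let \<open>n\<close> grow.\<close>
  have ID: "real n * I A t0 \<le> exp (B * T) * (N * T)" for n
  proof -
    let ?K = "{A..A + real n}"
    have sub: "?K \<times> {0..T} \<subseteq> ?D" using A by auto
    have cJ: "continuous_on (cbox (A, 0) (A + real n, T)) (\<lambda>(Z, t). (\<kappa> Z t)\<^sup>2)"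
    proof -
      have "continuous_on ?D (\<lambda>(Z, t). (\<kappa> Z t)\<^sup>2)"
        using c\<kappa> unfolding case_prod_beta' by (intro continuous_intros)
      then show ?thesis by (rule continuous_on_subset) (use sub in \<open>auto simp: cbox_Pair_eq\<close>)
    qed
    have J_int: "J integrable_on ?K"
    proof -
      have "continuous_on (cbox A (A + real n)) (\<lambda>Z. integral (cbox 0 T) (\<lambda>t. (\<kappa> Z t)\<^sup>2))"
        by (rule integral_continuous_on_param) (use cJ in \<open>simp add: cbox_Pair_eq\<close>)
      then show ?thesis unfolding J_def by (intro integrable_continuous_real) simp
    qed
    have "integral ?K J = integral {0..T} (\<lambda>t. integral ?K (\<lambda>Z. (\<kappa> Z t)\<^sup>2))"
      unfolding J_def using integral_swap_continuous[OF cJ] by simp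
    also have "\<dots> \<le> integral {0..T} (\<lambda>t. 4 * N)"
    proof (rule integral_le)
      have "continuous_on (cbox 0 T) (\<lambda>t. integral (cbox A (A + real n)) (\<lambda>Z. (\<kappa> Z t)\<^sup>2))"
        by (rule integral_continuous_on_param)
           (use continuous_on_swap_args[of "cbox A (A + real n)" "cbox 0 T" "\<lambda>Z t. (\<kappa> Z t)\<^sup>2"] cJ in \<open>simp add: cbox_Pair_eq\<close>)
      then show "(\<lambda>t. integral ?K (\<lambda>Z. (\<kappa> Z t)\<^sup>2)) integrable_on {0..T}"
        by (intro integrable_continuous_real) simp
      fix t assume t: "t \<in> {0..T}"
      have aA: "a \<le> A" using A by simp
      have "integral ?K (\<lambda>Z. (\<kappa> Z t)\<^sup>2) \<le> integral ?K (\<lambda>Z. 2 * (P1 Z t)\<^sup>2 + 2 * (P2 Z t)\<^sup>2)"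
      proof (rule integral_le)
        fix Z
        show "(\<kappa> Z t)\<^sup>2 \<le> 2 * (P1 Z t)\<^sup>2 + 2 * (P2 Z t)\<^sup>2"
          using zero_le_power2[of "P1 Z t + P2 Z t"] by (simp add: \<kappa>_def power2_diff power2_sum)
      qed (auto intro!: integrable_continuous_real continuous_intros slice[OF c\<kappa> t aA] slice[OF cP(1) t aA] slice[OF cP(2) t aA])
      also have "\<dots> = integral ?K (\<lambda>Z. 2 * (P1 Z t)\<^sup>2) + integral ?K (\<lambda>Z. 2 * (P2 Z t)\<^sup>2)"
        by (intro Henstock_Kurzweil_Integration.integral_add integrable_continuous_real continuous_intros slice[OF cP(1) t aA] slice[OF cP(2) t aA])
      also have "\<dots> \<le> 2 * N + 2 * N"
        using N1[OF aA _ t, of "A + real n"] N2[OF aA _ t, of "A + real n"] by simp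
      finally show "integral ?K (\<lambda>Z. (\<kappa> Z t)\<^sup>2) \<le> 4 * N" by simp
    qed auto
    finally have J_le: "integral ?K J \<le> 4 * N * T" using T by (simp add: mult.commute mult.left_commute)
    have "I A t0 * (A + real n - A) \<le> integral ?K (\<lambda>Z. exp (B * T) * (J Z / 4))"
    proof (rule const_le_integral)
      show "(\<lambda>Z. exp (B * T) * (J Z / 4)) integrable_on ?K"
        using integrable_cmul[OF J_int, of "exp (B * T) / 4"] by simp
      fix Z assume Z: "Z \<in> ?K"
      have "I A t0 \<le> I Z t0"
        unfolding I_def using Z A
        by (intro integral_subset_le integrable_continuous_real slice[OF cR t0]) (auto simp: R0)
      also have "\<dots> \<le> exp (B * T) * (J Z / 4)"
        by (rule I_le[OF _ t0]) (use Z A in auto)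
      finally show "I A t0 \<le> exp (B * T) * (J Z / 4)" .
    qed auto
    also have "\<dots> = exp (B * T) / 4 * integral ?K J" by simp
    also have "\<dots> \<le> exp (B * T) / 4 * (4 * N * T)" by (intro mult_left_mono J_le) auto
    finally show ?thesis by (simp add: mult.commute)
  qed
  have "I A t0 \<le> 0"
  proof (rule ccontr)
    assume "\<not> I A t0 \<le> 0"
    then obtain n where "exp (B * T) * (N * T) < real n * I A t0"
      using reals_Archimedean3[of "I A t0"] by auto
    then show False using ID[of n] by simp
  qed
  moreover have "0 \<le> I A t0"
    unfolding I_def by (intro Henstock_Kurzweil_Integration.integral_nonneg integrable_continuous_real slice[OF cR t0]) (auto simp: R0)
  ultimately have "integral {a..A} (\<lambda>y. R y t0) = 0" by (simp add: I_def)
  then have "R y0 t0 = 0"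
    by (rule integral_nonneg_eq_0_imp_0[rotated 2]) (use A y0 in \<open>auto intro: slice[OF cR t0] R0\<close>)
  then show ?thesis unfolding R_def by (rule exp_convexity_remainders(2))
qed

section \<open>Uniqueness for the Short Wave equation\<close>

lemma at_within_Icc_neq_bot:
  fixes t T :: real
  assumes "0 < T" "t \<in> {0..T}"
  shows "at t within {0..T} \<noteq> bot"
  using assms by (simp add: trivial_limit_within islimpt_Icc)

text \<open>
On the labels present in both flows, \<open>sinh_gordon_unique\<close> gives equal stretchings.  The particle
positions then differ by a function \<open>d\<close> of \<open>t\<close> alone, whose derivative is the difference of the
velocities; that difference does not depend on the label and tends to \<open>0\<close> for large labels.
\<close>

lemma eulerian_unique:
  assumes s1: "short_wave T u1 p1 q1 r1 ut1 pt1 qt1" and s2: "short_wave T u2 p2 q2 r2 ut2 pt2 qt2"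
    and init: "\<And>x. 0 \<le> x \<Longrightarrow> u1 x 0 = u2 x 0" and x: "0 \<le> x"
  shows "u1 x T = u2 x T"
proof -
  interpret s1: short_wave T u1 p1 q1 r1 ut1 pt1 qt1 by (rule s1)
  interpret s2: short_wave T u2 p2 q2 r2 ut2 pt2 qt2 by (rule s2)
  note T = s1.T_pos
  have z: "0 \<in> {0..T}" and TT: "T \<in> {0..T}" using T by auto
  have eq_deriv: "f' x = g' x"
    if "\<And>x. 0 \<le> x \<Longrightarrow> f x = g x" "(f has_real_derivative f' x) (at x within {0..})"
       "(g has_real_derivative g' x) (at x within {0..})" "0 \<le> x" for f g f' g' :: "real \<Rightarrow> real" and x
  proof -
    have "(g has_real_derivative f' x) (at x within {0..})"
      by (rule has_field_derivative_transform_within[OF that(2), of 1]) (use that in auto)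
    then show ?thesis
      using has_field_derivative_unique[OF _ that(3)] at_within_Ici_neq_bot[OF that(4)] by blast
  qed
  have p0: "p1 x 0 = p2 x 0" if "0 \<le> x" for x
    by (rule eq_deriv[where f = "\<lambda>x. u1 x 0" and g = "\<lambda>x. u2 x 0" and f' = "\<lambda>x. p1 x 0" and g' = "\<lambda>x. p2 x 0",
          OF init s1.u_x[OF that z] s2.u_x[OF that z] that])
  have q0: "q1 x 0 = q2 x 0" if "0 \<le> x" for x
    by (rule eq_deriv[where f = "\<lambda>x. p1 x 0" and g = "\<lambda>x. p2 x 0" and f' = "\<lambda>x. q1 x 0" and g' = "\<lambda>x. q2 x 0",
          OF p0 s1.p_x[OF that z] s2.p_x[OF that z] that])
  have sw0: "s1.sw x 0 = s2.sw x 0" if "0 \<le> x" for x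
    using q0[OF that] by (simp add: s1.sw_def s2.sw_def)
  have lag0: "s1.lag x 0 = s2.lag x 0" if "0 \<le> x" for x
    unfolding s1.lag_def s2.lag_def
    by (simp, intro Henstock_Kurzweil_Integration.integral_cong sw0) auto
  have pos0: "s1.pos y 0 = s2.pos y 0" if y: "0 \<le> y" for y
  proof -
    have "0 \<le> s1.pos y 0" "s1.lag (s1.pos y 0) 0 = y"
      using s1.pos_nonneg[OF z, of y] s1.lag_pos[OF z, of y] y by auto
    then show ?thesis
      using s2.pos_lag[OF z, of "s1.pos y 0"] lag0[of "s1.pos y 0"] by simp
  qed
  define a where "a = max (s1.lag0 T) (s2.lag0 T)"
  have dom: "y \<in> s1.lagdom" "y \<in> s2.lagdom" if "a \<le> y" for y
    using that by (auto simp: a_def)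
  have sub: "{a..} \<subseteq> s1.lagdom" "{a..} \<subseteq> s2.lagdom"
    by (auto simp: a_def)
  then have sub': "{a..} \<times> {0..T} \<subseteq> s1.lagdom \<times> {0..T}" "{a..} \<times> {0..T} \<subseteq> s2.lagdom \<times> {0..T}"
    by auto
  have a0: "0 \<le> a" using s1.lag0_mono[of 0 T] T by (simp add: a_def le_max_iff_disj)
  obtain B where B: "\<And>y t. y \<in> s2.lagdom \<Longrightarrow> t \<in> {0..T} \<Longrightarrow> \<bar>s2.pl y t\<bar> \<le> B"
    using s2.pl_bounded by blast
  obtain N1 where N1: "\<And>t a b. t \<in> {0..T} \<Longrightarrow> a \<in> s1.lagdom \<Longrightarrow> a \<le> b \<Longrightarrow> integral {a..b} (\<lambda>y. (s1.pl y t)\<^sup>2) \<le> N1"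
    using s1.pl_L2 by blast
  obtain N2 where N2: "\<And>t a b. t \<in> {0..T} \<Longrightarrow> a \<in> s2.lagdom \<Longrightarrow> a \<le> b \<Longrightarrow> integral {a..b} (\<lambda>y. (s2.pl y t)\<^sup>2) \<le> N2"
    using s2.pl_L2 by blast
  have hl: "s1.hl y t = s2.hl y t" if y: "a \<le> y" and t: "t \<in> {0..T}" for y t
  proof (rule sinh_gordon_unique[OF T, where a = a and ?h1.0 = s1.hl and ?h2.0 = s2.hl and ?P1.0 = s1.pl and ?P2.0 = s2.pl and B = B and N = "max N1 N2"])
    fix y t assume yt: "a \<le> y" "t \<in> {0..T}"
    show "((\<lambda>t. s1.hl y t) has_real_derivative s1.pl y t) (at t within {0..T})"
      by (rule s1.hl_t[OF dom(1) yt(2)]) (rule yt)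
    show "((\<lambda>t. s2.hl y t) has_real_derivative s2.pl y t) (at t within {0..T})"
      by (rule s2.hl_t[OF dom(2) yt(2)]) (rule yt)
    show "((\<lambda>y. s1.pl y t) has_real_derivative 2 * sinh (s1.hl y t)) (at y within {a..})"
      by (rule DERIV_subset[OF s1.pl_y[OF dom(1) yt(2)] sub(1)]) (rule yt)
    show "((\<lambda>y. s2.pl y t) has_real_derivative 2 * sinh (s2.hl y t)) (at y within {a..})"
      by (rule DERIV_subset[OF s2.pl_y[OF dom(2) yt(2)] sub(2)]) (rule yt)
    show "\<bar>s2.pl y t\<bar> \<le> B" by (rule B[OF dom(2) yt(2)]) (rule yt)
  next
    fix b c t assume bc: "a \<le> b" "b \<le> c" "t \<in> {0..T}"
    show "integral {b..c} (\<lambda>y. (s1.pl y t)\<^sup>2) \<le> max N1 N2"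
      using N1[OF bc(3) dom(1)[OF bc(1)] bc(2)] by simp
    show "integral {b..c} (\<lambda>y. (s2.pl y t)\<^sup>2) \<le> max N1 N2"
      using N2[OF bc(3) dom(2)[OF bc(1)] bc(2)] by simp
  next
    fix y assume "a \<le> y"
    then have y: "0 \<le> y" using a0 by simp
    have "0 \<le> s2.pos y 0" using s2.pos_nonneg[OF z, of y] y by simp
    then show "s1.hl y 0 = s2.hl y 0"
      unfolding s1.hl_def s2.hl_def pos0[OF y] by (simp add: sw0)
  qed (use y t in \<open>auto intro: continuous_on_subset[OF s1.hl_cont sub'(1)] continuous_on_subset[OF s2.hl_cont sub'(2)]
        continuous_on_subset[OF s1.pl_cont sub'(1)] continuous_on_subset[OF s2.pl_cont sub'(2)]\<close>)
  have sw: "s1.sw (s1.pos y t) t = s2.sw (s2.pos y t) t" if y: "a \<le> y" and t: "t \<in> {0..T}" for y t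
    using hl[OF y t] s1.sw_pos_lag[OF dom(1)[OF y] t] s2.sw_pos_lag[OF dom(2)[OF y] t]
    by (simp add: s1.hl_def s2.hl_def)
  define d where "d = (\<lambda>y t. s1.pos y t - s2.pos y t)"
  define v where "v = (\<lambda>y t. u1 (s1.pos y t) t - u2 (s2.pos y t) t)"
  have d_y: "d y t = d a t" if y: "a \<le> y" and t: "t \<in> {0..T}" for y t
  proof -
    have "((\<lambda>y. d y t) has_real_derivative 0) (at y within {a..})" if "y \<in> {a..}" for y
    proof -
      have y: "a \<le> y" using that by simp
      show ?thesis
        using DERIV_diff[OF DERIV_subset[OF s1.pos_y[OF dom(1)[OF y] t] sub(1)]
            DERIV_subset[OF s2.pos_y[OF dom(2)[OF y] t] sub(2)]] sw[OF y t]
        by (simp add: d_def)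
    qed
    then obtain k where "\<forall>y\<in>{a..}. d y t = k"
      using has_field_derivative_zero_constant[of "{a..}" "\<lambda>y. d y t"] by auto
    then show ?thesis using y by simp
  qed
  have d_t: "((\<lambda>t. d y t) has_real_derivative v y t) (at t within {0..T})" if y: "a \<le> y" and t: "t \<in> {0..T}" for y t
    unfolding d_def v_def
    by (rule DERIV_diff[OF s1.pos_t[OF dom(1)[OF y] t] s2.pos_t[OF dom(2)[OF y] t]])
  have v_y: "v y t = v a t" if y: "a \<le> y" and t: "t \<in> {0..T}" for y t
  proof -
    have "((\<lambda>t. d a t) has_real_derivative v y t) (at t within {0..T})"
      by (rule has_field_derivative_transform_within[OF d_t[OF y t], of 1]) (use t d_y[OF y] in auto)
    then show ?thesis
      using has_field_derivative_unique[OF _ d_t[OF order_refl t] at_within_Icc_neq_bot[OF T t]] by blast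
  qed
  have v0: "v y t = 0" if y: "a \<le> y" and t: "t \<in> {0..T}" for y t
  proof -
    have "((\<lambda>y. v y t) \<longlongrightarrow> 0 - 0) at_top"
      unfolding v_def by (intro tendsto_diff s1.u_pos_tendsto_0 s2.u_pos_tendsto_0 t)
    moreover have "\<forall>\<^sub>F y in at_top. v y t = v a t"
      unfolding eventually_at_top_linorder using v_y[OF _ t] by blast
    ultimately have "((\<lambda>_::real. v a t) \<longlongrightarrow> 0) at_top"
      by (simp add: tendsto_cong)
    then have "v a t = 0" by (simp add: tendsto_const_iff)
    then show ?thesis using v_y[OF y t] by simp
  qed
  have d0: "d y T = 0" if y: "a \<le> y" for y
  proof -
    have "((\<lambda>t. d y t) has_real_derivative 0) (at t within {0..T})" if "t \<in> {0..T}" for t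
      using d_t[OF y that] v0[OF y that] by simp
    then obtain k where "\<forall>t\<in>{0..T}. d y t = k"
      using has_field_derivative_zero_constant[of "{0..T}" "\<lambda>t. d y t"] by auto
    then have "d y T = d y 0" using z TT by simp
    also have "\<dots> = 0" using pos0[of y] y a0 by (simp add: d_def)
    finally show ?thesis .
  qed
  \<comment> \<open>The particle at the boundary in one flow is there in the other flow as well.\<close>
  have lag0_a: "s1.lag0 T = a"
  proof (cases "s1.lag0 T = a")
    case False
    then have "a = s2.lag 0 T" by (auto simp: a_def max_def split: if_splits)
    then have "s2.pos a T = 0" using s2.pos_lag[OF TT order_refl] by simp
    then have "s1.pos a T = 0" using d0[OF order_refl] by (simp add: d_def)
    then show ?thesis
      using s1.lag_pos[OF TT, of a] by (simp add: a_def)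
  qed
  define y where "y = s1.lag x T"
  have y: "a \<le> y" using s1.lag0_le_lag[OF TT x] by (simp add: y_def lag0_a)
  have "s1.pos y T = x" unfolding y_def by (rule s1.pos_lag[OF TT x])
  moreover from this have "s2.pos y T = x" using d0[OF y] by (simp add: d_def)
  ultimately show ?thesis using v0[OF y TT] by (simp add: v_def)
qed

lemma cont_partial_x_has_real_derivative:
  assumes "cont_partial_x T u" "0 \<le> x" "t \<in> {0..T}"
  shows "((\<lambda>x. u x t) has_real_derivative partial_x u x t) (at x within {0..})"
  using assms unfolding cont_partial_x_def partial_x_def
  by (simp add: has_real_derivative_iff_has_vector_derivative vector_derivative_works)

lemma cont_partial_t_has_real_derivative:
  assumes "cont_partial_t T u" "0 \<le> x" "t \<in> {0..T}"
  shows "((\<lambda>t. u x t) has_real_derivative partial_t T u x t) (at t within {0..T})"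
  using assms unfolding cont_partial_t_def partial_t_def
  by (simp add: has_real_derivative_iff_has_vector_derivative vector_derivative_works)

lemma C1_strip_mono:
  assumes f: "C1_strip T f fx ft" and T': "T' \<le> T"
  shows "C1_strip T' f fx ft"
proof -
  have sub: "{0..T'} \<subseteq> {0..T}" "{0..} \<times> {0..T'} \<subseteq> {0..} \<times> {0..T}" using T' by auto
  show ?thesis
    unfolding C1_strip_def
  proof (intro conjI allI impI ballI)
    fix x t :: real assume x: "0 \<le> x" and t: "t \<in> {0..T'}"
    then have t': "t \<in> {0..T}" using sub by blast
    have 1: "((\<lambda>x. f x t) has_real_derivative fx x t) (at x within {0..})"
      and 2: "((\<lambda>t. f x t) has_real_derivative ft x t) (at t within {0..T})"
      using f x t' unfolding C1_strip_def by blast+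
    show "((\<lambda>x. f x t) has_real_derivative fx x t) (at x within {0..})" by (rule 1)
    show "((\<lambda>t. f x t) has_real_derivative ft x t) (at t within {0..T'})" by (rule DERIV_subset[OF 2 sub(1)])
  next
    show "continuous_on ({0..} \<times> {0..T'}) (\<lambda>(x, t). fx x t)" "continuous_on ({0..} \<times> {0..T'}) (\<lambda>(x, t). ft x t)"
      using f unfolding C1_strip_def by (blast intro: continuous_on_subset[OF _ sub(2)])+
  qed
qed

text \<open>
A solution on \<open>[0, T]\<close> is restricted to \<open>[0, T']\<close>.  The time derivatives of \<open>u\<^sub>x\<close> and \<open>u\<^sub>x\<^sub>x\<close>, which
are not part of the notion of solution, come from \<open>mixed_partial_derivative\<close>.
\<close>

lemma short_wave_solution_imp_short_wave:
  assumes T': "0 < T'" "T' \<le> T" and sol: "short_wave_solution T u"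
    and reg: "\<And>t. t \<in> {0..T} \<Longrightarrow> (\<lambda>x. u x t) \<in> sobolev 4 {0<..} \<and>
       (\<lambda>x. partial_x (partial_x u) x t) \<in> weighted_sobolev 2 1 {0<..}"
    and pos: "\<And>x. 0 \<le> x \<Longrightarrow> 1 - partial_x (partial_x u) x 0 > 0"
    and bdry: "\<And>t. t \<in> {0..T} \<Longrightarrow> u 0 t \<le> 0"
  shows "short_wave T' u (partial_x u) (partial_x (partial_x u)) (partial_x (partial_x (partial_x u)))
     (partial_t T u) (partial_x (partial_t T u)) (partial_x (partial_x (partial_t T u)))"
proof -
  have cx: "cont_partial_x T u" "cont_partial_x T (partial_x u)" "cont_partial_x T (partial_x (partial_x u))"
    "cont_partial_t T u" "cont_partial_x T (partial_t T u)" "cont_partial_x T (partial_x (partial_t T u))"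
    and eq: "\<And>x t. \<lbrakk>0 \<le> x; t \<in> {0..T}\<rbrakk> \<Longrightarrow> partial_x (partial_x (partial_t T u)) x t
          - 2 * partial_x u x t + 2 * partial_x u x t * partial_x (partial_x u) x t
          + u x t * partial_x (partial_x (partial_x u)) x t = 0"
    using sol unfolding short_wave_solution_def by blast+
  note dx = cont_partial_x_has_real_derivative
  have cont: "continuous_on ({0..} \<times> {0..T}) (\<lambda>(x, t). partial_x f x t)" if "cont_partial_x T f" for f
    using that by (simp add: cont_partial_x_def)
  have u_C1: "C1_strip T u (partial_x u) (partial_t T u)"
    using dx[OF cx(1)] cont_partial_t_has_real_derivative[OF cx(4)] cont[OF cx(1)] cx(4)
    by (simp add: C1_strip_def cont_partial_t_def)
  have p_C1: "C1_strip T (partial_x u) (partial_x (partial_x u)) (partial_x (partial_t T u))"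
    using mixed_partial_derivative[OF u_C1 dx[OF cx(5)] cont[OF cx(5)]] dx[OF cx(2)] cont[OF cx(2)] cont[OF cx(5)]
    by (simp add: C1_strip_def)
  have q_C1: "C1_strip T (partial_x (partial_x u)) (partial_x (partial_x (partial_x u))) (partial_x (partial_x (partial_t T u)))"
    using mixed_partial_derivative[OF p_C1 dx[OF cx(6)] cont[OF cx(6)]] dx[OF cx(3)] cont[OF cx(3)] cont[OF cx(6)]
    by (simp add: C1_strip_def)
  have tT: "t \<in> {0..T}" if "t \<in> {0..T'}" for t using that T' by simp
  show ?thesis
  proof
    show "0 < T'" by (rule T')
    show "C1_strip T' u (partial_x u) (partial_t T u)"
      "C1_strip T' (partial_x u) (partial_x (partial_x u)) (partial_x (partial_t T u))"
      "C1_strip T' (partial_x (partial_x u)) (partial_x (partial_x (partial_x u))) (partial_x (partial_x (partial_t T u)))"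
      using u_C1 p_C1 q_C1 by (auto intro: C1_strip_mono[OF _ T'(2)])
    show "1 - partial_x (partial_x u) x 0 > 0" if "0 \<le> x" for x by (rule pos[OF that])
  next
    fix x t :: real assume x: "0 \<le> x" and t: "t \<in> {0..T'}"
    show "((\<lambda>x. partial_x (partial_t T u) x t) has_real_derivative partial_x (partial_x (partial_t T u)) x t) (at x within {0..})"
      by (rule dx[OF cx(6) x tT[OF t]])
    show "partial_x (partial_x (partial_t T u)) x t - 2 * partial_x u x t
       + 2 * partial_x u x t * partial_x (partial_x u) x t + u x t * partial_x (partial_x (partial_x u)) x t = 0"
      by (rule eq[OF x tT[OF t]])
  next
    fix t assume "t \<in> {0..T'}"
    then have t: "t \<in> {0..T}" by (rule tT)
    show "u 0 t \<le> 0" by (rule bdry[OF t])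
    show "\<exists>C\<ge>0. \<forall>x\<ge>0. integral {0..x} (\<lambda>z. (u z t)\<^sup>2) \<le> C"
      using reg[OF t] continuous_on_slice_x[OF C1_strip_continuous_on[OF u_C1] t]
      by (intro weighted_sobolev_square_integral_bounded) auto
    show "\<exists>C\<ge>0. \<forall>x\<ge>0. integral {0..x} (\<lambda>z. (partial_x (partial_x u) z t)\<^sup>2) \<le> C"
      using reg[OF t] continuous_on_slice_x[OF C1_strip_continuous_on[OF q_C1] t]
      by (intro weighted_sobolev_square_integral_bounded) auto
  qed
qed

theorem corollary7p7:
  fixes T :: real and u\<^sub>1 u\<^sub>2 :: "real \<Rightarrow> real \<Rightarrow> real"
  assumes T: "0 < T"
    and sol: "short_wave_solution T u\<^sub>1" "short_wave_solution T u\<^sub>2"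
    and reg: "\<And>u t. \<lbrakk>u \<in> {u\<^sub>1, u\<^sub>2}; t \<in> {0..T}\<rbrakk> \<Longrightarrow>
       (\<lambda>x. u x t) \<in> sobolev 4 {0<..} \<and>
       (\<lambda>x. partial_x (partial_x u) x t) \<in> weighted_sobolev 2 1 {0<..}"
    and pos: "\<And>u x. \<lbrakk>u \<in> {u\<^sub>1, u\<^sub>2}; 0 \<le> x\<rbrakk> \<Longrightarrow> 1 - partial_x (partial_x u) x 0 > 0"
    and bdry: "\<And>u t. \<lbrakk>u \<in> {u\<^sub>1, u\<^sub>2}; t \<in> {0..T}\<rbrakk> \<Longrightarrow> u 0 t \<le> 0"
    and init: "\<And>x. 0 \<le> x \<Longrightarrow> u\<^sub>1 x 0 = u\<^sub>2 x 0"
  shows "\<forall>x\<ge>0. \<forall>t. 0 \<le> t \<and> t < T \<longrightarrow> u\<^sub>1 x t = u\<^sub>2 x t"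
proof (intro allI impI)
  fix x t :: real assume x: "0 \<le> x" and t: "0 \<le> t \<and> t < T"
  show "u\<^sub>1 x t = u\<^sub>2 x t"
  proof (cases "t = 0")
    case True
    then show ?thesis using init[OF x] by simp
  next
    case False
    then have t': "0 < t" "t \<le> T" using t by auto
    show ?thesis
      by (rule eulerian_unique[OF short_wave_solution_imp_short_wave[OF t' sol(1)]
          short_wave_solution_imp_short_wave[OF t' sol(2)] init x]) (use reg pos bdry in auto)
  qed
qed

end
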